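(* Let $\overline{M}^{n+1}$ be a Riemannian manifold, let $N$ be a totally geodesic hypersurface of $\overline{M}$, and let $M^n=\mathbb{R}\times_fP^{n-1}$ be a warped product hypersurface in $\overline{M}$ with $\mathcal{H}'(t)\ge0$, where $\mathcal{H}(t)=f'(t)/f(t)$. Suppose that $M$ and $N$ are normal hypersurfaces such that $\Sigma^{n-1}=M\cap N$ is compact. Then $\Sigma$ is a totally geodesic slice of $M$ and $P$ is compact.
   Context: Superscripts denote dimensions. $M^n=\mathbb{R}\times_fP^{n-1}$ is the manifold $\mathbb{R}\times P$ with the metric $dt^2+f(t)^2g_P$, where $(P,g_P)$ is a Riemannian manifold and $f\colon\mathbb{R}\to\mathbb{R}^+$ is smooth; it is isometrically immersed as a hypersurface in $\overline{M}$. The slices of $M$ are the hypersurfaces $\Sigma_t=\{t\}\times P$, $t\in\mathbb{R}$. Two submanifolds $M$ and $N$ of a Riemannian manifold $\overline{M}$ are called normal submanifolds (normal hypersurfaces, when both are hypersurfaces) if (a) $M\cap N$ is a submanifold of $\overline{M}$, and (b) $T_pM\cap T_p^\perp(M\cap N)\subset T_p^\perp N$ for all $p\in M\cap N$, where $\perp$ denotes normal spaces in $\overline{M}$. For hypersurfaces this is equivalent to their unit normals being orthogonal along $M\cap N$.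
   Formalization: P and Σ are assumed connected and Σ nonempty (otherwise, with f = 1, N could meet M in two slices), and n ≥ 2; for non-injective immersions M ∩ N is taken as a subset of M and normality is required of every pair of sheets that meet. *)

theory Defs
  imports "HOL-Analysis.Analysis"
begin

section \<open>Smooth manifolds\<close>

text \<open>\<open>Ck_on\<close> and \<open>smooth_on\<close> are only meant for open sets.\<close>

primrec Ck_on :: "nat \<Rightarrow> 'e::euclidean_space set \<Rightarrow> ('e \<Rightarrow> 'f::euclidean_space) \<Rightarrow> bool" where
  "Ck_on 0 S f \<longleftrightarrow> continuous_on S f"
| "Ck_on (Suc k) S f \<longleftrightarrow>
     (\<forall>x\<in>S. f differentiable (at x)) \<and> (\<forall>v. Ck_on k S (\<lambda>x. frechet_derivative f (at x) v))"

definition smooth_on :: "'e::euclidean_space set \<Rightarrow> ('e \<Rightarrow> 'f::euclidean_space) \<Rightarrow> bool" where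
  "smooth_on S f \<longleftrightarrow> (\<forall>k. Ck_on k S f)"

text \<open>
  The points of a manifold are all the elements of a type; a chart is a domain together with a
  coordinate map into a Euclidean space, whose dimension is the dimension of the manifold (hence
  positive).  Hausdorffness and second countability are expressed by the sort of the point type.
  Connectedness is not built in.
\<close>

type_synonym ('a, 'e) chart = "'a set \<times> ('a \<Rightarrow> 'e)"

abbreviation dom_of :: "('a, 'e) chart \<Rightarrow> 'a set" where
  "dom_of c \<equiv> fst c"

abbreviation coord :: "('a, 'e) chart \<Rightarrow> 'a \<Rightarrow> 'e" where
  "coord c \<equiv> snd c"

definition param :: "('a, 'e) chart \<Rightarrow> 'e \<Rightarrow> 'a" where
  "param c = inv_into (dom_of c) (coord c)"

definition smooth_atlas ::
  "('a::{t2_space,second_countable_topology}, 'e::euclidean_space) chart set \<Rightarrow> bool" where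
  "smooth_atlas A \<longleftrightarrow>
     (\<Union>c\<in>A. dom_of c) = UNIV \<and>
     (\<forall>c\<in>A. open (dom_of c) \<and> open (coord c ` dom_of c) \<and>
        homeomorphism (dom_of c) (coord c ` dom_of c) (coord c) (param c)) \<and>
     (\<forall>c\<in>A. \<forall>d\<in>A. smooth_on (coord c ` (dom_of c \<inter> dom_of d)) (coord d \<circ> param c))"

definition smooth_map ::
  "('a::topological_space, 'e::euclidean_space) chart set \<Rightarrow>
   ('b::topological_space, 'f::euclidean_space) chart set \<Rightarrow> ('a \<Rightarrow> 'b) \<Rightarrow> bool" where
  "smooth_map A B \<psi> \<longleftrightarrow> continuous_on UNIV \<psi> \<and>
     (\<forall>c\<in>A. \<forall>d\<in>B. smooth_on (coord c ` (dom_of c \<inter> \<psi> -` dom_of d)) (coord d \<circ> \<psi> \<circ> param c))"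


section \<open>Tangent vectors\<close>

text \<open>
  A tangent vector at \<open>p\<close> is the family of its coordinate vectors in all the charts around \<open>p\<close>,
  related by the derivatives of the transition maps (and \<open>0\<close> for the other charts).
\<close>

type_synonym ('a, 'e) tvec = "('a, 'e) chart \<Rightarrow> 'e"

definition charts_at :: "('a, 'e) chart set \<Rightarrow> 'a \<Rightarrow> ('a, 'e) chart set" where
  "charts_at A p = {c \<in> A. p \<in> dom_of c}"

definition tangent_space ::
  "('a, 'e::euclidean_space) chart set \<Rightarrow> 'a \<Rightarrow> ('a, 'e) tvec set" where
  "tangent_space A p =
     {v. (\<forall>c\<in>charts_at A p. \<forall>d\<in>charts_at A p.
            v d = frechet_derivative (coord d \<circ> param c) (at (coord c p)) (v c)) \<and>
         (\<forall>c. c \<notin> charts_at A p \<longrightarrow> v c = 0)}"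

text \<open>The tangent vector at \<open>p\<close> whose coordinates in the chart \<open>c\<close> are \<open>u\<close>.\<close>

definition coord_vector ::
  "('a, 'e::euclidean_space) chart set \<Rightarrow> ('a, 'e) chart \<Rightarrow> 'a \<Rightarrow> 'e \<Rightarrow> ('a, 'e) tvec" where
  "coord_vector A c p u =
     (\<lambda>d. if d \<in> charts_at A p
          then frechet_derivative (coord d \<circ> param c) (at (coord c p)) u else 0)"

text \<open>On tangent vectors of \<open>A\<close> the choice of the chart \<open>c\<close> below is irrelevant by the chain rule.\<close>

definition differential ::
  "('a, 'e::euclidean_space) chart set \<Rightarrow> ('b, 'f::euclidean_space) chart set \<Rightarrow> ('a \<Rightarrow> 'b) \<Rightarrow> 'a \<Rightarrow>
   ('a, 'e) tvec \<Rightarrow> ('b, 'f) tvec" where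
  "differential A B \<psi> p v =
     (\<lambda>d. if d \<in> charts_at B (\<psi> p)
          then (let c = (SOME c. c \<in> charts_at A p)
                in frechet_derivative (coord d \<circ> \<psi> \<circ> param c) (at (coord c p)) (v c))
          else 0)"

definition immersion ::
  "('a::topological_space, 'e::euclidean_space) chart set \<Rightarrow>
   ('b::topological_space, 'f::euclidean_space) chart set \<Rightarrow> ('a \<Rightarrow> 'b) \<Rightarrow> bool" where
  "immersion A B \<psi> \<longleftrightarrow> smooth_map A B \<psi> \<and>
     (\<forall>p. inj_on (differential A B \<psi> p) (tangent_space A p))"

text \<open>The tangent space at \<open>p\<close>, inside the tangent space of the ambient manifold at \<open>\<psi> p\<close>, of a
  manifold immersed by \<open>\<psi>\<close>.\<close>

definition immersed_tangent_space ::
  "('a, 'e::euclidean_space) chart set \<Rightarrow> ('b, 'f::euclidean_space) chart set \<Rightarrow> ('a \<Rightarrow> 'b) \<Rightarrow> 'a \<Rightarrow>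
   ('b, 'f) tvec set" where
  "immersed_tangent_space A B \<psi> p = differential A B \<psi> p ` tangent_space A p"


section \<open>Riemannian metrics\<close>

type_synonym ('a, 'e) metric = "'a \<Rightarrow> ('a, 'e) tvec \<Rightarrow> ('a, 'e) tvec \<Rightarrow> real"

text \<open>The metric in the chart \<open>c\<close>, as a field of bilinear forms on \<open>coord c ` dom_of c\<close>.\<close>

definition metric_in_chart ::
  "('a, 'e::euclidean_space) chart set \<Rightarrow> ('a, 'e) metric \<Rightarrow> ('a, 'e) chart \<Rightarrow> 'e \<Rightarrow> 'e \<Rightarrow> 'e \<Rightarrow> real" where
  "metric_in_chart A g c z u v =
     g (param c z) (coord_vector A c (param c z) u) (coord_vector A c (param c z) v)"

definition riemannian_manifold ::
  "('a::{t2_space,second_countable_topology}, 'e::euclidean_space) chart set \<Rightarrow>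
   ('a, 'e) metric \<Rightarrow> bool" where
  "riemannian_manifold A g \<longleftrightarrow> smooth_atlas A \<and>
     (\<forall>c\<in>A.
        (\<forall>z\<in>coord c ` dom_of c.
           bilinear (metric_in_chart A g c z) \<and>
           (\<forall>u v. metric_in_chart A g c z u v = metric_in_chart A g c z v u) \<and>
           (\<forall>u. u \<noteq> 0 \<longrightarrow> metric_in_chart A g c z u u > 0)) \<and>
        (\<forall>u v. smooth_on (coord c ` dom_of c) (\<lambda>z. metric_in_chart A g c z u v)))"

definition orth_complement ::
  "('a, 'e::euclidean_space) chart set \<Rightarrow> ('a, 'e) metric \<Rightarrow> 'a \<Rightarrow> ('a, 'e) tvec set \<Rightarrow>
   ('a, 'e) tvec set" where
  "orth_complement A g p W = {v \<in> tangent_space A p. \<forall>w\<in>W. g p v w = 0}"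

definition isometric_immersion ::
  "('a::topological_space, 'e::euclidean_space) chart set \<Rightarrow> ('a, 'e) metric \<Rightarrow>
   ('b::topological_space, 'f::euclidean_space) chart set \<Rightarrow> ('b, 'f) metric \<Rightarrow> ('a \<Rightarrow> 'b) \<Rightarrow> bool" where
  "isometric_immersion A g B h \<psi> \<longleftrightarrow> immersion A B \<psi> \<and>
     (\<forall>p. \<forall>v\<in>tangent_space A p. \<forall>w\<in>tangent_space A p.
        h (\<psi> p) (differential A B \<psi> p v) (differential A B \<psi> p w) = g p v w)"


section \<open>Levi-Civita connection and second fundamental form\<close>

text \<open>
  The Christoffel symbols of the Levi-Civita connection in the chart \<open>c\<close>: the coordinates at \<open>z\<close> of
  the covariant derivative of the field with constant coordinates \<open>v\<close> in the direction \<open>u\<close>, as given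
  by the Koszul formula (the fields with constant coordinates commute).
\<close>

definition christoffel ::
  "('a, 'e::euclidean_space) chart set \<Rightarrow> ('a, 'e) metric \<Rightarrow> ('a, 'e) chart \<Rightarrow> 'e \<Rightarrow> 'e \<Rightarrow> 'e \<Rightarrow> 'e" where
  "christoffel A g c z u v =
     (THE k. \<forall>w. 2 * metric_in_chart A g c z k w =
        frechet_derivative (\<lambda>y. metric_in_chart A g c y v w) (at z) u +
        frechet_derivative (\<lambda>y. metric_in_chart A g c y u w) (at z) v -
        frechet_derivative (\<lambda>y. metric_in_chart A g c y u v) (at z) w)"

text \<open>
  For \<open>\<psi>\<close> from \<open>A\<close> into \<open>(B, h)\<close>, a chart \<open>c\<close> around \<open>q\<close> and a chart \<open>d\<close> around \<open>\<psi> q\<close>: the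
  coordinates in \<open>d\<close>, at \<open>\<psi> q\<close>, of the Levi-Civita derivative along \<open>\<psi>\<close>, in the direction of the
  vector with coordinates \<open>u\<close> in \<open>c\<close>, of the image under \<open>d\<psi>\<close> of the field with constant
  coordinates \<open>v\<close> in \<open>c\<close>.
\<close>

definition ambient_derivative ::
  "('b, 'f::euclidean_space) chart set \<Rightarrow> ('b, 'f) metric \<Rightarrow> ('a \<Rightarrow> 'b) \<Rightarrow>
   ('a, 'e::euclidean_space) chart \<Rightarrow> ('b, 'f) chart \<Rightarrow> 'a \<Rightarrow> 'e \<Rightarrow> 'e \<Rightarrow> 'f" where
  "ambient_derivative B h \<psi> c d q u v =
     (let F = coord d \<circ> \<psi> \<circ> param c; z = coord c q
      in frechet_derivative (\<lambda>y. frechet_derivative F (at y) v) (at z) u +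
         christoffel B h d (F z) (frechet_derivative F (at z) u) (frechet_derivative F (at z) v))"

text \<open>The component normal to \<open>W\<close> of the tangent vector with coordinates \<open>w\<close>, again in coordinates.\<close>

definition normal_component ::
  "('a, 'e::euclidean_space) chart set \<Rightarrow> ('a, 'e) metric \<Rightarrow> ('a, 'e) chart \<Rightarrow> 'a \<Rightarrow>
   ('a, 'e) tvec set \<Rightarrow> 'e \<Rightarrow> 'e" where
  "normal_component A g c p W w =
     (THE x. coord_vector A c p x \<in> orth_complement A g p W \<and> coord_vector A c p (w - x) \<in> W)"

definition second_fundamental_form ::
  "('a, 'e::euclidean_space) chart set \<Rightarrow> ('b, 'f::euclidean_space) chart set \<Rightarrow> ('b, 'f) metric \<Rightarrow>
   ('a \<Rightarrow> 'b) \<Rightarrow> ('a, 'e) chart \<Rightarrow> ('b, 'f) chart \<Rightarrow> 'a \<Rightarrow> 'e \<Rightarrow> 'e \<Rightarrow> 'f" where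
  "second_fundamental_form A B h \<psi> c d q u v =
     normal_component B h d (\<psi> q) (immersed_tangent_space A B \<psi> q)
       (ambient_derivative B h \<psi> c d q u v)"

definition totally_geodesic ::
  "('a::topological_space, 'e::euclidean_space) chart set \<Rightarrow>
   ('b::topological_space, 'f::euclidean_space) chart set \<Rightarrow> ('b, 'f) metric \<Rightarrow> ('a \<Rightarrow> 'b) \<Rightarrow> bool" where
  "totally_geodesic A B h \<psi> \<longleftrightarrow> immersion A B \<psi> \<and>
     (\<forall>q. \<forall>c\<in>charts_at A q. \<forall>d\<in>charts_at B (\<psi> q). \<forall>u v.
        second_fundamental_form A B h \<psi> c d q u v = 0)"


section \<open>Warped products over the line and normal submanifolds\<close>

definition line_atlas :: "(real, real) chart set" where
  "line_atlas = {(UNIV, id)}"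

definition line_prod_atlas :: "('c, 'p) chart set \<Rightarrow> (real \<times> 'c, real \<times> 'p) chart set" where
  "line_prod_atlas A = (\<lambda>c. (UNIV \<times> dom_of c, map_prod id (coord c))) ` A"

text \<open>The metric \<open>dt\<^sup>2 + f(t)\<^sup>2 g\<close> on the product of the line with \<open>(A, g)\<close>.\<close>

definition warped_metric ::
  "(real \<Rightarrow> real) \<Rightarrow> ('c, 'p::euclidean_space) chart set \<Rightarrow> ('c, 'p) metric \<Rightarrow>
   (real \<times> 'c, real \<times> 'p) metric" where
  "warped_metric f A g = (\<lambda>x v w.
     (let dt = (\<lambda>v. differential (line_prod_atlas A) line_atlas fst x v (UNIV, id));
          d\<pi> = differential (line_prod_atlas A) A snd x
      in dt v * dt w + (f (fst x))\<^sup>2 * g (snd x) (d\<pi> v) (d\<pi> w)))"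

definition slice :: "real \<Rightarrow> (real \<times> 'c) set" where
  "slice t = {t} \<times> UNIV"

text \<open>
  Let \<open>\<phi>\<close> and \<open>\<psi>\<close> be immersions of \<open>M\<close> and \<open>N\<close> into \<open>(B, h)\<close>.  They need not be injective, so the
  intersection of \<open>M\<close> and \<open>N\<close> is taken as a subset of \<open>M\<close>, namely \<open>\<phi> -` range \<psi>\<close>.  The map \<open>\<alpha>\<close>
  exhibits it as a submanifold \<open>S\<close>, which \<open>\<phi> \<circ> \<alpha>\<close> immerses into \<open>B\<close>; the condition on the tangent
  spaces is required of every pair of sheets of \<open>M\<close> and \<open>N\<close> that meet.
\<close>

definition normal_submanifolds ::
  "('b::topological_space, 'f::euclidean_space) chart set \<Rightarrow> ('b, 'f) metric \<Rightarrow>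
   ('m::topological_space, 'k::euclidean_space) chart set \<Rightarrow> ('m \<Rightarrow> 'b) \<Rightarrow>
   ('n::topological_space, 'l::euclidean_space) chart set \<Rightarrow> ('n \<Rightarrow> 'b) \<Rightarrow>
   ('s::topological_space, 'j::euclidean_space) chart set \<Rightarrow> ('s \<Rightarrow> 'm) \<Rightarrow> bool" where
  "normal_submanifolds B h M \<phi> N \<psi> S \<alpha> \<longleftrightarrow>
     immersion M B \<phi> \<and> immersion N B \<psi> \<and>
     immersion S M \<alpha> \<and> inj \<alpha> \<and> range \<alpha> = \<phi> -` range \<psi> \<and> immersion S B (\<phi> \<circ> \<alpha>) \<and>
     (\<forall>s r. \<phi> (\<alpha> s) = \<psi> r \<longrightarrow>
        immersed_tangent_space M B \<phi> (\<alpha> s) \<inter>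
          orth_complement B h (\<psi> r) (immersed_tangent_space S B (\<phi> \<circ> \<alpha>) s)
        \<subseteq> orth_complement B h (\<psi> r) (immersed_tangent_space N B \<psi> r))"

end

theory Submission
  imports Defs
begin

text \<open>
  The proof has two independent halves.

  \<^bold>\<open>The intersection is totally geodesic in \<open>M\<close>.\<close>  Let \<open>\<eta>\<close> be tangent to \<open>M\<close> and orthogonal
  to \<open>\<Sigma>\<close>.  By normality \<open>\<eta>\<close> is orthogonal to every sheet of \<open>N\<close> through the point, and by the Gauss formula
  (\<open>gauss_formula\<close>) the \<open>\<eta>\<close>-component of the second fundamental form of \<open>\<Sigma>\<close> in \<open>M\<close> is the
  \<open>\<eta>\<close>-component of the acceleration, in the ambient manifold, of the curves of \<open>\<Sigma>\<close>.  If such a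
  curve also runs in \<open>N\<close>, this component is a value of the second fundamental form of \<open>N\<close>, hence \<open>0\<close>.
  The difficulty is that \<open>\<psi>\<close> need not be injective, so that a curve of \<open>\<Sigma>\<close> need not have a continuous
  lift to \<open>N\<close>.  Two observations replace the lift.  First, the comparison of accelerations at a point
  needs only a sequence of points of \<open>N\<close> that converges in \<open>N\<close> and whose images lie on the curve
  (\<open>touching_second_order\<close>).  Secondly, whatever set-theoretic lift of the curve is chosen, its graph is
  a subset of a second countable space and so has only countably many isolated points
  (\<open>countable_isolated_graph\<close>).  Hence such a sequence exists at all but countably many points of the
  curve, and the remaining points are reached by continuity (\<open>tangential_closed\<close>).

  \<^bold>\<open>The height is constant.\<close>  Let \<open>h\<close> be the restriction to \<open>\<Sigma>\<close> of the projection of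
  \<open>\<real> \<times> P\<close> to the line.  As \<open>\<Sigma>\<close> is totally geodesic, the Hessian of \<open>h\<close> is the restriction of
  \<open>f f' g\<^sub>P\<close> (\<open>hessian_height\<close>).  At a maximum of \<open>h\<close> it is negative semidefinite
  while \<open>dh = 0\<close>, which forces \<open>f' \<le> 0\<close> there; at a minimum \<open>f' \<ge> 0\<close>.  Since \<open>f'/f\<close> is nondecreasing,
  \<open>f'\<close> vanishes at all values of \<open>h\<close>, so the Hessian of \<open>h\<close> vanishes identically.  In coordinates
  this is a linear first-order system for \<open>dh\<close>; therefore \<open>dh\<close> vanishes near every point where it
  vanishes, the set where \<open>h\<close> is maximal is open, and \<open>h\<close> is constant because \<open>\<Sigma>\<close> is connected.

  Thus \<open>\<Sigma>\<close> lies in a slice and projects injectively to \<open>P\<close>, which has the same dimension.  By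
  invariance of domain the image is open; it is also compact, so it is all of the connected space \<open>P\<close>.
\<close>


section \<open>Calculus of smooth maps\<close>

abbreviation \<D> where "\<D> f x \<equiv> frechet_derivative f (at x)"

text \<open>
  The order of the arguments is that of \<open>ambient_derivative\<close>: the derivative in the direction \<open>v\<close>
  is differentiated in the direction \<open>u\<close>.
\<close>

abbreviation \<D>\<^sub>2 where "\<D>\<^sub>2 f x u v \<equiv> \<D> (\<lambda>y. \<D> f y v) x u"

lemma linear_expand:
  fixes L :: "'a::euclidean_space \<Rightarrow> 'b::real_vector"
  assumes "linear L"
  shows "L v = (\<Sum>b\<in>Basis. (v \<bullet> b) *\<^sub>R L b)"
proof -
  interpret linear L by fact
  have "L v = L (\<Sum>b\<in>Basis. (v \<bullet> b) *\<^sub>R b)" by (simp add: euclidean_representation)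
  then show ?thesis by (simp add: sum scale)
qed

text \<open>
  Expanding the argument in a basis turns pointwise convergence of linear maps into joint convergence.
\<close>

lemma tendsto_linear_apply:
  fixes L :: "'i \<Rightarrow> 'a::euclidean_space \<Rightarrow> 'b::real_normed_vector"
  assumes "\<forall>\<^sub>F j in F. linear (L j)" "linear L0" "\<And>v. ((\<lambda>j. L j v) \<longlongrightarrow> L0 v) F" "(w \<longlongrightarrow> w0) F"
  shows "((\<lambda>j. L j (w j)) \<longlongrightarrow> L0 w0) F"
proof -
  have "((\<lambda>j. \<Sum>b\<in>Basis. (w j \<bullet> b) *\<^sub>R L j b) \<longlongrightarrow> (\<Sum>b\<in>Basis. (w0 \<bullet> b) *\<^sub>R L0 b)) F"
    by (intro tendsto_intros assms)
  then have "((\<lambda>j. \<Sum>b\<in>Basis. (w j \<bullet> b) *\<^sub>R L j b) \<longlongrightarrow> L0 w0) F"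
    by (simp flip: linear_expand[OF assms(2)])
  then show ?thesis
    by (rule Lim_transform_eventually)
      (use assms(1) in eventually_elim, metis linear_expand)
qed

lemma tendsto_bilinear_apply:
  fixes B :: "'i \<Rightarrow> 'a::euclidean_space \<Rightarrow> 'c::euclidean_space \<Rightarrow> 'b::real_normed_vector"
  assumes B: "\<forall>\<^sub>F j in F. bilinear (B j)" "bilinear B0"
    and lim: "\<And>u v. ((\<lambda>j. B j u v) \<longlongrightarrow> B0 u v) F" "(x \<longlongrightarrow> x0) F" "(y \<longlongrightarrow> y0) F"
  shows "((\<lambda>j. B j (x j) (y j)) \<longlongrightarrow> B0 x0 y0) F"
proof (rule tendsto_linear_apply)
  show "\<forall>\<^sub>F j in F. linear (B j (x j))" using B(1) by eventually_elim (simp add: bilinear_def)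
  show "linear (B0 x0)" using B(2) by (simp add: bilinear_def)
  show "((\<lambda>j. B j (x j) v) \<longlongrightarrow> B0 x0 v) F" for v
    by (rule tendsto_linear_apply[where L = "\<lambda>j x. B j x v" and ?L0.0 = "\<lambda>x. B0 x v"])
      (use B lim in \<open>auto simp: bilinear_def elim: eventually_mono\<close>)
qed (use lim in auto)

text \<open>
  The product rule for a linear map that depends on a parameter, again by expansion in a basis.  It
  serves for derivatives, where \<open>L y = \<D> f (p y)\<close>, and, once in each argument, for metrics.
\<close>

lemma has_derivative_linear_apply:
  fixes L :: "'z::real_normed_vector \<Rightarrow> 'a::euclidean_space \<Rightarrow> 'b::real_normed_vector"
  assumes S: "open S" "z \<in> S" "\<And>y. y \<in> S \<Longrightarrow> linear (L y)"
    and L': "\<And>v. ((\<lambda>y. L y v) has_derivative L' v) (at z)"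
    and q: "(q has_derivative q') (at z)"
  shows "((\<lambda>y. L y (q y)) has_derivative (\<lambda>u. L' (q z) u + L z (q' u))) (at z)"
proof -
  have 1: "((\<lambda>y. L y v) has_derivative (\<lambda>u. \<Sum>b\<in>Basis. (v \<bullet> b) *\<^sub>R L' b u)) (at z)" for v
    by (rule has_derivative_transform_within_open[where s = S and f = "\<lambda>y. \<Sum>b\<in>Basis. (v \<bullet> b) *\<^sub>R L y b"])
      (use S in \<open>auto intro!: derivative_eq_intros L' simp: linear_expand[where v = v]\<close>)
  have 2: "L' v u = (\<Sum>b\<in>Basis. (v \<bullet> b) *\<^sub>R L' b u)" for v u
    using has_derivative_unique[OF L' 1] by metis
  show ?thesis
  proof (rule has_derivative_transform_within_open[where s = S and f = "\<lambda>y. \<Sum>b\<in>Basis. (q y \<bullet> b) *\<^sub>R L y b"])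
    show "((\<lambda>y. \<Sum>b\<in>Basis. (q y \<bullet> b) *\<^sub>R L y b) has_derivative (\<lambda>u. L' (q z) u + L z (q' u))) (at z)"
      by (auto intro!: derivative_eq_intros L' q
          simp: 2[of "q z"] linear_expand[OF S(3)[OF S(2)], of "q' _"] sum.distrib)
  qed (use S in \<open>auto simp: linear_expand[where v = "q _"]\<close>)
qed

lemma linear_\<D>: "f differentiable (at x) \<Longrightarrow> linear (\<D> f x)"
  by (simp add: linear_frechet_derivative)

lemma \<D>_cong:
  assumes "open S" "x \<in> S" "\<And>y. y \<in> S \<Longrightarrow> f y = g y"
  shows "\<D> f x = \<D> g x"
proof -
  have "(f has_derivative h) (at x) \<longleftrightarrow> (g has_derivative h) (at x)" for h
    using has_derivative_transform_within_open[OF _ assms(1,2), of f h UNIV g]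
      has_derivative_transform_within_open[OF _ assms(1,2), of g h UNIV f] assms(3) by metis
  then show ?thesis unfolding frechet_derivative_def by simp
qed

lemma \<D>\<^sub>2_cong:
  assumes "open S" "x \<in> S" "\<And>y. y \<in> S \<Longrightarrow> f y = g y"
  shows "\<D>\<^sub>2 f x u v = \<D>\<^sub>2 g x u v"
  using \<D>_cong[OF assms(1,2), of "\<lambda>y. \<D> f y v" "\<lambda>y. \<D> g y v"] \<D>_cong[OF assms(1) _ assms(3)] by simp

lemma \<D>_eqI: "(f has_derivative f') (at x) \<Longrightarrow> \<D> f x = f'"
  using frechet_derivative_at by metis

lemma Ck_on_cong:
  assumes "open S" "\<And>x. x \<in> S \<Longrightarrow> f x = g x"
  shows "Ck_on k S f \<longleftrightarrow> Ck_on k S g"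
  using assms(2)
proof (induction k arbitrary: f g)
  case 0 then show ?case by (simp cong: continuous_on_cong)
next
  case (Suc k)
  have d: "f differentiable (at x) \<longleftrightarrow> g differentiable (at x)" if "x \<in> S" for x
    using Suc.prems that assms(1) unfolding differentiable_def
    by (metis has_derivative_transform_within_open)
  have "Ck_on k S (\<lambda>x. \<D> f x v) \<longleftrightarrow> Ck_on k S (\<lambda>x. \<D> g x v)" for v
    by (rule Suc.IH) (use \<D>_cong[OF assms(1) _ Suc.prems] in auto)
  then show ?case using d by auto
qed

lemma Ck_on_subset: "Ck_on k S f \<Longrightarrow> T \<subseteq> S \<Longrightarrow> Ck_on k T f"
  by (induction k arbitrary: f) (auto intro: continuous_on_subset)

lemma Ck_on_const: "Ck_on k S (\<lambda>x. c)"
  by (induction k arbitrary: c) auto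

lemma Ck_on_Suc_imp: "Ck_on (Suc k) S f \<Longrightarrow> Ck_on k S f"
proof (induction k arbitrary: f)
  case 0 then show ?case
    by (auto simp: differentiable_imp_continuous_within continuous_at_imp_continuous_on)
next
  case (Suc k)
  have "\<forall>x\<in>S. f differentiable at x" using Suc.prems by (meson Ck_on.simps(2))
  moreover have "Ck_on k S (\<lambda>x. \<D> f x v)" for v
    by (rule Suc.IH) (use Suc.prems Ck_on.simps(2)[of "Suc k"] in blast)
  ultimately show ?case by simp
qed

lemma Ck_on_add:
  assumes "open S" "Ck_on k S f" "Ck_on k S g"
  shows "Ck_on k S (\<lambda>x. f x + g x)"
  using assms(2,3)
proof (induction k arbitrary: f g)
  case 0 then show ?case by (auto intro: continuous_intros)
next
  case (Suc k)
  have "Ck_on k S (\<lambda>x. \<D> (\<lambda>x. f x + g x) x v)" for v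
  proof (subst Ck_on_cong[OF assms(1)])
    show "\<D> (\<lambda>x. f x + g x) x v = \<D> f x v + \<D> g x v" if "x \<in> S" for x
      using Suc.prems that by (subst \<D>_eqI[OF has_derivative_add]) (auto simp: frechet_derivative_works)
    show "Ck_on k S (\<lambda>x. \<D> f x v + \<D> g x v)"
      using Suc by simp
  qed
  then show ?case using Suc.prems by simp
qed

lemma Ck_on_mult:
  fixes f g :: "'e::euclidean_space \<Rightarrow> real"
  assumes "open S" "Ck_on k S f" "Ck_on k S g"
  shows "Ck_on k S (\<lambda>x. f x * g x)"
  using assms(2,3)
proof (induction k arbitrary: f g)
  case 0 then show ?case by (auto intro: continuous_intros)
next
  case (Suc k)
  have "Ck_on k S (\<lambda>x. \<D> (\<lambda>x. f x * g x) x v)" for v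
  proof (subst Ck_on_cong[OF assms(1)])
    show "\<D> (\<lambda>x. f x * g x) x v = f x * \<D> g x v + \<D> f x v * g x" if "x \<in> S" for x
      using Suc.prems that
      by (subst \<D>_eqI[OF has_derivative_mult]) (auto simp: frechet_derivative_works)
    show "Ck_on k S (\<lambda>x. f x * \<D> g x v + \<D> f x v * g x)"
      using Suc.prems
      by (intro Ck_on_add assms(1) Suc.IH Ck_on_Suc_imp[of k S f] Ck_on_Suc_imp[of k S g]) auto
  qed
  then show ?case using Suc.prems by simp
qed

lemma Ck_on_fst:
  fixes f :: "real \<Rightarrow> 'f::euclidean_space" and T :: "'p::euclidean_space set"
  assumes "Ck_on k S f" "open S" "open T"
  shows "Ck_on k (S \<times> T) (\<lambda>x. f (fst x))"
  using assms(1)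
proof (induction k arbitrary: f)
  case 0 then show ?case using continuous_on_compose2[OF _ continuous_on_fst[OF continuous_on_id], of S f "S \<times> T"] by simp
next
  case (Suc k)
  have d: "((\<lambda>x. f (fst x)) has_derivative (\<lambda>v. \<D> f (fst x) (fst v))) (at x)" if "x \<in> S \<times> T" for x :: "real \<times> 'p"
    using Suc.prems that
    by (intro has_derivative_compose[OF has_derivative_fst[OF has_derivative_ident]]) (auto simp: frechet_derivative_works)
  have "Ck_on k (S \<times> T) (\<lambda>x. \<D> (\<lambda>x. f (fst x)) x v)" for v
  proof (subst Ck_on_cong)
    show "\<D> (\<lambda>x. f (fst x)) x v = \<D> f (fst x) (fst v)" if "x \<in> S \<times> T" for x
      using \<D>_eqI[OF d[OF that]] by simp
    show "Ck_on k (S \<times> T) (\<lambda>x. \<D> f (fst x) (fst v))"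
      using Suc.IH[of "\<lambda>t. \<D> f t (fst v)"] Suc.prems by simp
  qed (auto intro: open_Times assms)
  then show ?case using d unfolding Ck_on.simps differentiable_def by blast
qed

lemma Ck_on_snd:
  fixes f :: "'p::euclidean_space \<Rightarrow> 'f::euclidean_space" and S :: "real set"
  assumes "Ck_on k T f" "open S" "open T"
  shows "Ck_on k (S \<times> T) (\<lambda>x. f (snd x))"
  using assms(1)
proof (induction k arbitrary: f)
  case 0 then show ?case using continuous_on_compose2[OF _ continuous_on_snd[OF continuous_on_id], of T f "S \<times> T"] by simp
next
  case (Suc k)
  have d: "((\<lambda>x. f (snd x)) has_derivative (\<lambda>v. \<D> f (snd x) (snd v))) (at x)" if "x \<in> S \<times> T" for x :: "real \<times> 'p"
    using Suc.prems that
    by (intro has_derivative_compose[OF has_derivative_snd[OF has_derivative_ident]]) (auto simp: frechet_derivative_works)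
  have "Ck_on k (S \<times> T) (\<lambda>x. \<D> (\<lambda>x. f (snd x)) x v)" for v
  proof (subst Ck_on_cong)
    show "\<D> (\<lambda>x. f (snd x)) x v = \<D> f (snd x) (snd v)" if "x \<in> S \<times> T" for x
      using \<D>_eqI[OF d[OF that]] by simp
    show "Ck_on k (S \<times> T) (\<lambda>x. \<D> f (snd x) (snd v))"
      using Suc.IH[of "\<lambda>t. \<D> f t (snd v)"] Suc.prems by simp
  qed (auto intro: open_Times assms)
  then show ?case using d unfolding Ck_on.simps differentiable_def by blast
qed

text \<open>
  The affine first component makes the induction close: the first component of a derivative is
  constant, hence again affine.
\<close>

lemma Ck_on_Pair_fst:
  fixes g :: "real \<times> 'p::euclidean_space \<Rightarrow> 'f::euclidean_space"
  assumes "Ck_on k S g" "open S"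
  shows "Ck_on k S (\<lambda>x. (a * fst x + b, g x))"
  using assms(1)
proof (induction k arbitrary: g a b)
  case 0 then show ?case by (auto intro!: continuous_intros)
next
  case (Suc k)
  have d: "((\<lambda>x. (a * fst x + b, g x)) has_derivative (\<lambda>v. (0 * fst x + a * fst v, \<D> g x v))) (at x)"
    if "x \<in> S" for x
    using Suc.prems that
    by (auto intro!: derivative_eq_intros simp: frechet_derivative_works)
  have "Ck_on k S (\<lambda>x. \<D> (\<lambda>x. (a * fst x + b, g x)) x v)" for v
  proof (subst Ck_on_cong)
    show "\<D> (\<lambda>x. (a * fst x + b, g x)) x v = (0 * fst x + a * fst v, \<D> g x v)" if "x \<in> S" for x
      using \<D>_eqI[OF d[OF that]] by simp
    show "Ck_on k S (\<lambda>x. (0 * fst x + a * fst v, \<D> g x v))"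
      by (rule Suc.IH) (use Suc.prems[unfolded Ck_on.simps] in blast)
  qed (auto intro: assms)
  then show ?case using d unfolding Ck_on.simps differentiable_def by blast
qed

lemma smooth_on_cong:
  assumes "open S" "\<And>x. x \<in> S \<Longrightarrow> f x = g x"
  shows "smooth_on S f \<longleftrightarrow> smooth_on S g"
  unfolding smooth_on_def using Ck_on_cong[OF assms] by auto

lemma smooth_on_subset: "smooth_on S f \<Longrightarrow> T \<subseteq> S \<Longrightarrow> smooth_on T f"
  unfolding smooth_on_def using Ck_on_subset by blast

lemma smooth_on_continuous: "smooth_on S f \<Longrightarrow> continuous_on S f"
  unfolding smooth_on_def by (metis Ck_on.simps(1))

lemma smooth_on_differentiable: "smooth_on S f \<Longrightarrow> x \<in> S \<Longrightarrow> f differentiable (at x)"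
  unfolding smooth_on_def by (metis Ck_on.simps(2))

lemma smooth_on_has_derivative: "smooth_on S f \<Longrightarrow> x \<in> S \<Longrightarrow> (f has_derivative \<D> f x) (at x)"
  using smooth_on_differentiable frechet_derivative_works by blast

lemma smooth_on_\<D>: "smooth_on S f \<Longrightarrow> smooth_on S (\<lambda>x. \<D> f x v)"
  unfolding smooth_on_def by (metis Ck_on.simps(2))

lemma smooth_on_linear_\<D>: "smooth_on S f \<Longrightarrow> x \<in> S \<Longrightarrow> linear (\<D> f x)"
  by (simp add: linear_\<D> smooth_on_differentiable)

lemma linear_\<D>_parameter:
  fixes h :: "'e::euclidean_space \<Rightarrow> 'a::euclidean_space \<Rightarrow> 'f::euclidean_space"
  assumes "open S" "z \<in> S" "\<And>y. y \<in> S \<Longrightarrow> linear (h y)" "\<And>v. (\<lambda>y. h y v) differentiable (at z)"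
  shows "linear (\<lambda>v. \<D> (\<lambda>y. h y v) z u)"
proof (rule linearI)
  fix v w :: 'a and r :: real
  note d = assms(4)[unfolded frechet_derivative_works]
  have "\<D> (\<lambda>y. h y (v + w)) z = \<D> (\<lambda>y. h y v + h y w) z"
    by (rule \<D>_cong[OF assms(1,2)]) (simp add: linear_add assms(3))
  then show "\<D> (\<lambda>y. h y (v + w)) z u = \<D> (\<lambda>y. h y v) z u + \<D> (\<lambda>y. h y w) z u"
    using \<D>_eqI[OF has_derivative_add[OF d d], of v w] by simp
  have "\<D> (\<lambda>y. h y (r *\<^sub>R v)) z = \<D> (\<lambda>y. r *\<^sub>R h y v) z"
    by (rule \<D>_cong[OF assms(1,2)]) (simp add: linear_scale assms(3))
  then show "\<D> (\<lambda>y. h y (r *\<^sub>R v)) z u = r *\<^sub>R \<D> (\<lambda>y. h y v) z u"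
    using \<D>_eqI[OF has_derivative_scaleR_right[OF d], of r v] by simp
qed

lemma smooth_on_bilinear_\<D>\<^sub>2:
  assumes "open S" "smooth_on S f" "x \<in> S"
  shows "bilinear (\<D>\<^sub>2 f x)"
  unfolding bilinear_def
proof (intro conjI allI)
  note d = smooth_on_differentiable[OF smooth_on_\<D>[OF assms(2)] assms(3)]
  show "linear (\<lambda>u. \<D>\<^sub>2 f x u v)" for v
    by (rule linear_\<D>[OF d])
  show "linear (\<D>\<^sub>2 f x u)" for u
    by (rule linear_\<D>_parameter[OF assms(1,3) smooth_on_linear_\<D>[OF assms(2)] d])
qed

lemma smooth_on_tendsto:
  assumes "smooth_on S f" "open S" "(p \<longlongrightarrow> x) F" "x \<in> S"
  shows "((\<lambda>j. f (p j)) \<longlongrightarrow> f x) F"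
  using continuous_on_tendsto_compose[OF smooth_on_continuous[OF assms(1)] assms(3,4)]
    topological_tendstoD[OF assms(3,2,4)] by blast

lemma smooth_on_tendsto_\<D>:
  assumes "smooth_on S f" "open S" "(p \<longlongrightarrow> x) F" "x \<in> S" "(v \<longlongrightarrow> v0) F"
  shows "((\<lambda>j. \<D> f (p j) (v j)) \<longlongrightarrow> \<D> f x v0) F"
proof (rule tendsto_linear_apply[where L = "\<lambda>j. \<D> f (p j)" and ?L0.0 = "\<D> f x" and w = v])
  show "\<forall>\<^sub>F j in F. linear (\<D> f (p j))"
    using topological_tendstoD[OF assms(3,2,4)]
    by eventually_elim (rule smooth_on_linear_\<D>[OF assms(1)])
  show "linear (\<D> f x)" by (rule smooth_on_linear_\<D>[OF assms(1,4)])
  show "((\<lambda>j. \<D> f (p j) v) \<longlongrightarrow> \<D> f x v) F" for v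
    by (rule smooth_on_tendsto[OF smooth_on_\<D>[OF assms(1)] assms(2-4)])
qed fact

lemma smooth_on_tendsto_\<D>\<^sub>2:
  assumes "smooth_on S f" "open S" "(p \<longlongrightarrow> x) F" "x \<in> S" "(u \<longlongrightarrow> u0) F" "(v \<longlongrightarrow> v0) F"
  shows "((\<lambda>j. \<D>\<^sub>2 f (p j) (u j) (v j)) \<longlongrightarrow> \<D>\<^sub>2 f x u0 v0) F"
proof (rule tendsto_bilinear_apply[where B = "\<lambda>j. \<D>\<^sub>2 f (p j)" and ?B0.0 = "\<D>\<^sub>2 f x" and x = u and y = v])
  show "\<forall>\<^sub>F j in F. bilinear (\<D>\<^sub>2 f (p j))"
    using topological_tendstoD[OF assms(3,2,4)]
    by eventually_elim (rule smooth_on_bilinear_\<D>\<^sub>2[OF assms(2,1)])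
  show "bilinear (\<D>\<^sub>2 f x)" by (rule smooth_on_bilinear_\<D>\<^sub>2[OF assms(2,1,4)])
  show "((\<lambda>j. \<D>\<^sub>2 f (p j) u v) \<longlongrightarrow> \<D>\<^sub>2 f x u v) F" for u v
    by (rule smooth_on_tendsto[OF smooth_on_\<D>[OF smooth_on_\<D>[OF assms(1)]] assms(2-4)])
qed fact+

lemma has_derivative_\<D>_compose:
  assumes S: "open S" "smooth_on S f" and T: "open T" "z \<in> T" "p ` T \<subseteq> S"
    and p: "(p has_derivative p') (at z)" and q: "(q has_derivative q') (at z)"
  shows "((\<lambda>y. \<D> f (p y) (q y)) has_derivative
    (\<lambda>u. \<D>\<^sub>2 f (p z) (p' u) (q z) + \<D> f (p z) (q' u))) (at z)"
proof (rule has_derivative_linear_apply[OF T(1,2) _ _ q])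
  show "linear (\<D> f (p y))" if "y \<in> T" for y
    using that T smooth_on_linear_\<D>[OF S(2)] by blast
  show "((\<lambda>y. \<D> f (p y) v) has_derivative (\<lambda>u. \<D>\<^sub>2 f (p z) (p' u) v)) (at z)" for v
    by (rule has_derivative_compose[OF p smooth_on_has_derivative[OF smooth_on_\<D>[OF S(2)]]])
      (use T in auto)
qed

lemma \<D>_compose:
  assumes S: "smooth_on S f" and T: "smooth_on T p" "z \<in> T" "p z \<in> S"
  shows "\<D> (f \<circ> p) z v = \<D> f (p z) (\<D> p z v)"
  using frechet_derivative_compose[OF smooth_on_differentiable[OF T(1,2)] smooth_on_differentiable[OF S T(3)]]
  by simp

lemma \<D>\<^sub>2_compose:
  assumes S: "open S" "smooth_on S f" and T: "open T" "smooth_on T p" "z \<in> T" "p ` T \<subseteq> S"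
  shows "\<D>\<^sub>2 (f \<circ> p) z u v = \<D>\<^sub>2 f (p z) (\<D> p z u) (\<D> p z v) + \<D> f (p z) (\<D>\<^sub>2 p z u v)"
proof -
  have "\<D> (\<lambda>y. \<D> (f \<circ> p) y v) z = \<D> (\<lambda>y. \<D> f (p y) (\<D> p y v)) z"
    by (rule \<D>_cong[OF T(1,3)]) (use T in \<open>auto intro!: \<D>_compose[OF S(2) T(2)]\<close>)
  also have "\<dots> = (\<lambda>u. \<D>\<^sub>2 f (p z) (\<D> p z u) (\<D> p z v) + \<D> f (p z) (\<D>\<^sub>2 p z u v))"
    by (intro \<D>_eqI has_derivative_\<D>_compose[OF S T(1,3,4)] smooth_on_has_derivative[OF T(2,3)]
        smooth_on_has_derivative[OF smooth_on_\<D>[OF T(2)] T(3)])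
  finally show ?thesis by simp
qed


section \<open>Second-order calculus\<close>

lemma has_derivative_along_line:
  assumes "(f has_derivative f') (at (x + t *\<^sub>R v))"
  shows "((\<lambda>t. f (x + t *\<^sub>R v)) has_derivative (\<lambda>h. h *\<^sub>R f' v)) (at t)"
proof -
  have "((\<lambda>t. x + t *\<^sub>R v) has_derivative (\<lambda>h. h *\<^sub>R v)) (at t)"
    by (auto intro!: derivative_eq_intros)
  from has_derivative_compose[OF this assms] show ?thesis
    using has_derivative_bounded_linear[OF assms] by (simp add: bounded_linear.linear linear_scale)
qed

lemma linear_has_derivative_along_line:
  fixes l :: "'f::euclidean_space \<Rightarrow> real"
  assumes "linear l" "(f has_derivative f') (at (x + t *\<^sub>R v))"
  shows "((\<lambda>t. l (f (x + t *\<^sub>R v))) has_real_derivative l (f' v)) (at t)"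
proof -
  have "(l has_derivative l) (at y)" for y by (rule linear_imp_has_derivative[OF assms(1)])
  from has_derivative_compose[OF has_derivative_along_line[OF assms(2)] this]
  show ?thesis
    unfolding has_field_derivative_def by (simp add: linear_scale[OF assms(1)] mult_commute_abs)
qed

lemma divide_by_large_less: "0 < e \<Longrightarrow> e / real (n + 2) < e"
  using mult_strict_left_mono[of 1 "real n + 2" e] by (simp add: divide_less_eq algebra_simps)

text \<open>
  The mean value theorem, first in the direction \<open>u\<close> and then in the direction \<open>v\<close>.  The functional
  \<open>l\<close> is there because the mean value theorem holds for scalar functions only.
\<close>

lemma second_difference:
  fixes f :: "'e::euclidean_space \<Rightarrow> 'f::euclidean_space" and l :: "'f \<Rightarrow> real"
  assumes f: "open S" "smooth_on S f" and l: "linear l" and t: "0 < t"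
    and S: "\<And>a b. \<lbrakk>0 \<le> a; a \<le> t; 0 \<le> b; b \<le> t\<rbrakk> \<Longrightarrow> x + a *\<^sub>R u + b *\<^sub>R v \<in> S"
  shows "\<exists>a b. 0 < a \<and> a < t \<and> 0 < b \<and> b < t \<and>
     l (f (x + t *\<^sub>R u + t *\<^sub>R v)) - l (f (x + t *\<^sub>R u)) - l (f (x + t *\<^sub>R v)) + l (f x)
     = t * t * l (\<D>\<^sub>2 f (x + a *\<^sub>R u + b *\<^sub>R v) v u)"
proof -
  note d = linear_has_derivative_along_line[OF l smooth_on_has_derivative[OF f(2)]]
  let ?g = "\<lambda>a. l (f ((x + t *\<^sub>R v) + a *\<^sub>R u)) - l (f (x + a *\<^sub>R u))"
  have "\<exists>a>0. a < t \<and> ?g t - ?g 0 = (t - 0) * (l (\<D> f ((x + t *\<^sub>R v) + a *\<^sub>R u) u) - l (\<D> f (x + a *\<^sub>R u) u))"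
  proof (rule MVT2[OF t])
    fix a assume a: "0 \<le> a" "a \<le> t"
    show "DERIV ?g a :> l (\<D> f ((x + t *\<^sub>R v) + a *\<^sub>R u) u) - l (\<D> f (x + a *\<^sub>R u) u)"
      by (intro DERIV_diff d) (use S[OF a, of t] S[OF a, of 0] t in \<open>auto simp: algebra_simps\<close>)
  qed
  then obtain a where a: "0 < a" "a < t"
    "?g t - ?g 0 = t * (l (\<D> f ((x + a *\<^sub>R u) + t *\<^sub>R v) u) - l (\<D> f (x + a *\<^sub>R u) u))"
    by (auto simp: algebra_simps)
  let ?h = "\<lambda>b. l (\<D> f ((x + a *\<^sub>R u) + b *\<^sub>R v) u)"
  have "\<exists>b>0. b < t \<and> ?h t - ?h 0 = (t - 0) * l (\<D>\<^sub>2 f ((x + a *\<^sub>R u) + b *\<^sub>R v) v u)"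
    by (rule MVT2[OF t linear_has_derivative_along_line[OF l smooth_on_has_derivative[OF smooth_on_\<D>[OF f(2)] S]]])
      (use a in auto)
  then obtain b where b: "0 < b" "b < t"
    "l (\<D> f ((x + a *\<^sub>R u) + t *\<^sub>R v) u) - l (\<D> f (x + a *\<^sub>R u) u) = t * l (\<D>\<^sub>2 f (x + a *\<^sub>R u + b *\<^sub>R v) v u)"
    by auto
  show ?thesis
    by (rule exI[of _ a], rule exI[of _ b]) (use a b in \<open>simp add: algebra_simps\<close>)
qed

text \<open>
  The second difference is symmetric in \<open>u\<close> and \<open>v\<close>, and divided by \<open>t\<^sup>2\<close> it tends to either
  mixed derivative.
\<close>

lemma \<D>\<^sub>2_symmetric:
  fixes f :: "'e::euclidean_space \<Rightarrow> 'f::euclidean_space"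
  assumes f: "open S" "smooth_on S f" and x: "x \<in> S"
  shows "\<D>\<^sub>2 f x u v = \<D>\<^sub>2 f x v u"
proof (rule euclidean_eqI)
  fix i :: 'f
  define l where "l y = y \<bullet> i" for y :: 'f
  have l: "linear l" unfolding l_def by (rule linearI) (auto simp: inner_left_distrib)
  obtain e where e: "0 < e" "ball x e \<subseteq> S" using f(1) x openE by blast
  define M where "M = norm u + norm v + 1"
  have M: "0 < M" by (simp add: M_def add_nonneg_pos)
  \<comment> \<open>The summand \<open>2\<close> gives \<open>t n * M < e\<close> for all \<open>n\<close>, so that the whole parallelogram stays in \<open>S\<close>.\<close>
  define t where "t n = e / M / real (n + 2)" for n
  have t0: "0 < t n" for n using e M by (simp add: t_def)
  have tM: "t n * M < e" for n
    using M divide_by_large_less[OF e(1), of n] by (simp add: t_def)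
  have ball: "norm (a *\<^sub>R u + b *\<^sub>R v) < e" if "0 \<le> a" "a \<le> t n" "0 \<le> b" "b \<le> t n" for a b n
  proof -
    have "norm (a *\<^sub>R u + b *\<^sub>R v) \<le> a * norm u + b * norm v"
      using norm_triangle_ineq[of "a *\<^sub>R u" "b *\<^sub>R v"] that by simp
    also have "\<dots> \<le> t n * norm u + t n * norm v" using that by (intro add_mono mult_right_mono) auto
    also have "\<dots> \<le> t n * M" using t0[of n] by (simp add: M_def algebra_simps)
    finally show ?thesis using tM[of n] by simp
  qed
  have inS: "x + a *\<^sub>R u + b *\<^sub>R v \<in> S" if "0 \<le> a" "a \<le> t n" "0 \<le> b" "b \<le> t n" for a b n
  proof -
    have "(x + a *\<^sub>R u + b *\<^sub>R v) - x = a *\<^sub>R u + b *\<^sub>R v" by simp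
    then have "x + a *\<^sub>R u + b *\<^sub>R v \<in> ball x e"
      using ball[OF that] by (simp only: mem_ball dist_norm norm_minus_commute[of x])
    then show ?thesis using e(2) by blast
  qed
  define \<Delta> where "\<Delta> n = l (f (x + t n *\<^sub>R u + t n *\<^sub>R v)) - l (f (x + t n *\<^sub>R u)) - l (f (x + t n *\<^sub>R v)) + l (f x)" for n
  have "\<exists>a b. 0 < a \<and> a < t n \<and> 0 < b \<and> b < t n \<and> \<Delta> n = t n * t n * l (\<D>\<^sub>2 f (x + a *\<^sub>R u + b *\<^sub>R v) v u)" for n
    unfolding \<Delta>_def by (rule second_difference[OF f l t0]) (rule inS)
  then obtain a b where ab: "\<And>n. 0 < a n \<and> a n < t n \<and> 0 < b n \<and> b n < t n"
    "\<And>n. \<Delta> n = t n * t n * l (\<D>\<^sub>2 f (x + a n *\<^sub>R u + b n *\<^sub>R v) v u)" by metis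
  have "\<exists>a b. 0 < a \<and> a < t n \<and> 0 < b \<and> b < t n \<and> \<Delta> n = t n * t n * l (\<D>\<^sub>2 f (x + a *\<^sub>R v + b *\<^sub>R u) u v)" for n
  proof -
    have "x + a *\<^sub>R v + b *\<^sub>R u \<in> S" if "0 \<le> a" "a \<le> t n" "0 \<le> b" "b \<le> t n" for a b
      using inS[OF that(3,4,1,2)] by (simp add: algebra_simps)
    from second_difference[OF f l t0 this] show ?thesis unfolding \<Delta>_def by (auto simp: algebra_simps)
  qed
  then obtain c d where cd: "\<And>n. 0 < c n \<and> c n < t n \<and> 0 < d n \<and> d n < t n"
    "\<And>n. \<Delta> n = t n * t n * l (\<D>\<^sub>2 f (x + c n *\<^sub>R v + d n *\<^sub>R u) u v)" by metis
  have tl: "t \<longlonglongrightarrow> 0"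
    unfolding t_def by (intro LIMSEQ_ignore_initial_segment[of "\<lambda>n. e / M / real n" 0 2] lim_const_over_n)
  have lim0: "s \<longlonglongrightarrow> 0" if "\<And>n. 0 < s n \<and> s n < t n" for s
    by (rule tendsto_sandwich[OF _ _ tendsto_const tl]) (use that less_imp_le in \<open>auto intro!: always_eventually\<close>)
  have lim: "(\<lambda>n. l (\<D>\<^sub>2 f (x + r n *\<^sub>R y + s n *\<^sub>R z) z y)) \<longlonglongrightarrow> l (\<D>\<^sub>2 f x z y)"
    if "r \<longlonglongrightarrow> 0" "s \<longlonglongrightarrow> 0" for r s y z
  proof (rule tendsto_linear_apply[where L = "\<lambda>_. l"])
    have "(\<lambda>n. x + r n *\<^sub>R y + s n *\<^sub>R z) \<longlonglongrightarrow> x + 0 *\<^sub>R y + 0 *\<^sub>R z" by (intro tendsto_intros that)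
    then show "(\<lambda>n. \<D>\<^sub>2 f (x + r n *\<^sub>R y + s n *\<^sub>R z) z y) \<longlonglongrightarrow> \<D>\<^sub>2 f x z y"
      by (intro smooth_on_tendsto_\<D>\<^sub>2[OF f(2,1)]) (use x in auto)
  qed (use l in auto)
  have "l (\<D>\<^sub>2 f (x + a n *\<^sub>R u + b n *\<^sub>R v) v u) = l (\<D>\<^sub>2 f (x + c n *\<^sub>R v + d n *\<^sub>R u) u v)" for n
    using ab(2)[of n] cd(2)[of n] t0[of n] by simp
  then have "(\<lambda>n. l (\<D>\<^sub>2 f (x + a n *\<^sub>R u + b n *\<^sub>R v) v u)) \<longlonglongrightarrow> l (\<D>\<^sub>2 f x u v)"
    using lim[OF lim0 lim0, of c d v u] cd by simp
  then have "l (\<D>\<^sub>2 f x v u) = l (\<D>\<^sub>2 f x u v)"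
    using lim[OF lim0 lim0, of a b u v] ab by (intro LIMSEQ_unique) auto
  then show "\<D>\<^sub>2 f x u v \<bullet> i = \<D>\<^sub>2 f x v u \<bullet> i" by (simp add: l_def)
qed

text \<open>
  The direction \<open>e k\<close> varies because the points to which this is applied approach \<open>x\<close> along no given curve.
\<close>

lemma difference_quotient_tendsto:
  fixes f :: "'e::euclidean_space \<Rightarrow> 'f::real_normed_vector"
  assumes f: "(f has_derivative f') (at x)"
    and \<delta>: "\<delta> \<longlonglongrightarrow> 0" "\<And>k::nat. \<delta> k \<noteq> 0" and e: "e \<longlonglongrightarrow> e0"
  shows "(\<lambda>k. (1 / \<delta> k) *\<^sub>R (f (x + \<delta> k *\<^sub>R e k) - f x)) \<longlonglongrightarrow> f' e0"
proof -
  interpret bounded_linear f' by (rule has_derivative_bounded_linear[OF f])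
  \<comment> \<open>The remainder of the linear approximation, divided by the size of the increment.\<close>
  define R where "R h = (if h = 0 then 0 else (1 / norm h) *\<^sub>R (f (x + h) - f x - f' h))" for h
  have "(\<lambda>h. norm (f (x + h) - f x - f' h) / norm h) \<midarrow>0\<rightarrow> 0"
    using f unfolding has_derivative_at by simp
  then have "((\<lambda>h. (1 / norm h) *\<^sub>R (f (x + h) - f x - f' h)) \<longlongrightarrow> 0) (at 0)"
    by - (rule tendsto_norm_zero_cancel, simp)
  then have "(R \<longlongrightarrow> 0) (at 0)"
    by (rule Lim_transform_eventually) (auto simp: R_def eventually_at intro!: exI[of _ 1])
  then have R: "isCont R 0" unfolding isCont_def by (simp add: R_def)
  have lim: "(\<lambda>k. \<delta> k *\<^sub>R e k) \<longlonglongrightarrow> 0" using tendsto_scaleR[OF \<delta>(1) e] by simp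
  have "(\<lambda>k. R (\<delta> k *\<^sub>R e k)) \<longlonglongrightarrow> 0"
    using isCont_tendsto_compose[OF R lim] by (simp add: R_def)
  then have "(\<lambda>k. f' (e k) + norm (e k) *\<^sub>R (sgn (\<delta> k) *\<^sub>R R (\<delta> k *\<^sub>R e k))) \<longlonglongrightarrow> f' e0 + norm e0 *\<^sub>R 0"
    by (intro tendsto_intros tendsto e)
      (rule Lim_null_comparison[where g = "\<lambda>k. norm (R (\<delta> k *\<^sub>R e k))"],
        auto simp: sgn_real_def intro!: tendsto_norm_zero)
  moreover have "f' (e k) + norm (e k) *\<^sub>R (sgn (\<delta> k) *\<^sub>R R (\<delta> k *\<^sub>R e k))
      = (1 / \<delta> k) *\<^sub>R (f (x + \<delta> k *\<^sub>R e k) - f x)" for k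
    using \<delta>(2)[of k] by (auto simp: R_def scaleR zero sgn_real_def algebra_simps divide_simps)
  ultimately show ?thesis by simp
qed

lemma second_order_quotient_tendsto:
  fixes f :: "'e::euclidean_space \<Rightarrow> 'f::euclidean_space" and l :: "'f \<Rightarrow> real"
  assumes f: "open S" "smooth_on S f" and x: "x \<in> S" and l: "linear l"
    and \<delta>: "\<delta> \<longlonglongrightarrow> 0" "\<And>k::nat. \<delta> k \<noteq> 0" and e: "e \<longlonglongrightarrow> e0"
  shows "(\<lambda>k. (l (f (x + \<delta> k *\<^sub>R e k)) - l (f x) - \<delta> k * l (\<D> f x (e k))) / (\<delta> k)\<^sup>2)
    \<longlonglongrightarrow> l (\<D>\<^sub>2 f x e0 e0) / 2"
proof -
  obtain r where r: "0 < r" "ball x r \<subseteq> S" using f(1) x openE by blast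
  have lim: "(\<lambda>k. \<delta> k *\<^sub>R e k) \<longlonglongrightarrow> 0" using tendsto_scaleR[OF \<delta>(1) e] by simp
  have ev: "\<forall>\<^sub>F k in sequentially. norm (\<delta> k *\<^sub>R e k) < r"
    using tendstoD[OF lim r(1)] by simp
  have "\<exists>s. \<bar>s\<bar> \<le> \<bar>\<delta> k\<bar> \<and> l (f (x + \<delta> k *\<^sub>R e k)) - l (f x) - \<delta> k * l (\<D> f x (e k)) =
      (\<delta> k)\<^sup>2 * (l (\<D>\<^sub>2 f (x + s *\<^sub>R e k) (e k) (e k)) / 2)"
    if k: "norm (\<delta> k *\<^sub>R e k) < r" for k
  proof -
    let ?d = "\<lambda>m::nat. if m = 0 then (\<lambda>s. l (f (x + s *\<^sub>R e k))) else if m = 1 then (\<lambda>s. l (\<D> f (x + s *\<^sub>R e k) (e k)))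
      else (\<lambda>s. l (\<D>\<^sub>2 f (x + s *\<^sub>R e k) (e k) (e k)))"
    have inS: "x + s *\<^sub>R e k \<in> S" if "\<bar>s\<bar> \<le> \<bar>\<delta> k\<bar>" for s
    proof -
      have "norm (s *\<^sub>R e k) \<le> norm (\<delta> k *\<^sub>R e k)" using that by (simp add: mult_right_mono)
      then show ?thesis using k r(2) by (auto simp: subset_eq dist_norm)
    qed
    have "\<exists>s. \<bar>s\<bar> \<le> \<bar>\<delta> k\<bar> \<and> l (f (x + \<delta> k *\<^sub>R e k)) =
      (\<Sum>m<2. ?d m 0 / fact m * \<delta> k ^ m) + ?d 2 s / fact 2 * \<delta> k ^ 2"
    proof (rule Maclaurin_bi_le, simp, intro allI impI)
      fix m :: nat and s assume a: "m < 2 \<and> \<bar>s\<bar> \<le> \<bar>\<delta> k\<bar>"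
      then have "m = 0 \<or> m = 1" by auto
      then show "DERIV (?d m) s :> ?d (Suc m) s"
        using linear_has_derivative_along_line[OF l smooth_on_has_derivative[OF f(2) inS]]
          linear_has_derivative_along_line[OF l smooth_on_has_derivative[OF smooth_on_\<D>[OF f(2)] inS]] a
        by auto
    qed
    then obtain s where "\<bar>s\<bar> \<le> \<bar>\<delta> k\<bar>" "l (f (x + \<delta> k *\<^sub>R e k)) =
      (\<Sum>m<2. ?d m 0 / fact m * \<delta> k ^ m) + ?d 2 s / fact 2 * \<delta> k ^ 2" by blast
    then show ?thesis
      by (intro exI[of _ s]) (simp add: numeral_2_eq_2 lessThan_Suc)
  qed
  then obtain s where s: "\<And>k. norm (\<delta> k *\<^sub>R e k) < r \<Longrightarrow> \<bar>s k\<bar> \<le> \<bar>\<delta> k\<bar> \<and>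
      l (f (x + \<delta> k *\<^sub>R e k)) - l (f x) - \<delta> k * l (\<D> f x (e k)) =
      (\<delta> k)\<^sup>2 * (l (\<D>\<^sub>2 f (x + s k *\<^sub>R e k) (e k) (e k)) / 2)" by metis
  have "s \<longlonglongrightarrow> 0"
    by (rule Lim_null_comparison[OF _ tendsto_rabs_zero[OF \<delta>(1)]]) (use ev in eventually_elim, use s in simp)
  then have "(\<lambda>k. x + s k *\<^sub>R e k) \<longlonglongrightarrow> x + 0 *\<^sub>R e0" by (intro tendsto_intros e)
  then have "(\<lambda>k. \<D>\<^sub>2 f (x + s k *\<^sub>R e k) (e k) (e k)) \<longlonglongrightarrow> \<D>\<^sub>2 f x e0 e0"
    by (intro smooth_on_tendsto_\<D>\<^sub>2[OF f(2,1)] e) (use x in auto)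
  then have "(\<lambda>k. l (\<D>\<^sub>2 f (x + s k *\<^sub>R e k) (e k) (e k)) / 2) \<longlonglongrightarrow> l (\<D>\<^sub>2 f x e0 e0) / 2"
    by (intro tendsto_intros tendsto_linear_apply[where L = "\<lambda>_. l"]) (use l in auto)
  then show ?thesis
    by (rule Lim_transform_eventually) (use ev in eventually_elim, use s \<delta>(2) in auto)
qed

text \<open>
  The step from points to accelerations.  No curve in the source of \<open>K\<close> is given, only points \<open>z k\<close>
  that \<open>K\<close> maps to the curve \<open>G (x + \<delta> u)\<close>.  As \<open>K\<close> is an immersion at \<open>y\<close>, the difference quotients
  of \<open>z\<close> are bounded, so a subsequence converges to some \<open>w\<close>, which \<open>\<D> K y\<close> maps to the velocity of
  the curve.  The functional \<open>l\<close> annihilates the first-order terms; comparing the second-order terms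
  of the two expansions gives the claim.
\<close>

lemma touching_second_order:
  fixes G :: "'e::euclidean_space \<Rightarrow> 'f::euclidean_space" and K :: "'l::euclidean_space \<Rightarrow> 'f"
    and l :: "'f \<Rightarrow> real"
  assumes G: "open U" "smooth_on U G" "x \<in> U" and K: "open V" "smooth_on V K" "y \<in> V"
    and inj: "inj (\<D> K y)" and l: "linear l" "\<And>w. l (\<D> K y w) = 0"
    and \<delta>: "\<delta> \<longlonglongrightarrow> 0" "\<And>k::nat. \<delta> k \<noteq> 0" and lim: "z \<longlonglongrightarrow> y"
    and eq: "G x = K y" "\<And>k. G (x + \<delta> k *\<^sub>R u) = K (z k)"
  shows "\<exists>w. \<D> K y w = \<D> G x u \<and> l (\<D>\<^sub>2 K y w w) = l (\<D>\<^sub>2 G x u u)"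
proof -
  define e where "e k = (1 / \<delta> k) *\<^sub>R (z k - y)" for k
  have z: "z k = y + \<delta> k *\<^sub>R e k" for k using \<delta>(2)[of k] by (simp add: e_def)
  have dK: "(K has_derivative \<D> K y) (at y)" by (rule smooth_on_has_derivative[OF K(2,3)])
  have G1: "(\<lambda>k. (1 / \<delta> k) *\<^sub>R (G (x + \<delta> k *\<^sub>R u) - G x)) \<longlonglongrightarrow> \<D> G x u"
    by (rule difference_quotient_tendsto[OF smooth_on_has_derivative[OF G(2,3)] \<delta>]) simp
  obtain c where c: "0 < c" "\<And>w. c * norm w \<le> norm (\<D> K y w)"
    using linear_inj_bounded_below_pos[OF smooth_on_linear_\<D>[OF K(2,3)] inj] by blast
  obtain d where d: "0 < d" "\<And>y'. norm (y' - y) < d \<Longrightarrow> norm (K y' - K y - \<D> K y (y' - y)) \<le> c / 2 * norm (y' - y)"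
    using dK c(1) unfolding has_derivative_at_alt by (metis half_gt_zero)
  have "\<forall>\<^sub>F k in sequentially. norm (z k - y) < d" using tendstoD[OF lim d(1)] by (simp add: dist_norm)
  then have "\<forall>\<^sub>F k in sequentially. norm (e k) \<le> 2 / c * norm ((1 / \<delta> k) *\<^sub>R (G (x + \<delta> k *\<^sub>R u) - G x))"
  proof eventually_elim
    case (elim k)
    have "c * norm (z k - y) \<le> norm (\<D> K y (z k - y))" by (rule c)
    also have "\<dots> \<le> norm (K (z k) - K y) + norm (K (z k) - K y - \<D> K y (z k - y))"
      by (metis norm_triangle_sub norm_minus_commute add.commute)
    also have "\<dots> \<le> norm (K (z k) - K y) + c / 2 * norm (z k - y)" using d(2)[OF elim] by simp
    finally have "norm (z k - y) \<le> 2 / c * norm (K (z k) - K y)" using c(1) by (simp add: field_simps)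
    then have "norm (z k - y) / \<bar>\<delta> k\<bar> \<le> 2 / c * norm (K (z k) - K y) / \<bar>\<delta> k\<bar>" by (intro divide_right_mono) auto
    then show ?case by (simp add: e_def eq)
  qed
  note e_le = this
  obtain B where B: "\<And>k. norm ((1 / \<delta> k) *\<^sub>R (G (x + \<delta> k *\<^sub>R u) - G x)) \<le> B"
    using convergent_imp_Bseq[OF convergentI[OF G1]] unfolding Bseq_def by blast
  have "\<forall>\<^sub>F k in sequentially. norm (e k) \<le> 2 / c * B"
    using e_le
  proof eventually_elim
    case (elim k)
    also have "2 / c * norm ((1 / \<delta> k) *\<^sub>R (G (x + \<delta> k *\<^sub>R u) - G x)) \<le> 2 / c * B"
      using c(1) by (intro mult_left_mono B) simp
    finally show ?case .
  qed
  then obtain N where N: "\<And>k. N \<le> k \<Longrightarrow> norm (e k) \<le> 2 / c * B"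
    unfolding eventually_sequentially by blast
  have "bounded (range (\<lambda>k. e (k + N)))"
    unfolding bounded_iff by (rule exI[of _ "2 / c * B"]) (use N in auto)
  then obtain w \<sigma> where \<sigma>: "strict_mono \<sigma>" "((\<lambda>k. e (k + N)) \<circ> \<sigma>) \<longlonglongrightarrow> w"
    using bounded_imp_convergent_subsequence[of "\<lambda>k. e (k + N)"] by blast
  define \<tau> where "\<tau> k = \<sigma> k + N" for k
  have \<tau>: "strict_mono \<tau>" using \<sigma>(1) by (simp add: \<tau>_def strict_mono_def)
  have e\<tau>: "(\<lambda>k. e (\<tau> k)) \<longlonglongrightarrow> w" using \<sigma>(2) by (simp add: \<tau>_def o_def)
  have \<delta>\<tau>: "(\<lambda>k. \<delta> (\<tau> k)) \<longlonglongrightarrow> 0" using LIMSEQ_subseq_LIMSEQ[OF \<delta>(1) \<tau>] by (simp add: o_def)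
  have "(\<lambda>k. (1 / \<delta> (\<tau> k)) *\<^sub>R (K (y + \<delta> (\<tau> k) *\<^sub>R e (\<tau> k)) - K y)) \<longlonglongrightarrow> \<D> K y w"
    by (rule difference_quotient_tendsto[OF dK \<delta>\<tau> \<delta>(2) e\<tau>])
  then have first: "\<D> K y w = \<D> G x u"
    using LIMSEQ_subseq_LIMSEQ[OF G1 \<tau>] LIMSEQ_unique by (fastforce simp: o_def eq z)
  then have lG: "l (\<D> G x u) = 0" using l(2) by metis
  have "(\<lambda>k. (l (K (y + \<delta> (\<tau> k) *\<^sub>R e (\<tau> k))) - l (K y) - \<delta> (\<tau> k) * l (\<D> K y (e (\<tau> k)))) / (\<delta> (\<tau> k))\<^sup>2)
      \<longlonglongrightarrow> l (\<D>\<^sub>2 K y w w) / 2"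
    by (rule second_order_quotient_tendsto[OF K l(1) \<delta>\<tau> \<delta>(2) e\<tau>])
  moreover have "(\<lambda>k. (l (G (x + \<delta> (\<tau> k) *\<^sub>R u)) - l (G x) - \<delta> (\<tau> k) * l (\<D> G x u)) / (\<delta> (\<tau> k))\<^sup>2)
      \<longlonglongrightarrow> l (\<D>\<^sub>2 G x u u) / 2"
    by (rule second_order_quotient_tendsto[OF G l(1) \<delta>\<tau> \<delta>(2) tendsto_const])
  ultimately have "l (\<D>\<^sub>2 K y w w) / 2 = l (\<D>\<^sub>2 G x u u) / 2"
    by (intro LIMSEQ_unique) (auto simp: eq lG l(2) simp flip: z)
  with first show ?thesis by auto
qed

text \<open>
  The second-order quotient is nonpositive because the first derivative vanishes.
\<close>

lemma second_derivative_nonpos_at_max: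
  fixes h :: "'e::euclidean_space \<Rightarrow> real"
  assumes h: "open S" "smooth_on S h" "x \<in> S" and max: "\<And>y. y \<in> S \<Longrightarrow> h y \<le> h x"
  shows "\<D> h x u = 0" "\<D>\<^sub>2 h x u u \<le> 0"
proof -
  have "\<D> h x = (\<lambda>v. 0)"
    by (rule differential_zero_maxmin[OF h(3,1) smooth_on_has_derivative[OF h(2,3)]]) (use max in auto)
  then show d0: "\<D> h x u = 0" by simp
  obtain r where r: "0 < r" "ball x r \<subseteq> S" using h(1,3) openE by blast
  define \<delta> where "\<delta> k = r / (norm u + 1) / real (k + 2)" for k
  have nu: "0 < norm u + 1" by (simp add: add_nonneg_pos)
  have \<delta>0: "\<delta> k \<noteq> 0" for k using r(1) nu by (simp add: \<delta>_def)
  have \<delta>: "\<delta> \<longlonglongrightarrow> 0"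
    unfolding \<delta>_def by (intro LIMSEQ_ignore_initial_segment[of "\<lambda>n. r / (norm u + 1) / real n" 0 2] lim_const_over_n)
  have "(\<lambda>k. (h (x + \<delta> k *\<^sub>R u) - h x - \<delta> k * \<D> h x u) / (\<delta> k)\<^sup>2) \<longlonglongrightarrow> \<D>\<^sub>2 h x u u / 2"
    using second_order_quotient_tendsto[OF h linear_ident \<delta> \<delta>0 tendsto_const] by simp
  moreover have "(h (x + \<delta> k *\<^sub>R u) - h x - \<delta> k * \<D> h x u) / (\<delta> k)\<^sup>2 \<le> 0" for k
  proof -
    have "\<bar>\<delta> k\<bar> * norm u \<le> \<bar>\<delta> k\<bar> * (norm u + 1)" by (intro mult_left_mono) auto
    also have "\<dots> < r" using r(1) nu divide_by_large_less[OF r(1), of k] by (simp add: \<delta>_def)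
    finally have "x + \<delta> k *\<^sub>R u \<in> S" using r(2) by (auto simp: subset_eq dist_norm)
    from max[OF this] show ?thesis by (simp add: d0 divide_nonpos_nonneg)
  qed
  ultimately have "\<D>\<^sub>2 h x u u / 2 \<le> 0" by (intro LIMSEQ_le_const2) auto
  then show "\<D>\<^sub>2 h x u u \<le> 0" by simp
qed


section \<open>Positive definite forms\<close>

definition pos_def :: "('a::euclidean_space \<Rightarrow> 'a \<Rightarrow> real) \<Rightarrow> bool" where
  "pos_def B \<longleftrightarrow> bilinear B \<and> (\<forall>u. u \<noteq> 0 \<longrightarrow> 0 < B u u)"

lemma pos_def_nondegenerate:
  assumes "pos_def B" "\<And>w. B x w = B y w"
  shows "x = y"
proof -
  have bil: "bilinear B" using assms(1) by (simp add: pos_def_def)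
  have "B (x - y) (x - y) = 0" using assms(2) by (simp add: bilinear_lsub[OF bil])
  then show ?thesis using assms(1) unfolding pos_def_def by (metis eq_iff_diff_eq_0 less_irrefl)
qed

lemma pos_def_ex1:
  assumes B: "pos_def B" and L: "linear (L :: 'a::euclidean_space \<Rightarrow> real)"
  shows "\<exists>!k. \<forall>w. B k w = L w"
proof -
  have bil: "bilinear B" using B by (simp add: pos_def_def)
  note uniq = pos_def_nondegenerate[OF B]
  \<comment> \<open>The map \<open>T\<close> represents the form with respect to the inner product; it is injective, hence onto.\<close>
  define T where "T k = (\<Sum>b\<in>Basis. B k b *\<^sub>R b)" for k
  have T: "T k \<bullet> b = B k b" if "b \<in> Basis" for k b using that by (simp add: T_def)
  have linT: "linear T"
    by (rule linearI) (auto simp: T_def bilinear_ladd[OF bil] bilinear_lmul[OF bil]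
        scaleR_add_left sum.distrib scaleR_sum_right)
  have ext: "\<forall>w. B k w = L w" if "\<And>b. b \<in> Basis \<Longrightarrow> B k b = L b" "linear L" for k L
  proof
    fix w
    have "linear (B k)" using bil by (simp add: bilinear_def)
    from linear_expand[OF this, of w] show "B k w = L w"
      using that by (simp add: linear_expand[OF that(2), of w])
  qed
  have "inj T"
  proof (rule injI)
    fix k k' assume "T k = T k'"
    then have "B k b = B k' b" if "b \<in> Basis" for b using T[OF that] by metis
    then show "k = k'" using ext[of k "B k'"] uniq[of k k'] bil by (simp add: bilinear_def)
  qed
  then obtain k where "T k = (\<Sum>b\<in>Basis. L b *\<^sub>R b)"
    using linear_injective_imp_surjective[OF linT] by (metis surjD)
  then have "B k b = L b" if "b \<in> Basis" for b using T[OF that, of k] that by simp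
  then have "\<forall>w. B k w = L w" using ext L by blast
  then show ?thesis using uniq by (intro ex1I[of _ k]) auto
qed

text \<open>
  Continuity of the solution \<open>k\<close> of \<open>B k w = L w\<close>.  No solution operator is needed: the
  difference \<open>k j - k0\<close> solves the equation with a small right-hand side, and \<open>B j\<close> stays uniformly
  positive definite.
\<close>

lemma pos_def_solution_tendsto:
  fixes B :: "'i \<Rightarrow> 'a::euclidean_space \<Rightarrow> 'a \<Rightarrow> real"
  assumes B: "\<forall>\<^sub>F j in F. bilinear (B j)" "pos_def B0" "\<And>u v. ((\<lambda>j. B j u v) \<longlongrightarrow> B0 u v) F"
    and L: "\<And>w. ((\<lambda>j. L j w) \<longlongrightarrow> L0 w) F"
    and k: "\<forall>\<^sub>F j in F. \<forall>w. B j (k j) w = L j w" "\<And>w. B0 k0 w = L0 w"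
  shows "(k \<longlongrightarrow> k0) F"
proof -
  have bil: "bilinear B0" using B(2) by (simp add: pos_def_def)
  \<comment> \<open>Compactness of the unit sphere gives a uniform lower bound for \<open>B0\<close>.\<close>
  obtain c where c: "0 < c" "\<And>u. c * (norm u)\<^sup>2 \<le> B0 u u"
  proof -
    have cont: "continuous_on (sphere 0 1) (\<lambda>u. B0 u u)"
      using bilinear_continuous_on_compose[OF continuous_on_id continuous_on_id bil] .
    have "sphere 0 1 \<noteq> ({} :: 'a set)" by simp
    then obtain m where m: "m \<in> sphere 0 1" "\<And>u. u \<in> sphere 0 1 \<Longrightarrow> B0 m m \<le> B0 u u"
      using continuous_attains_inf[OF compact_sphere _ cont] by blast
    show ?thesis
    proof
      show "0 < B0 m m" using m(1) B(2) unfolding pos_def_def mem_sphere_0 by (metis norm_zero zero_neq_one)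
      show "B0 m m * (norm u)\<^sup>2 \<le> B0 u u" for u
      proof (cases "u = 0")
        case False
        have u: "u = norm u *\<^sub>R sgn u" using False by (simp add: sgn_div_norm)
        have "B0 u u = (norm u)\<^sup>2 * B0 (sgn u) (sgn u)"
          by (subst (1 2) u) (simp only: bilinear_lmul[OF bil] bilinear_rmul[OF bil] power2_eq_square real_scaleR_def mult.assoc)
        moreover have "B0 m m \<le> B0 (sgn u) (sgn u)" using m(2) False by (simp add: norm_sgn)
        ultimately show ?thesis
          using mult_right_mono[of "B0 m m" _ "(norm u)\<^sup>2"] by (simp add: mult.commute)
      qed (simp add: bilinear_lzero[OF bil])
    qed
  qed
  define \<sigma> where "\<sigma> j = (\<Sum>a\<in>Basis. \<Sum>b\<in>Basis. \<bar>B j a b - B0 a b\<bar>)" for j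
  define \<rho> where "\<rho> j = (\<Sum>b\<in>Basis. \<bar>L j b - B j k0 b\<bar>)" for j
  have "(\<sigma> \<longlongrightarrow> (\<Sum>a\<in>Basis. \<Sum>b\<in>Basis. \<bar>B0 a b - B0 a b\<bar>)) F"
    unfolding \<sigma>_def by (intro tendsto_intros B)
  then have \<sigma>: "(\<sigma> \<longlongrightarrow> 0) F" by simp
  have "(\<rho> \<longlongrightarrow> (\<Sum>b\<in>Basis. \<bar>L0 b - B0 k0 b\<bar>)) F"
    unfolding \<rho>_def by (intro tendsto_intros B L)
  then have \<rho>: "(\<rho> \<longlongrightarrow> 0) F" by (simp add: k(2))
  have lin_bound: "\<bar>l v\<bar> \<le> (\<Sum>b\<in>Basis. \<bar>l b\<bar>) * norm v" if "linear l" for l :: "'a \<Rightarrow> real" and v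
  proof -
    have "\<bar>l v\<bar> \<le> (\<Sum>b\<in>Basis. \<bar>(v \<bullet> b) *\<^sub>R l b\<bar>)"
      by (subst linear_expand[OF that]) (rule sum_abs)
    also have "\<dots> \<le> (\<Sum>b\<in>Basis. \<bar>l b\<bar> * norm v)"
      by (intro sum_mono) (simp add: abs_mult mult.commute[of "norm v"] mult.commute[of "\<bar>v \<bullet> _\<bar>"] mult_left_mono Basis_le_norm)
    finally show ?thesis by (simp add: sum_distrib_right)
  qed
  have ev: "\<forall>\<^sub>F j in F. \<sigma> j < c / 2" using order_tendstoD(2)[OF \<sigma>, of "c / 2"] c(1) by simp
  have "\<forall>\<^sub>F j in F. norm (k j - k0) \<le> 2 / c * \<rho> j"
    using ev B(1) k(1)
  proof eventually_elim
    case (elim j)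
    let ?e = "k j - k0"
    have lin: "linear (\<lambda>v. B j u v)" "linear (\<lambda>v. B j v u)" for u using elim(2) by (auto simp: bilinear_def)
    have lin0: "linear (\<lambda>v. B0 u v)" "linear (\<lambda>v. B0 v u)" for u using bil by (auto simp: bilinear_def)
    have "\<bar>B j ?e ?e - B0 ?e ?e\<bar> \<le> (\<Sum>a\<in>Basis. \<bar>B j a ?e - B0 a ?e\<bar>) * norm ?e"
      by (rule lin_bound[of "\<lambda>a. B j a ?e - B0 a ?e"]) (intro linear_compose_sub lin lin0)
    also have "\<dots> \<le> (\<Sum>a\<in>Basis. (\<Sum>b\<in>Basis. \<bar>B j a b - B0 a b\<bar>) * norm ?e) * norm ?e"
      by (intro mult_right_mono sum_mono lin_bound[of "\<lambda>b. B j _ b - B0 _ b"] linear_compose_sub lin lin0) simp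
    also have "\<dots> = \<sigma> j * (norm ?e)\<^sup>2"
      by (simp add: \<sigma>_def sum_distrib_right power2_eq_square mult.assoc)
    finally have 1: "B0 ?e ?e \<le> B j ?e ?e + \<sigma> j * (norm ?e)\<^sup>2" by linarith
    have "B j ?e w = L j w - B j k0 w" for w using elim(3) bilinear_lsub[OF elim(2)] by simp
    then have 2: "B j ?e ?e \<le> \<rho> j * norm ?e"
      using lin_bound[OF lin(1)[of ?e], of ?e] by (simp add: \<rho>_def)
    have "c * (norm ?e)\<^sup>2 \<le> \<rho> j * norm ?e + \<sigma> j * (norm ?e)\<^sup>2" using 1 2 c(2)[of ?e] by linarith
    also have "\<dots> \<le> \<rho> j * norm ?e + c / 2 * (norm ?e)\<^sup>2"
      using elim(1) by (intro add_left_mono mult_right_mono) auto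
    finally have "c / 2 * norm ?e * norm ?e \<le> \<rho> j * norm ?e" by (simp add: power2_eq_square)
    moreover have "0 \<le> \<rho> j" by (simp add: \<rho>_def sum_nonneg)
    ultimately have "c / 2 * norm ?e \<le> \<rho> j"
      by (cases "?e = 0") auto
    then show ?case using c(1) by (simp add: field_simps)
  qed
  moreover have "((\<lambda>j. 2 / c * \<rho> j) \<longlongrightarrow> 0) F" using tendsto_mult_left[OF \<rho>, of "2 / c"] by simp
  ultimately have "((\<lambda>j. k j - k0) \<longlongrightarrow> 0) F" by (rule Lim_null_comparison)
  then show ?thesis by (simp add: LIM_zero_iff)
qed


section \<open>Isolated points of graphs\<close>

text \<open>
  The set consists of the first coordinates of the isolated points of the graph of \<open>r\<close> over \<open>T\<close>, and a
  countable basis separates isolated points.  Nothing is assumed about \<open>r\<close>, so this applies to an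
  arbitrary choice of preimages.
\<close>

lemma countable_isolated_graph:
  fixes r :: "real \<Rightarrow> 'n::{t2_space,second_countable_topology}"
  shows "countable {t \<in> T. \<not> (\<exists>s. (\<forall>k::nat. s k \<in> T \<and> s k \<noteq> t) \<and> s \<longlonglongrightarrow> t \<and> (\<lambda>k. r (s k)) \<longlonglongrightarrow> r t)}"
    (is "countable ?X")
proof -
  define X where "X = ?X"
  obtain \<B> :: "(real \<times> 'n) set set" where \<B>: "countable \<B>" "topological_basis \<B>"
    using ex_countable_basis by blast
  have "\<exists>b\<in>\<B>. (t, r t) \<in> b \<and> (\<forall>s\<in>T. (s, r s) \<in> b \<longrightarrow> s = t)" if t: "t \<in> X" for t
  proof (rule ccontr)
    assume no: "\<not> ?thesis"
    obtain A :: "nat \<Rightarrow> (real \<times> 'n) set" where A: "\<And>i. open (A i)" "\<And>i. (t, r t) \<in> A i"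
      "\<And>F. (\<forall>n. F n \<in> A n) \<Longrightarrow> F \<longlonglongrightarrow> (t, r t)"
      by (rule first_countable_topology_class.countable_basis[of "(t, r t)"]) (rule that)
    have "\<exists>s\<in>T. (s, r s) \<in> A k \<and> s \<noteq> t" for k
    proof -
      obtain b where "b \<in> \<B>" "(t, r t) \<in> b" "b \<subseteq> A k"
        by (rule topological_basisE[OF \<B>(2) A(1)[of k] A(2)[of k]])
      then show ?thesis using no by blast
    qed
    then obtain s where s: "\<And>k. s k \<in> T \<and> (s k, r (s k)) \<in> A k \<and> s k \<noteq> t" by metis
    then have "(\<lambda>k. (s k, r (s k))) \<longlonglongrightarrow> (t, r t)" by (intro A(3)) auto
    then have "s \<longlonglongrightarrow> t" "(\<lambda>k. r (s k)) \<longlonglongrightarrow> r t" using tendsto_fst tendsto_snd by fastforce+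
    with s t show False unfolding X_def by blast
  qed
  then have "\<forall>t\<in>X. \<exists>b. b \<in> \<B> \<and> (t, r t) \<in> b \<and> (\<forall>s\<in>T. (s, r s) \<in> b \<longrightarrow> s = t)" by blast
  then obtain b where b: "\<forall>t\<in>X. b t \<in> \<B> \<and> (t, r t) \<in> b t \<and> (\<forall>s\<in>T. (s, r s) \<in> b t \<longrightarrow> s = t)"
    by (rule bchoice[THEN exE])
  have "inj_on b X"
  proof (rule inj_onI)
    fix s t assume st: "s \<in> X" "t \<in> X" "b s = b t"
    have "(s, r s) \<in> b t" using bspec[OF b st(1)] st(3) by simp
    moreover have "s \<in> T" using st(1) by (simp add: X_def)
    ultimately show "s = t" using bspec[OF b st(2)] by simp
  qed
  moreover have "b ` X \<subseteq> \<B>" using bspec[OF b] by auto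
  ultimately have "countable X" using \<B>(1) by (meson countable_image_inj_on countable_subset)
  then show ?thesis by (simp add: X_def)
qed


section \<open>Charts and tangent vectors\<close>

abbreviation in_charts ::
  "('a, 'e::euclidean_space) chart \<Rightarrow> ('b, 'f::euclidean_space) chart \<Rightarrow> ('a \<Rightarrow> 'b) \<Rightarrow> 'e \<Rightarrow> 'f" where
  "in_charts c d \<psi> \<equiv> coord d \<circ> \<psi> \<circ> param c"

abbreviation chart_dom ::
  "('a, 'e::euclidean_space) chart \<Rightarrow> ('b, 'f::euclidean_space) chart \<Rightarrow> ('a \<Rightarrow> 'b) \<Rightarrow> 'e set" where
  "chart_dom c d \<psi> \<equiv> coord c ` (dom_of c \<inter> \<psi> -` dom_of d)"

lemma charts_atD:
  assumes "c \<in> charts_at A p"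
  shows "c \<in> A" "p \<in> dom_of c"
  using assms by (auto simp: charts_at_def)

lemma smooth_atlas_homeomorphism:
  assumes "smooth_atlas A" "c \<in> A"
  shows "open (dom_of c)" "open (coord c ` dom_of c)"
    "homeomorphism (dom_of c) (coord c ` dom_of c) (coord c) (param c)"
  using assms unfolding smooth_atlas_def by auto

lemma charts_at_nonempty: "smooth_atlas A \<Longrightarrow> \<exists>c. c \<in> charts_at A p"
  unfolding smooth_atlas_def charts_at_def by blast

lemma param_coord:
  assumes "smooth_atlas A" "c \<in> A" "p \<in> dom_of c"
  shows "param c (coord c p) = p"
  using homeomorphism_apply1[OF smooth_atlas_homeomorphism(3)[OF assms(1,2)] assms(3)] .

lemma coord_image_mem:
  assumes "smooth_atlas A" "c \<in> A"
  shows "z \<in> coord c ` (dom_of c \<inter> U) \<longleftrightarrow> z \<in> coord c ` dom_of c \<and> param c z \<in> U"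
  using param_coord[OF assms] by auto

lemma coord_param:
  assumes "smooth_atlas A" "c \<in> A" "z \<in> coord c ` dom_of c"
  shows "coord c (param c z) = z" "param c z \<in> dom_of c"
  using assms(3) param_coord[OF assms(1,2)] by auto

lemma open_coord_image:
  assumes "smooth_atlas A" "c \<in> A" "open U"
  shows "open (coord c ` (dom_of c \<inter> U))"
proof -
  note h = smooth_atlas_homeomorphism[OF assms(1,2)]
  have "openin (top_of_set (dom_of c)) (dom_of c \<inter> U)" using assms(3) by (simp add: openin_open_Int)
  from homeomorphism_imp_open_map[OF h(3) this] show ?thesis
    using h(2) openin_open_eq by blast
qed

lemma smooth_on_transition:
  assumes "smooth_atlas A" "c \<in> A" "d \<in> A"
  shows "smooth_on (coord c ` (dom_of c \<inter> dom_of d)) (coord d \<circ> param c)"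
  using assms unfolding smooth_atlas_def by blast

lemma transition_has_derivative:
  assumes "smooth_atlas A" "c \<in> charts_at A p" "d \<in> charts_at A p"
  shows "((coord d \<circ> param c) has_derivative \<D> (coord d \<circ> param c) (coord c p)) (at (coord c p))"
  using smooth_on_has_derivative[OF smooth_on_transition[OF assms(1)]] assms(2,3)
  by (auto simp: charts_at_def)

lemma transition_self:
  assumes "smooth_atlas A" "c \<in> charts_at A p"
  shows "\<D> (coord c \<circ> param c) (coord c p) u = u"
proof -
  note c = charts_atD[OF assms(2)]
  have "\<D> (coord c \<circ> param c) (coord c p) = \<D> (\<lambda>z. z) (coord c p)"
    by (rule \<D>_cong[OF smooth_atlas_homeomorphism(2)[OF assms(1) c(1)]])
      (use c coord_param[OF assms(1) c(1)] in auto)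
  then show ?thesis by simp
qed

lemma change_target_chart:
  assumes A: "smooth_atlas A" "c \<in> charts_at A p" and B: "smooth_atlas B" "d \<in> charts_at B (\<psi> p)" "d' \<in> charts_at B (\<psi> p)"
    and \<psi>: "continuous_on UNIV \<psi>" "(in_charts c d \<psi> has_derivative F') (at (coord c p))"
  shows "(in_charts c d' \<psi> has_derivative (\<lambda>u. \<D> (coord d' \<circ> param d) (coord d (\<psi> p)) (F' u))) (at (coord c p))"
proof -
  note c = charts_atD[OF A(2)] and d = charts_atD[OF B(2)] and d' = charts_atD[OF B(3)]
  let ?S = "coord c ` (dom_of c \<inter> \<psi> -` (dom_of d \<inter> dom_of d'))"
  have "open (\<psi> -` (dom_of d \<inter> dom_of d'))"
    by (intro open_vimage \<psi> open_Int smooth_atlas_homeomorphism[OF B(1)] d d')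
  then have S: "open ?S" by (rule open_coord_image[OF A(1) c(1)])
  have p: "param c (coord c p) = p" by (rule param_coord[OF A(1) c])
  have "(coord d' \<circ> param d has_derivative \<D> (coord d' \<circ> param d) (coord d (\<psi> p))) (at (in_charts c d \<psi> (coord c p)))"
    using transition_has_derivative[OF B] by (simp add: p)
  from diff_chain_at[OF \<psi>(2) this]
  have "((coord d' \<circ> param d) \<circ> in_charts c d \<psi> has_derivative
      (\<lambda>u. \<D> (coord d' \<circ> param d) (coord d (\<psi> p)) (F' u))) (at (coord c p))"
    by (simp add: o_def)
  then show ?thesis
    by (rule has_derivative_transform_within_open[OF _ S])
      (use c d d' param_coord[OF A(1) c(1)] param_coord[OF B(1) d(1)] in \<open>auto simp: p\<close>)
qed

lemma change_source_chart:
  assumes A: "smooth_atlas A" "c \<in> charts_at A p" "c' \<in> charts_at A p"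
    and F: "((F \<circ> param c) has_derivative F') (at (coord c p))"
  shows "((F \<circ> param c') has_derivative (\<lambda>u. F' (\<D> (coord c \<circ> param c') (coord c' p) u))) (at (coord c' p))"
proof -
  note c = charts_atD[OF A(2)] and c' = charts_atD[OF A(3)]
  have S: "open (coord c' ` (dom_of c' \<inter> dom_of c))"
    by (rule open_coord_image[OF A(1) c'(1) smooth_atlas_homeomorphism(1)[OF A(1) c(1)]])
  have p: "(coord c \<circ> param c') (coord c' p) = coord c p" using param_coord[OF A(1) c'] by simp
  have "(F \<circ> param c has_derivative F') (at ((coord c \<circ> param c') (coord c' p)))" using F p by simp
  from diff_chain_at[OF transition_has_derivative[OF A(1,3,2)] this]
  have "((F \<circ> param c) \<circ> (coord c \<circ> param c') has_derivative
      (\<lambda>u. F' (\<D> (coord c \<circ> param c') (coord c' p) u))) (at (coord c' p))"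
    by (simp add: o_def)
  then show ?thesis
    by (rule has_derivative_transform_within_open[OF _ S])
      (use c c' param_coord[OF A(1) c'(1)] param_coord[OF A(1) c(1)] in auto)
qed

lemma transition_compose:
  assumes "smooth_atlas A" "c \<in> charts_at A p" "d \<in> charts_at A p" "e \<in> charts_at A p"
  shows "\<D> (coord e \<circ> param d) (coord d p) (\<D> (coord d \<circ> param c) (coord c p) u) = \<D> (coord e \<circ> param c) (coord c p) u"
  using \<D>_eqI[OF change_source_chart[OF assms(1,3,2) transition_has_derivative[OF assms(1,3,4)]]] by simp

lemma coord_vector_tangent:
  "smooth_atlas A \<Longrightarrow> c \<in> charts_at A p \<Longrightarrow> coord_vector A c p u \<in> tangent_space A p"
  by (auto simp: tangent_space_def coord_vector_def transition_compose)

lemma coord_vector_self: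
  "smooth_atlas A \<Longrightarrow> c \<in> charts_at A p \<Longrightarrow> coord_vector A c p u c = u"
  by (simp add: coord_vector_def transition_self)

lemma coord_vector_eq_iff:
  "smooth_atlas A \<Longrightarrow> c \<in> charts_at A p \<Longrightarrow> coord_vector A c p u = coord_vector A c p v \<longleftrightarrow> u = v"
  by (metis coord_vector_self)

lemma tangent_space_eq:
  assumes "smooth_atlas A" "c \<in> charts_at A p"
  shows "tangent_space A p = range (coord_vector A c p)"
proof -
  have "v = coord_vector A c p (v c)" if "v \<in> tangent_space A p" for v
  proof
    fix d show "v d = coord_vector A c p (v c) d"
    proof (cases "d \<in> charts_at A p")
      case True
      then have "v d = \<D> (coord d \<circ> param c) (coord c p) (v c)"
        using that assms(2) unfolding tangent_space_def by blast
      with True show ?thesis by (simp only: coord_vector_def if_True)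
    next
      case False
      then have "v d = 0" using that unfolding tangent_space_def by blast
      with False show ?thesis by (simp add: coord_vector_def)
    qed
  qed
  then show ?thesis using coord_vector_tangent[OF assms] by blast
qed

text \<open>
  The definition of \<open>differential\<close> computes in an arbitrary chart around \<open>p\<close>; the change-of-chart
  lemmas show that the chart is irrelevant.
\<close>

lemma differential_coord_vector:
  assumes A: "smooth_atlas A" "c \<in> charts_at A p" and B: "smooth_atlas B" "d \<in> charts_at B (\<psi> p)"
    and \<psi>: "continuous_on UNIV \<psi>" "(in_charts c d \<psi> has_derivative F') (at (coord c p))"
  shows "differential A B \<psi> p (coord_vector A c p u) = coord_vector B d (\<psi> p) (F' u)"
proof
  fix e
  define c' where "c' = (SOME c. c \<in> charts_at A p)"
  have c': "c' \<in> charts_at A p" unfolding c'_def using A(2) by (rule someI)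
  show "differential A B \<psi> p (coord_vector A c p u) e = coord_vector B d (\<psi> p) (F' u) e"
  proof (cases "e \<in> charts_at B (\<psi> p)")
    case e: True
    let ?T = "\<D> (coord c \<circ> param c') (coord c' p)"
    have "\<D> (in_charts c' e \<psi>) (coord c' p) =
        (\<lambda>u. \<D> (coord e \<circ> param d) (coord d (\<psi> p)) (F' (?T u)))"
      by (intro \<D>_eqI change_source_chart[OF A c', of "coord e \<circ> \<psi>"]) 
        (rule change_target_chart[where \<psi> = \<psi>, OF A B(1,2) e \<psi>])
    moreover have "?T (\<D> (coord c' \<circ> param c) (coord c p) u) = u"
      by (simp add: transition_compose[OF A c' A(2)] transition_self[OF A])
    ultimately show ?thesis
      using e c' by (simp add: differential_def c'_def[symmetric] Let_def coord_vector_def)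
  qed (simp add: differential_def coord_vector_def)
qed

lemma open_chart_dom:
  assumes "smooth_atlas A" "c \<in> A" "smooth_atlas B" "d \<in> B" "continuous_on UNIV \<psi>"
  shows "open (chart_dom c d \<psi>)"
  by (intro open_coord_image[OF assms(1,2)] open_vimage smooth_atlas_homeomorphism[OF assms(3,4)] assms(5))

lemma smooth_mapD:
  assumes "smooth_map A B \<psi>" "c \<in> A" "d \<in> B"
  shows "continuous_on UNIV \<psi>" "smooth_on (chart_dom c d \<psi>) (in_charts c d \<psi>)"
  using assms unfolding smooth_map_def by auto

lemma differential_smooth_map:
  assumes "smooth_atlas A" "c \<in> charts_at A p" "smooth_atlas B" "d \<in> charts_at B (\<psi> p)" "smooth_map A B \<psi>"
  shows "differential A B \<psi> p (coord_vector A c p u) = coord_vector B d (\<psi> p) (\<D> (in_charts c d \<psi>) (coord c p) u)"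
proof (rule differential_coord_vector[where \<psi> = \<psi>, OF assms(1-4)])
  note s = smooth_mapD[OF assms(5) charts_atD(1)[OF assms(2)] charts_atD(1)[OF assms(4)]]
  show "continuous_on UNIV \<psi>" by (rule s(1))
  show "(in_charts c d \<psi> has_derivative \<D> (in_charts c d \<psi>) (coord c p)) (at (coord c p))"
    by (rule smooth_on_has_derivative[OF s(2)]) (use charts_atD[OF assms(2)] charts_atD[OF assms(4)] in auto)
qed

text \<open>
  In coordinates the tangent space of an immersed manifold is the range of the derivative.
\<close>

lemma immersed_tangent_space_eq:
  assumes "smooth_atlas A" "c \<in> charts_at A p" "smooth_atlas B" "d \<in> charts_at B (\<psi> p)" "smooth_map A B \<psi>"
  shows "immersed_tangent_space A B \<psi> p = coord_vector B d (\<psi> p) ` range (\<D> (in_charts c d \<psi>) (coord c p))"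
  unfolding immersed_tangent_space_def tangent_space_eq[OF assms(1,2)] image_image
  using differential_smooth_map[OF assms] by simp

lemma immersion_inj:
  assumes "smooth_atlas A" "c \<in> charts_at A p" "smooth_atlas B" "d \<in> charts_at B (\<psi> p)" "immersion A B \<psi>"
  shows "inj (\<D> (in_charts c d \<psi>) (coord c p))"
proof (rule injI)
  fix u v assume eq: "\<D> (in_charts c d \<psi>) (coord c p) u = \<D> (in_charts c d \<psi>) (coord c p) v"
  have s: "smooth_map A B \<psi>" "inj_on (differential A B \<psi> p) (tangent_space A p)"
    using assms(5) by (auto simp: immersion_def)
  have "differential A B \<psi> p (coord_vector A c p u) = differential A B \<psi> p (coord_vector A c p v)"
    using differential_smooth_map[OF assms(1-4) s(1)] eq by simp
  then have "coord_vector A c p u = coord_vector A c p v"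
    by (rule inj_onD[OF s(2) _ coord_vector_tangent[OF assms(1,2)] coord_vector_tangent[OF assms(1,2)]])
  then show "u = v" using coord_vector_eq_iff[OF assms(1,2)] by simp
qed


section \<open>The metric and the Levi-Civita connection in a chart\<close>

lemma metric_in_chart_coord:
  assumes "smooth_atlas A" "c \<in> charts_at A p"
  shows "metric_in_chart A g c (coord c p) u v = g p (coord_vector A c p u) (coord_vector A c p v)"
  using param_coord[OF assms(1) charts_atD[OF assms(2)]] by (simp add: metric_in_chart_def)

lemma riemannian_manifoldD:
  assumes "riemannian_manifold A g" "c \<in> A"
  shows "smooth_atlas A"
    and "\<And>z. z \<in> coord c ` dom_of c \<Longrightarrow> pos_def (metric_in_chart A g c z)"
    and "\<And>z u v. z \<in> coord c ` dom_of c \<Longrightarrow> metric_in_chart A g c z u v = metric_in_chart A g c z v u"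
    and "\<And>u v. smooth_on (coord c ` dom_of c) (\<lambda>z. metric_in_chart A g c z u v)"
  using assms unfolding riemannian_manifold_def pos_def_def by blast+

text \<open>
  The Christoffel symbols with lowered index: the right-hand side of the Koszul formula for the
  fields with constant coordinates \<open>u\<close>, \<open>v\<close>, \<open>w\<close>.
\<close>

definition koszul :: "('e::euclidean_space \<Rightarrow> 'e \<Rightarrow> 'e \<Rightarrow> real) \<Rightarrow> 'e \<Rightarrow> 'e \<Rightarrow> 'e \<Rightarrow> 'e \<Rightarrow> real" where
  "koszul G z u v w = (\<D> (\<lambda>y. G y v w) z u + \<D> (\<lambda>y. G y u w) z v - \<D> (\<lambda>y. G y u v) z w) / 2"

text \<open>
  The coordinate form of a Riemannian metric, so that the calculus needs no manifold.
\<close>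

definition smooth_metric :: "'e::euclidean_space set \<Rightarrow> ('e \<Rightarrow> 'e \<Rightarrow> 'e \<Rightarrow> real) \<Rightarrow> bool" where
  "smooth_metric S G \<longleftrightarrow> open S \<and>
     (\<forall>z\<in>S. pos_def (G z) \<and> (\<forall>u v. G z u v = G z v u)) \<and> (\<forall>u v. smooth_on S (\<lambda>z. G z u v))"

lemma smooth_metricD:
  assumes "smooth_metric S G"
  shows "open S"
    and "\<And>z. z \<in> S \<Longrightarrow> pos_def (G z)"
    and "\<And>z. z \<in> S \<Longrightarrow> bilinear (G z)"
    and "\<And>z u v. z \<in> S \<Longrightarrow> G z u v = G z v u"
    and "\<And>u v. smooth_on S (\<lambda>z. G z u v)"
  using assms unfolding smooth_metric_def pos_def_def by auto

lemma smooth_metric_in_chart: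
  assumes "riemannian_manifold A g" "c \<in> A"
  shows "smooth_metric (coord c ` dom_of c) (metric_in_chart A g c)"
  unfolding smooth_metric_def
  using riemannian_manifoldD[OF assms] smooth_atlas_homeomorphism(2)[OF riemannian_manifoldD(1)[OF assms] assms(2)]
  by blast

lemma linear_\<D>_metric:
  assumes "smooth_metric S G" "z \<in> S"
  shows "linear (\<lambda>v. \<D> (\<lambda>y. G y v w) z u)" "linear (\<lambda>w. \<D> (\<lambda>y. G y v w) z u)"
    "linear (\<lambda>u. \<D> (\<lambda>y. G y v w) z u)"
proof -
  note G = smooth_metricD[OF assms(1)]
  have d: "(\<lambda>y. G y v w) differentiable (at z)" for v w
    by (rule smooth_on_differentiable[OF G(5) assms(2)])
  show "linear (\<lambda>v. \<D> (\<lambda>y. G y v w) z u)"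
    by (rule linear_\<D>_parameter[OF G(1) assms(2), of "\<lambda>y v. G y v w"]) (use G(3) d in \<open>auto simp: bilinear_def\<close>)
  show "linear (\<lambda>w. \<D> (\<lambda>y. G y v w) z u)"
    by (rule linear_\<D>_parameter[OF G(1) assms(2), of "\<lambda>y w. G y v w"]) (use G(3) d in \<open>auto simp: bilinear_def\<close>)
  show "linear (\<lambda>u. \<D> (\<lambda>y. G y v w) z u)" by (rule linear_\<D>[OF d])
qed

lemma linear_koszul:
  assumes "smooth_metric S G" "z \<in> S"
  shows "linear (\<lambda>u. koszul G z u v w)" "linear (\<lambda>v. koszul G z u v w)" "linear (\<lambda>w. koszul G z u v w)"
proof -
  note l = linear_\<D>_metric[OF assms]
  have half: "linear (\<lambda>u. l u / 2)" if "linear l" for l :: "'a \<Rightarrow> real"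
    using linear_compose_scale_right[OF that, of "1/2"] by simp
  show "linear (\<lambda>u. koszul G z u v w)" "linear (\<lambda>v. koszul G z u v w)" "linear (\<lambda>w. koszul G z u v w)"
    unfolding koszul_def by (intro half linear_compose_add linear_compose_sub l)+
qed

lemma christoffel_koszul:
  assumes "riemannian_manifold A g" "c \<in> A" "z \<in> coord c ` dom_of c"
  shows "metric_in_chart A g c z (christoffel A g c z u v) w = koszul (metric_in_chart A g c) z u v w"
proof -
  let ?G = "metric_in_chart A g c"
  have "\<exists>!k. \<forall>w. ?G z k w = koszul ?G z u v w"
    by (rule pos_def_ex1[OF riemannian_manifoldD(2)[OF assms] linear_koszul(3)[OF smooth_metric_in_chart[OF assms(1,2)] assms(3)]])
  then have "\<exists>!k. \<forall>w. 2 * ?G z k w = \<D> (\<lambda>y. ?G y v w) z u + \<D> (\<lambda>y. ?G y u w) z v - \<D> (\<lambda>y. ?G y u v) z w"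
    by (simp add: koszul_def eq_divide_eq mult.commute)
  from theI'[OF this] have "2 * ?G z (christoffel A g c z u v) w =
      \<D> (\<lambda>y. ?G y v w) z u + \<D> (\<lambda>y. ?G y u w) z v - \<D> (\<lambda>y. ?G y u v) z w"
    unfolding christoffel_def[symmetric] by blast
  then show ?thesis unfolding koszul_def by (simp add: eq_divide_eq mult.commute)
qed

lemma bilinear_christoffel:
  assumes "riemannian_manifold A g" "c \<in> A" "z \<in> coord c ` dom_of c"
  shows "bilinear (christoffel A g c z)"
proof -
  let ?G = "metric_in_chart A g c z"
  note pd = riemannian_manifoldD(2)[OF assms]
  have bil: "bilinear ?G" using pd by (simp add: pos_def_def)
  note k = christoffel_koszul[OF assms] and l = linear_koszul[OF smooth_metric_in_chart[OF assms(1,2)] assms(3)]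
  show ?thesis
    unfolding bilinear_def
    by (auto intro!: linearI pos_def_nondegenerate[OF pd] simp: bilinear_ladd[OF bil] bilinear_lmul[OF bil] k
        linear_add[OF l(1)] linear_add[OF l(2)] linear_scale[OF l(1)] linear_scale[OF l(2)])
qed

lemma christoffel_symmetric:
  assumes "riemannian_manifold A g" "c \<in> A" "z \<in> coord c ` dom_of c"
  shows "christoffel A g c z u v = christoffel A g c z v u"
proof (rule pos_def_nondegenerate[OF riemannian_manifoldD(2)[OF assms]])
  fix w
  have "\<D> (\<lambda>y. metric_in_chart A g c y u v) z = \<D> (\<lambda>y. metric_in_chart A g c y v u) z"
    by (rule \<D>_cong[OF smooth_metricD(1)[OF smooth_metric_in_chart[OF assms(1,2)]] assms(3)])
      (rule riemannian_manifoldD(3)[OF assms(1,2)])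
  then show "metric_in_chart A g c z (christoffel A g c z u v) w = metric_in_chart A g c z (christoffel A g c z v u) w"
    unfolding christoffel_koszul[OF assms] koszul_def by simp
qed

lemma tendsto_metric:
  assumes "smooth_metric S G" "z \<in> S" "(p \<longlongrightarrow> z) F" "(u \<longlongrightarrow> u0) F" "(v \<longlongrightarrow> v0) F"
  shows "((\<lambda>j. G (p j) (u j) (v j)) \<longlongrightarrow> G z u0 v0) F"
proof (rule tendsto_bilinear_apply[where B = "\<lambda>j. G (p j)" and ?B0.0 = "G z" and x = u and y = v])
  note G = smooth_metricD[OF assms(1)]
  show "\<forall>\<^sub>F j in F. bilinear (G (p j))"
    using topological_tendstoD[OF assms(3) G(1) assms(2)] by eventually_elim (rule G(3))
  show "bilinear (G z)" by (rule G(3)[OF assms(2)])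
  show "((\<lambda>j. G (p j) u v) \<longlongrightarrow> G z u v) F" for u v
    by (rule smooth_on_tendsto[OF G(5,1) assms(3,2)])
qed fact+

text \<open>
  The symbols solve a linear system whose coefficients are those of the metric.
\<close>

lemma tendsto_christoffel:
  assumes R: "riemannian_manifold A g" "c \<in> A" and z: "z \<in> coord c ` dom_of c" "(p \<longlongrightarrow> z) F"
    and lim: "(u \<longlongrightarrow> u0) F" "(v \<longlongrightarrow> v0) F"
  shows "((\<lambda>j. christoffel A g c (p j) (u j) (v j)) \<longlongrightarrow> christoffel A g c z u0 v0) F"
proof (rule tendsto_bilinear_apply[where B = "\<lambda>j. christoffel A g c (p j)" and ?B0.0 = "christoffel A g c z" and x = u and y = v])
  let ?G = "metric_in_chart A g c"
  note sm = smooth_metric_in_chart[OF R]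
  note G = smooth_metricD[OF sm]
  have ev: "\<forall>\<^sub>F j in F. p j \<in> coord c ` dom_of c" by (rule topological_tendstoD[OF z(2) G(1) z(1)])
  show "\<forall>\<^sub>F j in F. bilinear (christoffel A g c (p j))"
    using ev by eventually_elim (rule bilinear_christoffel[OF R])
  show "bilinear (christoffel A g c z)" by (rule bilinear_christoffel[OF R z(1)])
  show "((\<lambda>j. christoffel A g c (p j) u v) \<longlongrightarrow> christoffel A g c z u v) F" for u v
  proof (rule pos_def_solution_tendsto[where B = "\<lambda>j. ?G (p j)" and ?B0.0 = "?G z" and L = "\<lambda>j. koszul ?G (p j) u v" and ?L0.0 = "koszul ?G z u v"])
    show "\<forall>\<^sub>F j in F. bilinear (?G (p j))" using ev by eventually_elim (rule G(3))
    show "pos_def (?G z)" by (rule G(2)[OF z(1)])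
    show "((\<lambda>j. ?G (p j) u v) \<longlongrightarrow> ?G z u v) F" for u v
      by (rule smooth_on_tendsto[OF G(5,1) z(2,1)])
    show "((\<lambda>j. koszul ?G (p j) u v w) \<longlongrightarrow> koszul ?G z u v w) F" for w
      unfolding koszul_def
      by (intro tendsto_intros smooth_on_tendsto_\<D>[OF G(5,1) z(2,1)]) auto
    show "\<forall>\<^sub>F j in F. \<forall>w. ?G (p j) (christoffel A g c (p j) u v) w = koszul ?G (p j) u v w"
      using ev by eventually_elim (simp add: christoffel_koszul[OF R])
    show "?G z (christoffel A g c z u v) w = koszul ?G z u v w" for w
      by (rule christoffel_koszul[OF R z(1)])
  qed
qed (use lim in auto)

lemma has_derivative_metric:
  assumes G: "smooth_metric S G" and T: "open T" "z \<in> T" "p ` T \<subseteq> S"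
    and d: "(p has_derivative p') (at z)" "(q has_derivative q') (at z)" "(r has_derivative r') (at z)"
  shows "((\<lambda>y. G (p y) (q y) (r y)) has_derivative
     (\<lambda>u. \<D> (\<lambda>x. G x (q z) (r z)) (p z) (p' u) + G (p z) (q' u) (r z) + G (p z) (q z) (r' u))) (at z)"
proof -
  note G' = smooth_metricD[OF G]
  have lin: "linear (G (p y) v)" "linear (\<lambda>v. G (p y) v w)" if "y \<in> T" for y v w
    using G'(3)[of "p y"] T(3) that by (auto simp: bilinear_def)
  have 1: "((\<lambda>y. G (p y) v w) has_derivative (\<lambda>u. \<D> (\<lambda>x. G x v w) (p z) (p' u))) (at z)" for v w
    by (rule has_derivative_compose[OF d(1) smooth_on_has_derivative[OF G'(5)]]) (use T in auto)
  have 2: "((\<lambda>y. G (p y) (q y) w) has_derivative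
      (\<lambda>u. \<D> (\<lambda>x. G x (q z) w) (p z) (p' u) + G (p z) (q' u) w)) (at z)" for w
    by (rule has_derivative_linear_apply[OF T(1,2) lin(2) 1 d(2)])
  show ?thesis
    by (rule has_derivative_linear_apply[OF T(1,2) lin(1) 2 d(3)])
qed

text \<open>
  The analytic content of the Gauss formula.  When the product rule is applied to
  \<open>H (F y) (\<D> F y u) (\<D> F y v)\<close>, the Koszul combination cancels all terms with second derivatives
  of \<open>F\<close> except \<open>\<D>\<^sub>2 F z u v\<close>, by symmetry of the second derivative.
\<close>

lemma koszul_pullback:
  assumes F: "open S" "smooth_on S F" "F ` S \<subseteq> T" and H: "smooth_metric T H"
    and G: "\<And>y u v. y \<in> S \<Longrightarrow> G y u v = H (F y) (\<D> F y u) (\<D> F y v)" and z: "z \<in> S"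
  shows "koszul G z u v w =
    H (F z) (\<D>\<^sub>2 F z u v) (\<D> F z w) + koszul H (F z) (\<D> F z u) (\<D> F z v) (\<D> F z w)"
proof -
  note H' = smooth_metricD[OF H]
  have Fz: "F z \<in> T" using F(3) z by auto
  have "\<D> (\<lambda>y. G y a b) z c = \<D> (\<lambda>x. H x (\<D> F z a) (\<D> F z b)) (F z) (\<D> F z c)
     + H (F z) (\<D>\<^sub>2 F z c a) (\<D> F z b) + H (F z) (\<D> F z a) (\<D>\<^sub>2 F z c b)" for a b c
  proof -
    have "\<D> (\<lambda>y. G y a b) z = \<D> (\<lambda>y. H (F y) (\<D> F y a) (\<D> F y b)) z"
      by (rule \<D>_cong[OF F(1) z G])
    also have "\<dots> = (\<lambda>c. \<D> (\<lambda>x. H x (\<D> F z a) (\<D> F z b)) (F z) (\<D> F z c)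
     + H (F z) (\<D>\<^sub>2 F z c a) (\<D> F z b) + H (F z) (\<D> F z a) (\<D>\<^sub>2 F z c b))"
      by (intro \<D>_eqI has_derivative_metric[OF H F(1) z F(3)] smooth_on_has_derivative[OF F(2) z]
          smooth_on_has_derivative[OF smooth_on_\<D>[OF F(2)] z])
    finally show ?thesis by (rule fun_cong)
  qed
  then show ?thesis
    unfolding koszul_def
    by (simp add: \<D>\<^sub>2_symmetric[OF F(1,2) z, of v u] \<D>\<^sub>2_symmetric[OF F(1,2) z, of w] H'(4)[OF Fz, of "\<D> F z _" "\<D>\<^sub>2 F z _ _"] field_simps)
qed


section \<open>Totally geodesic immersions\<close>

lemma pos_def_pullback:
  assumes "pos_def G" "linear L" "inj L"
  shows "pos_def (\<lambda>u v. G (L u) (L v))"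
proof -
  have bil: "bilinear G" and pos: "u \<noteq> 0 \<Longrightarrow> 0 < G u u" for u using assms(1) by (auto simp: pos_def_def)
  have "bilinear (\<lambda>u v. G (L u) (L v))"
    unfolding bilinear_def
    by (auto intro!: linearI simp: linear_add[OF assms(2)] linear_scale[OF assms(2)] bilinear_ladd[OF bil]
        bilinear_radd[OF bil] bilinear_lmul[OF bil] bilinear_rmul[OF bil])
  moreover have "L u \<noteq> 0" if "u \<noteq> 0" for u
    using that assms(2,3) linear_injective_0 by blast
  ultimately show ?thesis using pos by (simp add: pos_def_def)
qed

text \<open>
  The orthogonal projection to the range of \<open>L\<close>, found by solving the normal equations.
\<close>

lemma orthogonal_decomposition:
  fixes L :: "'e::euclidean_space \<Rightarrow> 'f::euclidean_space"
  assumes "pos_def G" "linear L" "inj L"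
  shows "\<exists>k. \<forall>v. G (w - L k) (L v) = 0"
proof -
  have bil: "bilinear G" using assms(1) by (simp add: pos_def_def)
  have "linear (\<lambda>v. G w (L v))"
    using linear_compose[OF assms(2), of "G w"] bil by (simp add: bilinear_def o_def)
  from pos_def_ex1[OF pos_def_pullback[OF assms] this] obtain k where "\<forall>v. G (L k) (L v) = G w (L v)" by blast
  then show ?thesis by (intro exI[of _ k]) (simp add: bilinear_lsub[OF bil])
qed

lemma orth_complement_coord:
  assumes "smooth_atlas B" "d \<in> charts_at B p"
  shows "coord_vector B d p x \<in> orth_complement B h p (coord_vector B d p ` W) \<longleftrightarrow>
    (\<forall>w\<in>W. metric_in_chart B h d (coord d p) x w = 0)"
  using coord_vector_tangent[OF assms] by (auto simp: orth_complement_def metric_in_chart_coord[OF assms])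

text \<open>
  The definite description in \<open>normal_component\<close> is well defined by orthogonal decomposition; it
  is \<open>0\<close> exactly when nothing has to be removed from \<open>w\<close> to make it tangent.
\<close>

lemma normal_component_eq_0_iff:
  fixes L :: "'e::euclidean_space \<Rightarrow> 'f::euclidean_space"
  assumes R: "riemannian_manifold B h" "d \<in> charts_at B p" and L: "linear L" "inj L"
  shows "normal_component B h d p (coord_vector B d p ` range L) w = 0 \<longleftrightarrow> w \<in> range L"
proof -
  note d = charts_atD[OF R(2)]
  note A = riemannian_manifoldD(1)[OF R(1) d(1)]
  let ?G = "metric_in_chart B h d (coord d p)"
  let ?P = "\<lambda>x. coord_vector B d p x \<in> orth_complement B h p (coord_vector B d p ` range L)
     \<and> coord_vector B d p (w - x) \<in> coord_vector B d p ` range L"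
  have G: "pos_def ?G" using riemannian_manifoldD(2)[OF R(1) d(1)] d(2) by blast
  then have bil: "bilinear ?G" by (simp add: pos_def_def)
  have P: "?P x \<longleftrightarrow> (\<forall>u. ?G x (L u) = 0) \<and> w - x \<in> range L" for x
    unfolding orth_complement_coord[OF A R(2)] using coord_vector_eq_iff[OF A R(2)] by auto
  obtain k where k: "\<forall>v. ?G (w - L k) (L v) = 0" using orthogonal_decomposition[OF G L] by blast
  have ex1: "\<exists>!x. ?P x"
  proof (rule ex1I[of _ "w - L k"])
    show "?P (w - L k)" unfolding P using k by simp
    fix x assume "?P x"
    then obtain k' where k': "\<forall>u. ?G x (L u) = 0" "w - x = L k'" unfolding P by blast
    have diff: "x - (w - L k) = L (k - k')" using k'(2) by (simp add: linear_diff[OF L(1)] algebra_simps)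
    have "?G (x - (w - L k)) (x - (w - L k)) = 0"
      by (subst (2) diff) (simp add: bilinear_lsub[OF bil, of x] k k'(1))
    then show "x = w - L k" using G unfolding pos_def_def by (metis eq_iff_diff_eq_0 less_irrefl)
  qed
  have P0: "?P 0 \<longleftrightarrow> w \<in> range L" unfolding P by (simp add: bilinear_lzero[OF bil])
  show ?thesis
  proof
    assume "normal_component B h d p (coord_vector B d p ` range L) w = 0"
    then have "(THE x. ?P x) = 0" by (simp only: normal_component_def)
    with theI'[OF ex1] have "?P 0" by (rule back_subst[where P = ?P])
    then show "w \<in> range L" by (simp only: P0)
  next
    assume "w \<in> range L"
    then have "?P 0" by (simp only: P0)
    from the1_equality[OF ex1 this] show "normal_component B h d p (coord_vector B d p ` range L) w = 0"
      by (simp only: normal_component_def)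
  qed
qed

lemma second_fundamental_form_eq_0_iff:
  assumes A: "smooth_atlas A" "c \<in> charts_at A q" and R: "riemannian_manifold B h" "d \<in> charts_at B (\<psi> q)"
    and \<psi>: "immersion A B \<psi>"
  shows "second_fundamental_form A B h \<psi> c d q u v = 0 \<longleftrightarrow>
    ambient_derivative B h \<psi> c d q u v \<in> range (\<D> (in_charts c d \<psi>) (coord c q))"
proof -
  note c = charts_atD[OF A(2)] and d = charts_atD[OF R(2)]
  note B = riemannian_manifoldD(1)[OF R(1) d(1)]
  have sm: "smooth_map A B \<psi>" using \<psi> by (simp add: immersion_def)
  have "linear (\<D> (in_charts c d \<psi>) (coord c q))"
    by (rule smooth_on_linear_\<D>[OF smooth_mapD(2)[OF sm c(1) d(1)]]) (use c d in auto)
  then show ?thesis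
    unfolding second_fundamental_form_def immersed_tangent_space_eq[where \<psi> = \<psi>, OF A B R(2) sm]
    by (rule normal_component_eq_0_iff[OF R _ immersion_inj[where \<psi> = \<psi>, OF A B R(2) \<psi>]])
qed

text \<open>
  The form in which the hypothesis on \<open>N\<close> is used and the conclusion on \<open>\<Sigma>\<close> is proved.
\<close>

lemma totally_geodesic_iff:
  assumes "smooth_atlas A" "riemannian_manifold B h"
  shows "totally_geodesic A B h \<psi> \<longleftrightarrow> immersion A B \<psi> \<and>
    (\<forall>q. \<forall>c\<in>charts_at A q. \<forall>d\<in>charts_at B (\<psi> q). \<forall>u v.
      ambient_derivative B h \<psi> c d q u v \<in> range (\<D> (in_charts c d \<psi>) (coord c q)))"
  unfolding totally_geodesic_def
proof (rule conj_cong[OF refl], intro iff_allI ball_cong refl)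
  fix q c d u v
  assume "immersion A B \<psi>" and c: "c \<in> charts_at A q" and d: "d \<in> charts_at B (\<psi> q)"
  then show "second_fundamental_form A B h \<psi> c d q u v = 0 \<longleftrightarrow>
      ambient_derivative B h \<psi> c d q u v \<in> range (\<D> (in_charts c d \<psi>) (coord c q))"
    by (intro second_fundamental_form_eq_0_iff[where \<psi> = \<psi>, OF assms(1) c assms(2) d])
qed


section \<open>Warped products\<close>

lemma smooth_on_has_real_derivative:
  fixes f :: "real \<Rightarrow> real"
  assumes "smooth_on S f" "x \<in> S"
  shows "(f has_real_derivative deriv f x) (at x)" "deriv f x = \<D> f x 1"
proof -
  have "\<D> f x h = \<D> f x 1 * h" for h
    using linear_scale[OF smooth_on_linear_\<D>[OF assms], of h 1] by (simp add: mult.commute)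
  then have "\<D> f x = (*) (\<D> f x 1)" by (rule ext)
  then have d: "(f has_real_derivative \<D> f x 1) (at x)"
    using smooth_on_has_derivative[OF assms] by (simp add: has_field_derivative_def)
  show "(f has_real_derivative deriv f x) (at x)" "deriv f x = \<D> f x 1"
    using d DERIV_imp_deriv[OF d] by simp_all
qed

text \<open>
  The chart of the product that \<open>line_prod_atlas\<close> builds from a chart of the second factor.
\<close>

definition line_chart :: "('c, 'p) chart \<Rightarrow> (real \<times> 'c, real \<times> 'p) chart" where
  "line_chart c = (UNIV \<times> dom_of c, map_prod id (coord c))"

lemma line_chart_simps [simp]:
  "dom_of (line_chart c) = UNIV \<times> dom_of c" "coord (line_chart c) x = (fst x, coord c (snd x))"
  by (auto simp: line_chart_def map_prod_def split: prod.split)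

lemma line_prod_atlas_eq: "line_prod_atlas A = line_chart ` A"
  by (simp add: line_prod_atlas_def line_chart_def)

lemma line_chart_image: "coord (line_chart c) ` (UNIV \<times> S) = UNIV \<times> coord c ` S"
  by (force simp: image_iff)

lemma param_line_chart:
  assumes "smooth_atlas A" "c \<in> A" "snd z \<in> coord c ` dom_of c"
  shows "param (line_chart c) z = (fst z, param c (snd z))"
  unfolding param_def[of "line_chart c"]
proof (rule inv_into_f_eq)
  show "inj_on (coord (line_chart c)) (dom_of (line_chart c))"
  proof (rule inj_onI)
    fix x y assume xy: "x \<in> dom_of (line_chart c)" "y \<in> dom_of (line_chart c)"
      "coord (line_chart c) x = coord (line_chart c) y"
    then have "param c (coord c (snd x)) = param c (coord c (snd y))" "fst x = fst y" by simp_all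
    then show "x = y" using xy(1,2) param_coord[OF assms(1,2)] by (simp add: mem_Times_iff prod_eq_iff)
  qed
  show "(fst z, param c (snd z)) \<in> dom_of (line_chart c)"
    using coord_param[OF assms] by simp
  show "coord (line_chart c) (fst z, param c (snd z)) = z"
    using coord_param[OF assms] by simp
qed

lemma smooth_atlas_line_prod:
  fixes A :: "('c::{t2_space,second_countable_topology}, 'p::euclidean_space) chart set"
  assumes A: "smooth_atlas A"
  shows "smooth_atlas (line_prod_atlas A)"
proof -
  have 1: "(\<Union>c\<in>line_chart ` A. dom_of c) = UNIV"
    using A unfolding smooth_atlas_def by (auto simp: set_eq_iff)
  have 2: "open (dom_of c') \<and> open (coord c' ` dom_of c') \<and>
      homeomorphism (dom_of c') (coord c' ` dom_of c') (coord c') (param c')" if c': "c' \<in> line_chart ` A" for c'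
  proof -
    obtain c where c: "c \<in> A" "c' = line_chart c" using c' by blast
    note h = smooth_atlas_homeomorphism[OF A c(1)]
    have img: "coord (line_chart c) ` (UNIV \<times> dom_of c) = UNIV \<times> coord c ` dom_of c"
      by (rule line_chart_image)
    have cont: "continuous_on (UNIV \<times> dom_of c) (coord (line_chart c))"
      unfolding line_chart_def snd_conv map_prod_def case_prod_unfold id_def
      by (intro continuous_on_Pair continuous_on_fst continuous_on_id
          continuous_on_compose2[OF homeomorphism_cont1[OF h(3)] continuous_on_snd[OF continuous_on_id]]) auto
    have "continuous_on (UNIV \<times> coord c ` dom_of c) (\<lambda>z. (fst z, param c (snd z)))"
      by (intro continuous_on_Pair continuous_on_fst continuous_on_id
          continuous_on_compose2[OF homeomorphism_cont2[OF h(3)] continuous_on_snd[OF continuous_on_id]]) auto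
    then have cont': "continuous_on (UNIV \<times> coord c ` dom_of c) (param (line_chart c))"
      by (rule continuous_on_eq) (use param_line_chart[OF A c(1)] in auto)
    have "homeomorphism (UNIV \<times> dom_of c) (UNIV \<times> coord c ` dom_of c) (coord (line_chart c)) (param (line_chart c))"
      by (rule homeomorphismI[OF cont cont'])
        (use param_line_chart[OF A c(1)] param_coord[OF A c(1)] in auto)
    then show ?thesis using h(1,2) c(2) img by (simp add: open_Times)
  qed
  have 3: "smooth_on (coord c' ` (dom_of c' \<inter> dom_of d')) (coord d' \<circ> param c')"
    if cd': "c' \<in> line_chart ` A" "d' \<in> line_chart ` A" for c' d'
  proof -
    obtain c d where c: "c \<in> A" "c' = line_chart c" and d: "d \<in> A" "d' = line_chart d" using cd' by blast
    let ?S = "coord c ` (dom_of c \<inter> dom_of d)"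
    have img: "coord c' ` (dom_of c' \<inter> dom_of d') = UNIV \<times> ?S"
      using line_chart_image[of c "dom_of c \<inter> dom_of d"] c d by (simp add: Times_Int_Times)
    have S: "open ?S" by (rule open_coord_image[OF A c(1) smooth_atlas_homeomorphism(1)[OF A d(1)]])
    have "smooth_on (UNIV \<times> ?S) (\<lambda>x. (1 * fst x + 0, (coord d \<circ> param c) (snd x)) :: real \<times> 'p)"
      unfolding smooth_on_def
      by (intro allI Ck_on_Pair_fst Ck_on_snd open_Times open_UNIV S)
        (use smooth_on_transition[OF A c(1) d(1)] in \<open>simp add: smooth_on_def o_def\<close>)
    then show ?thesis
      unfolding img by (subst smooth_on_cong[OF open_Times[OF open_UNIV S]])
        (use param_line_chart[OF A c(1)] c d in auto)
  qed
  show ?thesis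
    unfolding smooth_atlas_def line_prod_atlas_eq using 1 2 3 by blast
qed

lemma smooth_atlas_line: "smooth_atlas line_atlas"
proof -
  have p: "param (UNIV :: real set, id :: real \<Rightarrow> real) = id"
    by (simp add: param_def inv_id)
  have C: "Ck_on k UNIV (\<lambda>x::real. a * x + b)" for k a b
  proof (induction k arbitrary: a b)
    case 0 show ?case by (auto intro!: continuous_intros)
  next
    case (Suc k)
    have d: "((\<lambda>x. a * x + b) has_derivative (\<lambda>v. a * v)) (at x)" for x :: real
      by (auto intro!: derivative_eq_intros)
    have "(\<lambda>x. \<D> (\<lambda>x. a * x + b) x v) = (\<lambda>x. 0 * x + a * v)" for v
      by (simp add: \<D>_eqI[OF d])
    then show ?case using d Suc unfolding Ck_on.simps differentiable_def by metis
  qed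
  have "smooth_on UNIV (id :: real \<Rightarrow> real)"
    unfolding smooth_on_def using C[of _ 1 0] by (simp add: id_def)
  then show ?thesis
    by (auto simp: smooth_atlas_def line_atlas_def p homeomorphism_def)
qed

lemma warped_metric_in_chart:
  fixes P :: "('c::{t2_space,second_countable_topology}, 'p::euclidean_space) chart set"
  assumes P: "smooth_atlas P" "c \<in> P" and z: "snd z \<in> coord c ` dom_of c"
  shows "metric_in_chart (line_prod_atlas P) (warped_metric f P g) (line_chart c) z u v =
     fst u * fst v + (f (fst z))\<^sup>2 * metric_in_chart P g c (snd z) (snd u) (snd v)"
proof -
  let ?M = "line_prod_atlas P" and ?m = "line_chart c" and ?l = "(UNIV :: real set, id :: real \<Rightarrow> real)"
  let ?q = "(fst z, param c (snd z))"
  note M = smooth_atlas_line_prod[OF P(1)]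
  note cp = coord_param[OF P z]
  have m: "?m \<in> charts_at ?M ?q" using P(2) cp by (simp add: charts_at_def line_prod_atlas_eq)
  have c: "c \<in> charts_at P (snd ?q)" using P(2) cp by (simp add: charts_at_def)
  have l: "?l \<in> charts_at line_atlas (fst ?q)" by (simp add: charts_at_def line_atlas_def)
  have mz: "coord ?m ?q = z" using cp by simp
  have op: "open (UNIV \<times> coord c ` dom_of c)"
    by (intro open_Times open_UNIV smooth_atlas_homeomorphism(2)[OF P])
  have 1: "(in_charts ?m ?l fst has_derivative fst) (at (coord ?m ?q))"
    unfolding mz
    by (rule has_derivative_transform_within_open[OF has_derivative_fst[OF has_derivative_ident] op])
      (use z param_line_chart[OF P] in \<open>auto simp: mem_Times_iff\<close>)
  have 2: "(in_charts ?m c snd has_derivative snd) (at (coord ?m ?q))"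
    unfolding mz
    by (rule has_derivative_transform_within_open[OF has_derivative_snd[OF has_derivative_ident] op])
      (use z param_line_chart[OF P] coord_param[OF P] in \<open>auto simp: mem_Times_iff\<close>)
  have dt: "differential ?M line_atlas fst ?q (coord_vector ?M ?m ?q w) ?l = fst w" for w
    using differential_coord_vector[where \<psi> = fst, OF M m smooth_atlas_line l continuous_on_fst[OF continuous_on_id] 1]
      coord_vector_self[OF smooth_atlas_line l] by simp
  have d\<pi>: "differential ?M P snd ?q (coord_vector ?M ?m ?q w) = coord_vector P c (snd ?q) (snd w)" for w
    by (rule differential_coord_vector[where \<psi> = snd, OF M m P(1) c continuous_on_snd[OF continuous_on_id] 2])
  show ?thesis
    unfolding metric_in_chart_def param_line_chart[OF P z] warped_metric_def Let_def dt d\<pi> by simp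
qed

lemma warped_metric_riemannian:
  fixes P :: "('c::{t2_space,second_countable_topology}, 'p::euclidean_space) chart set"
  assumes P: "riemannian_manifold P g" and f: "smooth_on UNIV f" "\<And>t. f t > 0"
  shows "riemannian_manifold (line_prod_atlas P) (warped_metric f P g)"
  unfolding riemannian_manifold_def
proof (intro conjI ballI allI)
  have A: "smooth_atlas P" using P by (simp add: riemannian_manifold_def)
  show "smooth_atlas (line_prod_atlas P)" by (rule smooth_atlas_line_prod[OF A])
  fix m assume "m \<in> line_prod_atlas P"
  then obtain c where c: "c \<in> P" "m = line_chart c" by (auto simp: line_prod_atlas_eq)
  let ?G = "metric_in_chart P g c"
  note G = smooth_metricD[OF smooth_metric_in_chart[OF P c(1)]]
  have img: "coord m ` dom_of m = UNIV \<times> coord c ` dom_of c"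
    using line_chart_image[of c "dom_of c"] c(2) by simp
  note eq = warped_metric_in_chart[OF A c(1), of _ f g, folded c(2)]
  {
    fix z assume "z \<in> coord m ` dom_of m"
    then have z: "snd z \<in> coord c ` dom_of c" unfolding img by auto
    note bil = G(3)[OF z]
    show "bilinear (metric_in_chart (line_prod_atlas P) (warped_metric f P g) m z)"
      unfolding bilinear_def eq[OF z]
      by (auto intro!: linearI simp: bilinear_ladd[OF bil] bilinear_lmul[OF bil] bilinear_radd[OF bil] bilinear_rmul[OF bil] algebra_simps)
    show "metric_in_chart (line_prod_atlas P) (warped_metric f P g) m z u v =
        metric_in_chart (line_prod_atlas P) (warped_metric f P g) m z v u" for u v
      unfolding eq[OF z] using G(4)[OF z] by (simp add: mult.commute)
    show "u \<noteq> 0 \<longrightarrow> 0 < metric_in_chart (line_prod_atlas P) (warped_metric f P g) m z u u" for u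
    proof
      assume u: "u \<noteq> 0"
      have pos: "v \<noteq> 0 \<Longrightarrow> 0 < ?G (snd z) v v" for v using G(2)[OF z] by (simp add: pos_def_def)
      show "0 < metric_in_chart (line_prod_atlas P) (warped_metric f P g) m z u u"
      proof (cases "snd u = 0")
        case True
        then have "fst u \<noteq> 0" using u by (simp add: prod_eq_iff)
        then have "0 < fst u * fst u" by (metis not_real_square_gt_zero)
        then show ?thesis using True by (simp add: eq[OF z] bilinear_lzero[OF bil])
      next
        case False
        have "0 < (f (fst z))\<^sup>2 * ?G (snd z) (snd u) (snd u)"
          using pos[OF False] f(2)[of "fst z"] by (intro mult_pos_pos zero_less_power) auto
        then show ?thesis unfolding eq[OF z] using zero_le_square[of "fst u"] by linarith
      qed
    qed
  }
  show "smooth_on (coord m ` dom_of m) (\<lambda>z. metric_in_chart (line_prod_atlas P) (warped_metric f P g) m z u v)" for u v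
  proof -
    have op: "open (UNIV \<times> coord c ` dom_of c)" by (intro open_Times open_UNIV G(1))
    have Cf: "Ck_on k UNIV f" for k using f(1) by (simp add: smooth_on_def)
    have CG: "Ck_on k (coord c ` dom_of c) (\<lambda>y. ?G y u v)" for k u v
      using G(5) by (simp add: smooth_on_def)
    have "smooth_on (UNIV \<times> coord c ` dom_of c)
        (\<lambda>z. fst u * fst v + (f (fst z) * f (fst z)) * ?G (snd z) (snd u) (snd v))"
      unfolding smooth_on_def
      by (intro allI Ck_on_add Ck_on_mult op Ck_on_const Ck_on_fst[OF Cf open_UNIV G(1)] Ck_on_snd[OF CG open_UNIV G(1)])
    then show ?thesis
      unfolding img by (subst smooth_on_cong[OF op]) (auto simp: eq power2_eq_square)
  qed
qed

text \<open>
  Pairing with the unit field \<open>(1, 0)\<close> extracts the first component.  The inner product of \<open>(1, 0)\<close> with a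
  field with constant coordinates is constant, so only the derivative of \<open>f\<^sup>2\<close> along the line contributes.
\<close>

lemma christoffel_warped_fst:
  fixes P :: "('c::{t2_space,second_countable_topology}, 'p::euclidean_space) chart set"
  assumes P: "riemannian_manifold P g" and f: "smooth_on UNIV f" "\<And>t. f t > 0"
    and c: "c \<in> P" and z: "snd z \<in> coord c ` dom_of c"
  shows "fst (christoffel (line_prod_atlas P) (warped_metric f P g) (line_chart c) z u v) =
    - f (fst z) * deriv f (fst z) * metric_in_chart P g c (snd z) (snd u) (snd v)"
proof -
  let ?M = "line_prod_atlas P" and ?h = "warped_metric f P g" and ?m = "line_chart c"
  let ?H = "metric_in_chart ?M ?h ?m" and ?G = "metric_in_chart P g c"
  have A: "smooth_atlas P" using P by (simp add: riemannian_manifold_def)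
  note G = smooth_metricD[OF smooth_metric_in_chart[OF P c]]
  note R = warped_metric_riemannian[OF P f]
  have m: "?m \<in> ?M" using c by (simp add: line_prod_atlas_eq)
  have img: "coord ?m ` dom_of ?m = UNIV \<times> coord c ` dom_of c"
    using line_chart_image[of c "dom_of c"] by simp
  have z': "z \<in> coord ?m ` dom_of ?m" unfolding img using z by (auto simp: mem_Times_iff)
  have op: "open (UNIV \<times> coord c ` dom_of c)" by (intro open_Times open_UNIV G(1))
  have zU: "z \<in> UNIV \<times> coord c ` dom_of c" using z' img by simp
  note eq = warped_metric_in_chart[OF A c, of _ f g]
  let ?\<Gamma> = "christoffel ?M ?h ?m z u v"
  have "fst ?\<Gamma> = ?H z ?\<Gamma> (1, 0)"
    unfolding eq[OF z] by (simp add: bilinear_rzero[OF G(3)[OF z]])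
  also have "\<dots> = koszul ?H z u v (1, 0)" by (rule christoffel_koszul[OF R m z'])
  also have "\<D> (\<lambda>y. ?H y w (1, 0)) z = \<D> (\<lambda>y. fst w) z" for w
    by (rule \<D>_cong[OF op zU]) (auto simp: eq bilinear_rzero[OF G(3)])
  then have "koszul ?H z u v (1, 0) = - \<D> (\<lambda>y. ?H y u v) z (1, 0) / 2"
    by (simp add: koszul_def)
  also have "\<D> (\<lambda>y. ?H y u v) z = \<D> (\<lambda>y. fst u * fst v + f (fst y) * f (fst y) * ?G (snd y) (snd u) (snd v)) z"
    by (rule \<D>_cong[OF op zU]) (auto simp: eq power2_eq_square)
  also have "\<dots> (1, 0) = 2 * f (fst z) * deriv f (fst z) * ?G (snd z) (snd u) (snd v)"
  proof -
    have f': "(f has_derivative (\<lambda>h. deriv f (fst z) * h)) (at (fst z))"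
      using smooth_on_has_real_derivative[OF f(1)] by (simp add: has_field_derivative_def)
    have 1: "((\<lambda>y. f (fst y)) has_derivative (\<lambda>h. deriv f (fst z) * fst h)) (at z)"
      by (rule has_derivative_compose[OF has_derivative_fst[OF has_derivative_ident] f'])
    have dG: "((\<lambda>y. ?G y (snd u) (snd v)) has_derivative \<D> (\<lambda>y. ?G y (snd u) (snd v)) (snd z)) (at (snd z))"
      by (rule smooth_on_has_derivative[OF G(5) z])
    have 2: "((\<lambda>y. ?G (snd y) (snd u) (snd v)) has_derivative (\<lambda>h. \<D> (\<lambda>y. ?G y (snd u) (snd v)) (snd z) (snd h))) (at z)"
      by (rule has_derivative_compose[OF has_derivative_snd[OF has_derivative_ident] dG])
    have "\<D> (\<lambda>y. ?G y (snd u) (snd v)) (snd z) 0 = 0"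
      by (rule linear_0[OF smooth_on_linear_\<D>[OF G(5) z]])
    then show ?thesis
      by (subst \<D>_eqI[OF has_derivative_add[OF has_derivative_const has_derivative_mult[OF has_derivative_mult[OF 1 1] 2]]]) simp
  qed
  finally show ?thesis by simp
qed


section \<open>The Gauss formula\<close>

lemma isometric_in_charts:
  assumes M: "riemannian_manifold M g" "m \<in> M" and B: "riemannian_manifold B h" "d \<in> B"
    and \<phi>: "isometric_immersion M g B h \<phi>" and y: "y \<in> chart_dom m d \<phi>"
  shows "metric_in_chart M g m y u v =
    metric_in_chart B h d (in_charts m d \<phi> y) (\<D> (in_charts m d \<phi>) y u) (\<D> (in_charts m d \<phi>) y v)"
proof -
  obtain x where x: "x \<in> dom_of m" "\<phi> x \<in> dom_of d" "y = coord m x" using y by blast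
  note AM = riemannian_manifoldD(1)[OF M] and AB = riemannian_manifoldD(1)[OF B]
  have m: "m \<in> charts_at M x" and d: "d \<in> charts_at B (\<phi> x)" using x M(2) B(2) by (auto simp: charts_at_def)
  have sm: "smooth_map M B \<phi>" using \<phi> by (simp add: isometric_immersion_def immersion_def)
  have Fy: "in_charts m d \<phi> y = coord d (\<phi> x)" using x param_coord[OF AM M(2)] by simp
  show ?thesis
    unfolding Fy metric_in_chart_coord[OF AB d] unfolding x(3) metric_in_chart_coord[OF AM m]
      differential_smooth_map[where \<psi> = \<phi>, OF AM m AB d sm, symmetric]
    using \<phi> coord_vector_tangent[OF AM m] unfolding isometric_immersion_def by simp
qed

text \<open>
  The setting of the Gauss formula: immersions \<open>\<alpha>\<close> of \<open>\<Sigma>\<close> into \<open>M\<close> and \<open>\<phi>\<close> of \<open>M\<close> into \<open>B\<close>, with the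
  metric of \<open>M\<close> induced from \<open>B\<close>.
\<close>

locale isometric_chain =
  fixes M :: "('m::{t2_space,second_countable_topology}, 'k::euclidean_space) chart set"
    and g :: "('m, 'k) metric"
    and B :: "('b::{t2_space,second_countable_topology}, 'f::euclidean_space) chart set"
    and h :: "('b, 'f) metric"
    and \<phi> :: "'m \<Rightarrow> 'b"
    and \<Sigma> :: "('s::{t2_space,second_countable_topology}, 'j::euclidean_space) chart set"
    and \<alpha> :: "'s \<Rightarrow> 'm"
  assumes M: "riemannian_manifold M g" and B: "riemannian_manifold B h"
    and iso: "isometric_immersion M g B h \<phi>"
    and \<Sigma>: "smooth_atlas \<Sigma>" and \<alpha>: "immersion \<Sigma> M \<alpha>" and \<phi>\<alpha>: "immersion \<Sigma> B (\<phi> \<circ> \<alpha>)"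
begin

lemma atlas_M: "smooth_atlas M" and atlas_B: "smooth_atlas B"
  using M B by (auto simp: riemannian_manifold_def)

lemma smooth_maps: "smooth_map M B \<phi>" "smooth_map \<Sigma> M \<alpha>" "smooth_map \<Sigma> B (\<phi> \<circ> \<alpha>)"
  using iso \<alpha> \<phi>\<alpha> by (auto simp: isometric_immersion_def immersion_def)

context
  fixes s c m d
  assumes c: "c \<in> charts_at \<Sigma> s" and m: "m \<in> charts_at M (\<alpha> s)" and d: "d \<in> charts_at B (\<phi> (\<alpha> s))"
begin

lemma composite_in_charts:
  shows "\<D> (in_charts c d (\<phi> \<circ> \<alpha>)) (coord c s) v =
      \<D> (in_charts m d \<phi>) (coord m (\<alpha> s)) (\<D> (in_charts c m \<alpha>) (coord c s) v)" (is ?first)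
    and "\<D>\<^sub>2 (in_charts c d (\<phi> \<circ> \<alpha>)) (coord c s) u v =
      \<D>\<^sub>2 (in_charts m d \<phi>) (coord m (\<alpha> s)) (\<D> (in_charts c m \<alpha>) (coord c s) u) (\<D> (in_charts c m \<alpha>) (coord c s) v)
      + \<D> (in_charts m d \<phi>) (coord m (\<alpha> s)) (\<D>\<^sub>2 (in_charts c m \<alpha>) (coord c s) u v)" (is ?second)
proof -
  note c' = charts_atD[OF c] and m' = charts_atD[OF m] and d' = charts_atD[OF d]
  let ?U = "coord c ` (dom_of c \<inter> \<alpha> -` (dom_of m \<inter> \<phi> -` dom_of d))"
  let ?a = "in_charts c m \<alpha>" and ?F = "in_charts m d \<phi>" and ?G = "in_charts c d (\<phi> \<circ> \<alpha>)"
  note s\<phi> = smooth_mapD[OF smooth_maps(1) m'(1) d'(1)] and s\<alpha> = smooth_mapD[OF smooth_maps(2) c'(1) m'(1)]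
  have U: "open ?U"
    by (intro open_coord_image[OF \<Sigma> c'(1)] open_vimage s\<phi>(1) s\<alpha>(1) open_Int
        smooth_atlas_homeomorphism(1)[OF atlas_M m'(1)] smooth_atlas_homeomorphism(1)[OF atlas_B d'(1)])
  have T: "open (chart_dom m d \<phi>)" by (rule open_chart_dom[OF atlas_M m'(1) atlas_B d'(1) s\<phi>(1)])
  have z: "coord c s \<in> ?U" using c'(2) m'(2) d'(2) by auto
  have a: "smooth_on ?U ?a" by (rule smooth_on_subset[OF s\<alpha>(2)]) auto
  have aU: "?a ` ?U \<subseteq> chart_dom m d \<phi>" using param_coord[OF \<Sigma> c'(1)] by auto
  have az: "?a (coord c s) = coord m (\<alpha> s)" using param_coord[OF \<Sigma> c'] by simp
  have eq: "?G y = (?F \<circ> ?a) y" if "y \<in> ?U" for y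
    using that param_coord[OF \<Sigma> c'(1)] param_coord[OF atlas_M m'(1)] by auto
  have azT: "?a (coord c s) \<in> chart_dom m d \<phi>" using aU z by blast
  have "\<D> ?G (coord c s) = \<D> (?F \<circ> ?a) (coord c s)"
    by (rule \<D>_cong[OF U z]) (rule eq)
  then show ?first by (simp only: \<D>_compose[OF s\<phi>(2) a z azT] az)
  have "\<D>\<^sub>2 ?G (coord c s) u v = \<D>\<^sub>2 (?F \<circ> ?a) (coord c s) u v"
    by (rule \<D>\<^sub>2_cong[OF U z]) (rule eq)
  then show ?second by (simp only: \<D>\<^sub>2_compose[OF T s\<phi>(2) U a z aU] az)
qed

text \<open>
  By the chain rule the acceleration in \<open>B\<close> is the image of the one in \<open>M\<close> plus the second derivative
  of \<open>\<phi>\<close> and a change of Christoffel symbols; against vectors tangent to \<open>M\<close> these last two cancel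
  by \<open>koszul_pullback\<close>.
\<close>

lemma gauss_formula:
  "metric_in_chart M g m (coord m (\<alpha> s)) (ambient_derivative M g \<alpha> c m s u v) w =
   metric_in_chart B h d (coord d (\<phi> (\<alpha> s))) (ambient_derivative B h (\<phi> \<circ> \<alpha>) c d s u v)
     (\<D> (in_charts m d \<phi>) (coord m (\<alpha> s)) w)"
proof -
  note c' = charts_atD[OF c] and m' = charts_atD[OF m] and d' = charts_atD[OF d]
  let ?a = "in_charts c m \<alpha>" and ?F = "in_charts m d \<phi>" and ?G = "in_charts c d (\<phi> \<circ> \<alpha>)"
  let ?z = "coord c s" and ?x = "coord m (\<alpha> s)" and ?p = "coord d (\<phi> (\<alpha> s))"
  let ?H = "metric_in_chart B h d" and ?GM = "metric_in_chart M g m"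
  note s\<phi> = smooth_mapD[OF smooth_maps(1) m'(1) d'(1)]
  have T: "open (chart_dom m d \<phi>)" by (rule open_chart_dom[OF atlas_M m'(1) atlas_B d'(1) s\<phi>(1)])
  have x: "?x \<in> chart_dom m d \<phi>" using m'(2) d'(2) by auto
  have FT: "?F ` chart_dom m d \<phi> \<subseteq> coord d ` dom_of d"
    using param_coord[OF atlas_M m'(1)] by auto
  have Fx: "?F ?x = ?p" and az: "?a ?z = ?x" and Gz: "?G ?z = ?p"
    using param_coord[OF atlas_M m'] param_coord[OF \<Sigma> c'] by auto
  have xM: "?x \<in> coord m ` dom_of m" and pB: "?p \<in> coord d ` dom_of d" using m'(2) d'(2) by auto
  have bM: "bilinear (?GM ?x)" using smooth_metricD(3)[OF smooth_metric_in_chart[OF M m'(1)] xM] .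
  have bH: "bilinear (?H ?p)" using smooth_metricD(3)[OF smooth_metric_in_chart[OF B d'(1)] pB] .
  note iso' = isometric_in_charts[OF M m'(1) B d'(1) iso]
  let ?X = "\<D> ?a ?z u" and ?Y = "\<D> ?a ?z v"
  have "?GM ?x (ambient_derivative M g \<alpha> c m s u v) w = ?GM ?x (\<D>\<^sub>2 ?a ?z u v) w + koszul ?GM ?x ?X ?Y w"
    unfolding ambient_derivative_def Let_def az
    by (simp add: bilinear_ladd[OF bM] christoffel_koszul[OF M m'(1) xM])
  also have "koszul ?GM ?x ?X ?Y w = ?H ?p (\<D>\<^sub>2 ?F ?x ?X ?Y) (\<D> ?F ?x w)
      + koszul ?H ?p (\<D> ?F ?x ?X) (\<D> ?F ?x ?Y) (\<D> ?F ?x w)"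
    using koszul_pullback[OF T s\<phi>(2) FT smooth_metric_in_chart[OF B d'(1)] iso' x, of ?X ?Y w] unfolding Fx .
  also have "?GM ?x (\<D>\<^sub>2 ?a ?z u v) w = ?H ?p (\<D> ?F ?x (\<D>\<^sub>2 ?a ?z u v)) (\<D> ?F ?x w)"
    using iso'[OF x, of "\<D>\<^sub>2 ?a ?z u v" w] unfolding Fx .
  also have "?H ?p (\<D> ?F ?x (\<D>\<^sub>2 ?a ?z u v)) (\<D> ?F ?x w) + (?H ?p (\<D>\<^sub>2 ?F ?x ?X ?Y) (\<D> ?F ?x w)
      + koszul ?H ?p (\<D> ?F ?x ?X) (\<D> ?F ?x ?Y) (\<D> ?F ?x w))
     = ?H ?p (\<D>\<^sub>2 ?G ?z u v) (\<D> ?F ?x w) + koszul ?H ?p (\<D> ?G ?z u) (\<D> ?G ?z v) (\<D> ?F ?x w)"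
    unfolding composite_in_charts bilinear_ladd[OF bH] by simp
  also have "\<dots> = ?H ?p (ambient_derivative B h (\<phi> \<circ> \<alpha>) c d s u v) (\<D> ?F ?x w)"
    unfolding ambient_derivative_def Let_def Gz
    by (simp add: bilinear_ladd[OF bH] christoffel_koszul[OF B d'(1) pB])
  finally show ?thesis .
qed

end

end


section \<open>The intersection is totally geodesic\<close>

text \<open>
  If vectors \<open>V j\<close> tangent to the image of \<open>a\<close> converge, then so do their coefficients with respect to
  \<open>\<D> a\<close>, because the Gram form of \<open>\<D> a\<close> is positive definite in the limit.  The limit \<open>V0\<close> is not assumed
  tangent; \<open>k0\<close> are the coefficients of its orthogonal projection.
\<close>

lemma tangential_coefficients_tendsto:
  fixes a :: "'e::euclidean_space \<Rightarrow> 'f::euclidean_space"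
  assumes G: "smooth_metric S G" and a: "open U" "smooth_on U a" "a ` U \<subseteq> S"
    and z: "z \<in> U" "inj (\<D> a z)" and p: "(p \<longlongrightarrow> z) F" and V: "(V \<longlongrightarrow> V0) F"
    and k: "\<forall>\<^sub>F j in F. V j = \<D> a (p j) (k j)"
    and k0: "\<And>w. G (a z) (\<D> a z k0) (\<D> a z w) = G (a z) V0 (\<D> a z w)"
  shows "(k \<longlongrightarrow> k0) F"
proof (rule pos_def_solution_tendsto[where B = "\<lambda>j u v. G (a (p j)) (\<D> a (p j) u) (\<D> a (p j) v)"
      and ?B0.0 = "\<lambda>u v. G (a z) (\<D> a z u) (\<D> a z v)" and L = "\<lambda>j w. G (a (p j)) (V j) (\<D> a (p j) w)"
      and ?L0.0 = "\<lambda>w. G (a z) V0 (\<D> a z w)"])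
  note G' = smooth_metricD[OF G]
  have ev: "\<forall>\<^sub>F j in F. p j \<in> U" by (rule topological_tendstoD[OF p a(1) z(1)])
  have az: "a z \<in> S" using a(3) z(1) by auto
  have lim: "((\<lambda>j. a (p j)) \<longlongrightarrow> a z) F" by (rule smooth_on_tendsto[OF a(2,1) p z(1)])
  have lim': "((\<lambda>j. \<D> a (p j) v) \<longlongrightarrow> \<D> a z v) F" for v
    by (rule smooth_on_tendsto_\<D>[OF a(2,1) p z(1) tendsto_const])
  show "\<forall>\<^sub>F j in F. bilinear (\<lambda>u v. G (a (p j)) (\<D> a (p j) u) (\<D> a (p j) v))"
    using ev
  proof eventually_elim
    case (elim j)
    have l: "linear (\<D> a (p j))" by (rule smooth_on_linear_\<D>[OF a(2) elim])
    have b: "bilinear (G (a (p j)))" by (rule G'(3)) (use a(3) elim in auto)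
    show ?case
      unfolding bilinear_def
      by (auto intro!: linearI simp: linear_add[OF l] linear_scale[OF l] bilinear_ladd[OF b]
          bilinear_radd[OF b] bilinear_lmul[OF b] bilinear_rmul[OF b])
  qed
  show "pos_def (\<lambda>u v. G (a z) (\<D> a z u) (\<D> a z v))"
    by (rule pos_def_pullback[OF G'(2)[OF az] smooth_on_linear_\<D>[OF a(2) z(1)] z(2)])
  show "((\<lambda>j. G (a (p j)) (\<D> a (p j) u) (\<D> a (p j) v)) \<longlongrightarrow> G (a z) (\<D> a z u) (\<D> a z v)) F" for u v
    by (rule tendsto_metric[OF G az lim lim' lim'])
  show "((\<lambda>j. G (a (p j)) (V j) (\<D> a (p j) w)) \<longlongrightarrow> G (a z) V0 (\<D> a z w)) F" for w
    by (rule tendsto_metric[OF G az lim V lim'])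
  show "\<forall>\<^sub>F j in F. \<forall>w. G (a (p j)) (\<D> a (p j) (k j)) (\<D> a (p j) w) = G (a (p j)) (V j) (\<D> a (p j) w)"
    using k by eventually_elim simp
qed (rule k0)

text \<open>
  Tangency is a closed condition: the coefficients converge to those of the projection of \<open>V0\<close>,
  so \<open>V0\<close> equals its projection.
\<close>

lemma tangential_closed:
  fixes a :: "'e::euclidean_space \<Rightarrow> 'f::euclidean_space"
  assumes G: "smooth_metric S G" and a: "open U" "smooth_on U a" "a ` U \<subseteq> S"
    and z: "z \<in> U" "inj (\<D> a z)" and p: "(p \<longlongrightarrow> z) F" "F \<noteq> bot" and V: "(V \<longlongrightarrow> V0) F"
    and k: "\<forall>\<^sub>F j in F. V j \<in> range (\<D> a (p j))"
  shows "V0 \<in> range (\<D> a z)"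
proof -
  note G' = smooth_metricD[OF G]
  have az: "a z \<in> S" using a(3) z(1) by auto
  have l: "linear (\<D> a z)" by (rule smooth_on_linear_\<D>[OF a(2) z(1)])
  define k where "k j = (SOME k. V j = \<D> a (p j) k)" for j
  have k: "\<forall>\<^sub>F j in F. V j = \<D> a (p j) (k j)"
    using assms(10) by eventually_elim (auto simp: k_def intro: someI)
  obtain k0 where k0: "\<forall>w. G (a z) (V0 - \<D> a z k0) (\<D> a z w) = 0"
    using orthogonal_decomposition[OF G'(2)[OF az] l z(2)] by blast
  have "(k \<longlongrightarrow> k0) F"
    by (rule tangential_coefficients_tendsto[OF G a z p(1) V k])
      (use k0 in \<open>simp add: bilinear_lsub[OF G'(3)[OF az]]\<close>)
  then have "((\<lambda>j. \<D> a (p j) (k j)) \<longlongrightarrow> \<D> a z k0) F"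
    by (rule smooth_on_tendsto_\<D>[OF a(2,1) p(1) z(1)])
  then have "(V \<longlongrightarrow> \<D> a z k0) F"
    by (rule Lim_transform_eventually) (use k in eventually_elim, simp)
  then have "V0 = \<D> a z k0" using tendsto_unique[OF p(2) V] by blast
  then show ?thesis by blast
qed

lemma uncountable_accumulates_at_0:
  assumes "open T" "0 \<in> T" "countable X"
  shows "\<exists>t. (\<forall>k::nat. t k \<in> T - X) \<and> t \<longlonglongrightarrow> (0::real)"
proof -
  have "\<exists>t. t \<in> T - X \<and> \<bar>t\<bar> < 1 / Suc k" for k :: nat
  proof -
    have "open (T \<inter> ball 0 (1 / Suc k))" "0 \<in> T \<inter> ball 0 (1 / Suc k)" using assms by auto
    then obtain e where e: "0 < e" "ball 0 e \<subseteq> T \<inter> ball 0 (1 / Suc k)" by (meson openE)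
    have "uncountable {0<..<e}" using e(1) by (simp add: uncountable_open_interval)
    then have "\<not> {0<..<e} \<subseteq> X" using assms(3) countable_subset by blast
    then obtain t where t: "t \<in> {0<..<e}" "t \<notin> X" by blast
    then have "t \<in> ball 0 e" by simp
    then show ?thesis using e(2) t(2) by (intro exI[of _ t]) auto
  qed
  then obtain t where t: "\<And>k. t k \<in> T - X \<and> \<bar>t k\<bar> < 1 / Suc k" by metis
  have "t \<longlonglongrightarrow> 0"
    by (rule Lim_null_comparison[OF _ LIMSEQ_inverse_real_of_nat])
      (use t in \<open>auto intro!: always_eventually simp: inverse_eq_divide less_imp_le\<close>)
  then show ?thesis using t by blast
qed

locale normal_intersection = isometric_chain M g B h \<phi> \<Sigma> \<alpha>
  for M :: "('m::{t2_space,second_countable_topology}, 'k::euclidean_space) chart set"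
    and g :: "('m, 'k) metric"
    and B :: "('b::{t2_space,second_countable_topology}, 'f::euclidean_space) chart set"
    and h :: "('b, 'f) metric"
    and \<phi> :: "'m \<Rightarrow> 'b"
    and \<Sigma> :: "('s::{t2_space,second_countable_topology}, 'j::euclidean_space) chart set"
    and \<alpha> :: "'s \<Rightarrow> 'm" +
  fixes N :: "('n::{t2_space,second_countable_topology}, 'l::euclidean_space) chart set"
    and \<psi> :: "'n \<Rightarrow> 'b"
  assumes N: "smooth_atlas N" and geodesic: "totally_geodesic N B h \<psi>"
    and normal: "normal_submanifolds B h M \<phi> N \<psi> \<Sigma> \<alpha>"
begin

lemma immersion_\<psi>: "immersion N B \<psi>" and smooth_\<psi>: "smooth_map N B \<psi>"
  using geodesic by (auto simp: totally_geodesic_def immersion_def)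

text \<open>
  The normality condition in coordinates: the image of a vector \<open>\<eta>\<close> that is orthogonal to \<open>\<Sigma>\<close> in \<open>M\<close> is
  orthogonal to every sheet of \<open>N\<close> through the point.
\<close>

lemma normal_to_sheet:
  assumes c: "c \<in> charts_at \<Sigma> s" and m: "m \<in> charts_at M (\<alpha> s)" and d: "d \<in> charts_at B (\<phi> (\<alpha> s))"
    and r: "\<phi> (\<alpha> s) = \<psi> r" and e: "e \<in> charts_at N r"
    and \<eta>: "\<And>v. metric_in_chart M g m (coord m (\<alpha> s)) \<eta> (\<D> (in_charts c m \<alpha>) (coord c s) v) = 0"
  shows "metric_in_chart B h d (coord d (\<phi> (\<alpha> s))) (\<D> (in_charts m d \<phi>) (coord m (\<alpha> s)) \<eta>)
     (\<D> (in_charts e d \<psi>) (coord e r) w) = 0"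
proof -
  note c' = charts_atD[OF c] and m' = charts_atD[OF m] and d' = charts_atD[OF d]
  let ?F\<eta> = "\<D> (in_charts m d \<phi>) (coord m (\<alpha> s)) \<eta>"
  let ?x = "coord_vector B d (\<phi> (\<alpha> s)) ?F\<eta>"
  have d2: "d \<in> charts_at B (\<psi> r)" using d r by simp
  have d3: "d \<in> charts_at B ((\<phi> \<circ> \<alpha>) s)" using d by simp
  have TM: "?x \<in> immersed_tangent_space M B \<phi> (\<alpha> s)"
    unfolding immersed_tangent_space_eq[where \<psi> = \<phi>, OF atlas_M m atlas_B d smooth_maps(1)] by blast
  have x: "coord m (\<alpha> s) \<in> chart_dom m d \<phi>" using m'(2) d'(2) by auto
  have "metric_in_chart B h d (coord d (\<phi> (\<alpha> s))) ?F\<eta> (\<D> (in_charts c d (\<phi> \<circ> \<alpha>)) (coord c s) u) = 0" for u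
    unfolding composite_in_charts[OF c m d]
    using isometric_in_charts[OF M m'(1) B d'(1) iso x, of \<eta> "\<D> (in_charts c m \<alpha>) (coord c s) u"]
      \<eta>[of u] param_coord[OF atlas_M m'] by simp
  then have "?x \<in> orth_complement B h (\<psi> r) (immersed_tangent_space \<Sigma> B (\<phi> \<circ> \<alpha>) s)"
    unfolding immersed_tangent_space_eq[where \<psi> = "\<phi> \<circ> \<alpha>", OF \<Sigma> c atlas_B d3 smooth_maps(3)]
    using orth_complement_coord[OF atlas_B d2, of ?F\<eta> h] by (auto simp: r)
  then have "?x \<in> orth_complement B h (\<psi> r) (immersed_tangent_space N B \<psi> r)"
    using normal r TM unfolding normal_submanifolds_def by blast
  then show ?thesis
    unfolding immersed_tangent_space_eq[where \<psi> = \<psi>, OF N e atlas_B d2 smooth_\<psi>]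
    using orth_complement_coord[OF atlas_B d2, of ?F\<eta> h] by (auto simp: r)
qed

text \<open>
  Let \<open>\<eta>\<close> be the component of the acceleration \<open>D\<close> normal to \<open>\<Sigma>\<close> in \<open>M\<close>.  By the Gauss formula
  the inner product of \<open>D\<close> and \<open>\<eta>\<close> can be computed in the ambient manifold, where \<open>touching_second_order\<close>
  replaces the curve in \<open>\<Sigma>\<close> by a direction \<open>w\<close> in \<open>N\<close>.  There the acceleration is tangent to \<open>N\<close> and
  \<open>\<eta>\<close> is normal to \<open>N\<close>.
\<close>

lemma tangential_at_accumulation:
  assumes c: "c \<in> charts_at \<Sigma> s" and m: "m \<in> charts_at M (\<alpha> s)"
    and \<delta>: "\<delta> \<longlonglongrightarrow> 0" "\<And>k::nat. \<delta> k \<noteq> 0" and r: "r \<longlonglongrightarrow> r0" "\<phi> (\<alpha> s) = \<psi> r0"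
    and eq: "\<And>k. \<phi> (\<alpha> (param c (coord c s + \<delta> k *\<^sub>R u))) = \<psi> (r k)"
  shows "ambient_derivative M g \<alpha> c m s u u \<in> range (\<D> (in_charts c m \<alpha>) (coord c s))"
proof -
  note c' = charts_atD[OF c] and m' = charts_atD[OF m]
  obtain d where d: "d \<in> charts_at B (\<phi> (\<alpha> s))" using charts_at_nonempty[OF atlas_B] by blast
  obtain e where e: "e \<in> charts_at N r0" using charts_at_nonempty[OF N] by blast
  note d' = charts_atD[OF d] and e' = charts_atD[OF e]
  have d2: "d \<in> charts_at B (\<psi> r0)" using d r(2) by simp
  let ?a = "in_charts c m \<alpha>" and ?F = "in_charts m d \<phi>" and ?G = "in_charts c d (\<phi> \<circ> \<alpha>)" and ?K = "in_charts e d \<psi>"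
  let ?z = "coord c s" and ?x = "coord m (\<alpha> s)" and ?p = "coord d (\<phi> (\<alpha> s))" and ?y = "coord e r0"
  let ?H = "metric_in_chart B h d ?p" and ?GM = "metric_in_chart M g m ?x"
  let ?D = "ambient_derivative M g \<alpha> c m s u u"
  have xM: "?x \<in> coord m ` dom_of m" and pB: "?p \<in> coord d ` dom_of d" using m'(2) d'(2) by auto
  note GM = smooth_metricD(2)[OF smooth_metric_in_chart[OF M m'(1)] xM]
  have bM: "bilinear ?GM" using GM by (simp add: pos_def_def)
  have bH: "bilinear ?H" using smooth_metricD(3)[OF smooth_metric_in_chart[OF B d'(1)] pB] .
  have symH: "?H x y = ?H y x" for x y using smooth_metricD(4)[OF smooth_metric_in_chart[OF B d'(1)] pB] .
  have symM: "?GM x y = ?GM y x" for x y using smooth_metricD(4)[OF smooth_metric_in_chart[OF M m'(1)] xM] .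
  have la: "linear (\<D> ?a ?z)"
    by (rule smooth_on_linear_\<D>[OF smooth_mapD(2)[OF smooth_maps(2) c'(1) m'(1)]]) (use c' m' in auto)
  obtain k where k: "\<forall>v. ?GM (?D - \<D> ?a ?z k) (\<D> ?a ?z v) = 0"
    using orthogonal_decomposition[OF GM la immersion_inj[where \<psi> = \<alpha>, OF \<Sigma> c atlas_M m \<alpha>]] by blast
  \<comment> \<open>It suffices to show that \<open>\<eta>\<close> is orthogonal to \<open>?D\<close>, as it is orthogonal to the other summand.\<close>
  define \<eta> where "\<eta> = ?D - \<D> ?a ?z k"
  define l where "l x = ?H x (\<D> ?F ?x \<eta>)" for x
  have l: "linear l" using bH unfolding l_def bilinear_def by blast
  have lK: "l (\<D> ?K ?y w) = 0" for w
    unfolding l_def symH[of "\<D> ?K ?y w"]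
    by (rule normal_to_sheet[OF c m d r(2) e]) (use k in \<open>simp add: \<eta>_def\<close>)
  have "\<forall>\<^sub>F k in sequentially. r k \<in> dom_of e"
    by (rule topological_tendstoD[OF r(1) smooth_atlas_homeomorphism(1)[OF N e'(1)] e'(2)])
  \<comment> \<open>Only from the index \<open>n0\<close> on do the points \<open>r k\<close> lie in the domain of the chart \<open>e\<close>.\<close>
  then obtain n0 where n0: "\<And>k. n0 \<le> k \<Longrightarrow> r k \<in> dom_of e" unfolding eventually_sequentially by blast
  have "(\<lambda>k. coord e (r (k + n0))) \<longlonglongrightarrow> ?y"
    by (rule continuous_on_tendsto_compose[OF homeomorphism_cont1[OF smooth_atlas_homeomorphism(3)[OF N e'(1)]]
          LIMSEQ_ignore_initial_segment[OF r(1)] e'(2)]) (use n0 in auto)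
  moreover have "?G (?z + \<delta> (k + n0) *\<^sub>R u) = ?K (coord e (r (k + n0)))" for k
    using eq[of "k + n0"] param_coord[OF N e'(1) n0[of "k + n0"]] by simp
  moreover have "?G ?z = ?K ?y" using r(2) param_coord[OF N e'] param_coord[OF \<Sigma> c'] by simp
  moreover have "open (chart_dom c d (\<phi> \<circ> \<alpha>))" "smooth_on (chart_dom c d (\<phi> \<circ> \<alpha>)) ?G"
    using smooth_mapD[OF smooth_maps(3) c'(1) d'(1)] open_chart_dom[OF \<Sigma> c'(1) atlas_B d'(1)] by auto
  moreover have "?z \<in> chart_dom c d (\<phi> \<circ> \<alpha>)" using c'(2) d'(2) by auto
  moreover have "open (chart_dom e d \<psi>)" "smooth_on (chart_dom e d \<psi>) ?K"
    using smooth_mapD[OF smooth_\<psi> e'(1) d'(1)] open_chart_dom[OF N e'(1) atlas_B d'(1)] by auto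
  moreover have "?y \<in> chart_dom e d \<psi>" using e'(2) charts_atD[OF d2] by auto
  ultimately obtain w where w: "\<D> ?K ?y w = \<D> ?G ?z u" "l (\<D>\<^sub>2 ?K ?y w w) = l (\<D>\<^sub>2 ?G ?z u u)"
    using touching_second_order[of "chart_dom c d (\<phi> \<circ> \<alpha>)" ?G ?z "chart_dom e d \<psi>" ?K ?y l "\<lambda>k. \<delta> (k + n0)" "\<lambda>k. coord e (r (k + n0))" u]
      immersion_inj[where \<psi> = \<psi>, OF N e atlas_B d2 immersion_\<psi>] l lK LIMSEQ_ignore_initial_segment[OF \<delta>(1)] \<delta>(2)
    by metis
  obtain q where q: "ambient_derivative B h \<psi> e d r0 w w = \<D> ?K ?y q"
    using geodesic e d2 unfolding totally_geodesic_iff[where \<psi> = \<psi>, OF N B] by blast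
  have pts: "?G ?z = ?p" "?K ?y = ?p" using r(2) param_coord[OF N e'] param_coord[OF \<Sigma> c'] by simp_all
  have "?GM ?D \<eta> = l (ambient_derivative B h (\<phi> \<circ> \<alpha>) c d s u u)"
    unfolding l_def by (rule gauss_formula[OF c m d])
  also have "\<dots> = l (ambient_derivative B h \<psi> e d r0 w w)"
    unfolding ambient_derivative_def Let_def pts by (simp add: linear_add[OF l] w)
  also have "\<dots> = 0" unfolding q by (rule lK)
  finally have "?GM ?D \<eta> = 0" .
  moreover have "?GM (\<D> ?a ?z k) \<eta> = 0" using k symM[of "\<D> ?a ?z k" \<eta>] by (simp add: \<eta>_def)
  ultimately have "?GM \<eta> \<eta> = 0" by (subst (1) \<eta>_def) (simp add: bilinear_lsub[OF bM])
  then have "\<eta> = 0" using GM unfolding pos_def_def by (metis less_irrefl)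
  then show ?thesis by (simp add: \<eta>_def)
qed

text \<open>
  On the coordinate line through \<open>s\<close> in the direction \<open>u\<close>, preimages in \<open>N\<close> are chosen
  arbitrarily.  The previous lemma applies outside a countable set of parameters, and these parameters
  accumulate at \<open>0\<close>.
\<close>

lemma tangential_diagonal:
  assumes c: "c \<in> charts_at \<Sigma> s" and m: "m \<in> charts_at M (\<alpha> s)"
  shows "ambient_derivative M g \<alpha> c m s u u \<in> range (\<D> (in_charts c m \<alpha>) (coord c s))"
proof -
  note c' = charts_atD[OF c] and m' = charts_atD[OF m]
  let ?a = "in_charts c m \<alpha>" and ?z = "coord c s" and ?U = "chart_dom c m \<alpha>"
  let ?G = "metric_in_chart M g m"
  note s\<alpha> = smooth_mapD[OF smooth_maps(2) c'(1) m'(1)]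
  have U: "open ?U" by (rule open_chart_dom[OF \<Sigma> c'(1) atlas_M m'(1) s\<alpha>(1)])
  have zU: "?z \<in> ?U" using c' m' by auto
  define T where "T = (\<lambda>t. ?z + t *\<^sub>R u) -` ?U"
  have T: "open T" unfolding T_def by (rule open_vimage[OF U]) (intro continuous_intros)
  have T0: "0 \<in> T" using zU by (simp add: T_def)
  define \<sigma> where "\<sigma> t = param c (?z + t *\<^sub>R u)" for t
  have "\<exists>r. \<phi> (\<alpha> x) = \<psi> r" for x using normal unfolding normal_submanifolds_def by blast
  \<comment> \<open>An arbitrary choice of preimages; it need not be continuous.\<close>
  then obtain R where R: "\<And>x. \<phi> (\<alpha> x) = \<psi> (R x)" by metis
  have charts: "c \<in> charts_at \<Sigma> (\<sigma> t)" "m \<in> charts_at M (\<alpha> (\<sigma> t))" "coord c (\<sigma> t) = ?z + t *\<^sub>R u" if "t \<in> T" for t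
  proof -
    have U': "?z + t *\<^sub>R u \<in> coord c ` dom_of c" "param c (?z + t *\<^sub>R u) \<in> \<alpha> -` dom_of m"
      using that coord_image_mem[OF \<Sigma> c'(1)] unfolding T_def by blast+
    then show "c \<in> charts_at \<Sigma> (\<sigma> t)" "m \<in> charts_at M (\<alpha> (\<sigma> t))" "coord c (\<sigma> t) = ?z + t *\<^sub>R u"
      using coord_param[OF \<Sigma> c'(1) U'(1)] c'(1) m'(1) by (auto simp: charts_at_def \<sigma>_def)
  qed
  \<comment> \<open>The parameters over which the graph of the chosen preimages has an isolated point.\<close>
  define X where "X = {t \<in> T. \<not> (\<exists>s. (\<forall>k::nat. s k \<in> T \<and> s k \<noteq> t) \<and> s \<longlonglongrightarrow> t \<and>
      (\<lambda>k. R (\<sigma> (s k))) \<longlonglongrightarrow> R (\<sigma> t))}"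
  have "countable X" unfolding X_def by (rule countable_isolated_graph)
  from uncountable_accumulates_at_0[OF T T0 this] obtain t where t: "\<And>k. t k \<in> T - X" "t \<longlonglongrightarrow> 0" by blast
  have good: "ambient_derivative M g \<alpha> c m (\<sigma> (t j)) u u \<in> range (\<D> ?a (?z + t j *\<^sub>R u))" for j
  proof -
    have tj: "t j \<in> T" using t by blast
    obtain s' where s': "\<And>k. s' k \<in> T \<and> s' k \<noteq> t j" "s' \<longlonglongrightarrow> t j" "(\<lambda>k. R (\<sigma> (s' k))) \<longlonglongrightarrow> R (\<sigma> (t j))"
      using t(1)[of j] unfolding X_def by blast
    have "ambient_derivative M g \<alpha> c m (\<sigma> (t j)) u u \<in> range (\<D> ?a (coord c (\<sigma> (t j))))"
    proof (rule tangential_at_accumulation[OF charts(1,2)[OF tj], where \<delta> = "\<lambda>k. s' k - t j" and r = "\<lambda>k. R (\<sigma> (s' k))"])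
      show "(\<lambda>k. s' k - t j) \<longlonglongrightarrow> 0" using s'(2) by (simp add: LIM_zero)
      show "\<phi> (\<alpha> (param c (coord c (\<sigma> (t j)) + (s' k - t j) *\<^sub>R u))) = \<psi> (R (\<sigma> (s' k)))" for k
      proof -
        have "coord c (\<sigma> (t j)) + (s' k - t j) *\<^sub>R u = ?z + s' k *\<^sub>R u"
          unfolding charts(3)[OF tj] by (simp add: algebra_simps)
        then show ?thesis using R[of "\<sigma> (s' k)"] by (simp add: \<sigma>_def)
      qed
    qed (use s' R in auto)
    then show ?thesis unfolding charts(3)[OF tj] .
  qed
  have lim: "(\<lambda>j. ?z + t j *\<^sub>R u) \<longlonglongrightarrow> ?z"
  proof -
    have "(\<lambda>j. ?z + t j *\<^sub>R u) \<longlonglongrightarrow> ?z + 0 *\<^sub>R u" by (intro tendsto_intros t(2))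
    then show ?thesis by simp
  qed
  have aU: "?a ` ?U \<subseteq> coord m ` dom_of m" using param_coord[OF \<Sigma> c'(1)] by auto
  have az: "?a ?z = coord m (\<alpha> s)" using param_coord[OF \<Sigma> c'] by simp
  have eqD: "ambient_derivative M g \<alpha> c m (\<sigma> (t j)) u u = \<D>\<^sub>2 ?a (?z + t j *\<^sub>R u) u u +
      christoffel M g m (?a (?z + t j *\<^sub>R u)) (\<D> ?a (?z + t j *\<^sub>R u) u) (\<D> ?a (?z + t j *\<^sub>R u) u)" for j
  proof -
    have "t j \<in> T" using t by blast
    from charts(3)[OF this] show ?thesis unfolding ambient_derivative_def Let_def by simp
  qed
  have azm: "?a ?z \<in> coord m ` dom_of m" using m'(2) unfolding az by blast
  have "(\<lambda>j. ambient_derivative M g \<alpha> c m (\<sigma> (t j)) u u) \<longlonglongrightarrow> ambient_derivative M g \<alpha> c m s u u"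
    unfolding eqD unfolding ambient_derivative_def Let_def
    by (intro tendsto_add smooth_on_tendsto_\<D>\<^sub>2[OF s\<alpha>(2) U lim zU] tendsto_christoffel[OF M m'(1) azm]
        smooth_on_tendsto[OF s\<alpha>(2) U lim zU] smooth_on_tendsto_\<D>[OF s\<alpha>(2) U lim zU] tendsto_const)
  then show ?thesis
    by (rule tangential_closed[OF smooth_metric_in_chart[OF M m'(1)] U s\<alpha>(2) aU zU
          immersion_inj[where \<psi> = \<alpha>, OF \<Sigma> c atlas_M m \<alpha>] lim sequentially_bot])
      (use good in \<open>auto intro!: always_eventually\<close>)
qed

text \<open>
  Polarization, since the acceleration is a symmetric bilinear form.
\<close>

theorem intersection_totally_geodesic: "totally_geodesic \<Sigma> M g \<alpha>"
  unfolding totally_geodesic_iff[where \<psi> = \<alpha>, OF \<Sigma> M]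
proof (intro conjI allI ballI)
  show "immersion \<Sigma> M \<alpha>" by (rule \<alpha>)
  fix s c m u v assume c: "c \<in> charts_at \<Sigma> s" and m: "m \<in> charts_at M (\<alpha> s)"
  note c' = charts_atD[OF c] and m' = charts_atD[OF m]
  let ?a = "in_charts c m \<alpha>" and ?z = "coord c s"
  note s\<alpha> = smooth_mapD[OF smooth_maps(2) c'(1) m'(1)]
  have U: "open (chart_dom c m \<alpha>)" by (rule open_chart_dom[OF \<Sigma> c'(1) atlas_M m'(1) s\<alpha>(1)])
  have zU: "?z \<in> chart_dom c m \<alpha>" using c' m' by auto
  have az: "?a ?z \<in> coord m ` dom_of m" using param_coord[OF \<Sigma> c'] m'(2) by auto
  note b = bilinear_christoffel[OF M m'(1) az] and l = smooth_on_linear_\<D>[OF s\<alpha>(2) zU]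
    and b2 = smooth_on_bilinear_\<D>\<^sub>2[OF U s\<alpha>(2) zU]
  let ?D = "ambient_derivative M g \<alpha> c m s"
  have "?D (u + v) (u + v) = ?D u u + ?D v v + 2 *\<^sub>R ?D u v"
    unfolding ambient_derivative_def Let_def
    by (simp add: linear_add[OF l] bilinear_ladd[OF b] bilinear_radd[OF b] bilinear_ladd[OF b2] bilinear_radd[OF b2]
        \<D>\<^sub>2_symmetric[OF U s\<alpha>(2) zU, of v u] christoffel_symmetric[OF M m'(1) az, of "\<D> ?a ?z v" "\<D> ?a ?z u"]
        scaleR_2 algebra_simps del: o_apply)
  then have "?D u v = (1/2) *\<^sub>R (?D (u + v) (u + v) - ?D u u - ?D v v)" by simp
  moreover have "subspace (range (\<D> ?a ?z))" using linear_subspace_image[OF l subspace_UNIV] .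
  ultimately show "?D u v \<in> range (\<D> ?a ?z)"
    using tangential_diagonal[OF c m] by (simp only:) (intro subspace_mul subspace_diff)
qed

end


section \<open>The height function\<close>

lemma has_derivative_linear_compose:
  fixes l :: "'f::euclidean_space \<Rightarrow> 'g::euclidean_space"
  assumes "linear l" "(f has_derivative f') F"
  shows "((\<lambda>x. l (f x)) has_derivative (\<lambda>v. l (f' v))) F"
  using bounded_linear.has_derivative[OF _ assms(2)] assms(1) linear_conv_bounded_linear by blast

lemma smooth_on_linear_compose:
  fixes l :: "'f::euclidean_space \<Rightarrow> 'g::euclidean_space"
  assumes S: "open S" and l: "linear l" and f: "smooth_on S f"
  shows "smooth_on S (\<lambda>x. l (f x))"
    and "x \<in> S \<Longrightarrow> \<D> (\<lambda>x. l (f x)) x u = l (\<D> f x u)"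
    and "x \<in> S \<Longrightarrow> \<D>\<^sub>2 (\<lambda>x. l (f x)) x u v = l (\<D>\<^sub>2 f x u v)"
proof -
  have D: "\<D> (\<lambda>x. l (f x)) x u = l (\<D> f x u)" if "f differentiable (at x)" for f x u
    using \<D>_eqI[OF has_derivative_linear_compose[OF l that[unfolded frechet_derivative_works]]] by simp
  have "Ck_on k S f \<Longrightarrow> Ck_on k S (\<lambda>x. l (f x))" for k f
  proof (induction k arbitrary: f)
    case 0
    then show ?case using linear_continuous_on_compose[OF _ l] by simp
  next
    case (Suc k)
    note d = Suc.prems[unfolded Ck_on.simps]
    have "Ck_on k S (\<lambda>x. \<D> (\<lambda>x. l (f x)) x v)" for v
      by (subst Ck_on_cong[OF S D]) (use d Suc.IH in blast)+
    moreover have "(\<lambda>x. l (f x)) differentiable (at x)" if "x \<in> S" for x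
      using has_derivative_linear_compose[OF l] d that unfolding differentiable_def by blast
    ultimately show ?case by simp
  qed
  then show "smooth_on S (\<lambda>x. l (f x))" using f unfolding smooth_on_def by blast
  show "x \<in> S \<Longrightarrow> \<D> (\<lambda>x. l (f x)) x u = l (\<D> f x u)"
    by (rule D[OF smooth_on_differentiable[OF f]])
  assume x: "x \<in> S"
  have "\<D> (\<lambda>y. \<D> (\<lambda>x. l (f x)) y v) x = \<D> (\<lambda>y. l (\<D> f y v)) x"
    by (rule \<D>_cong[OF S x]) (rule D[OF smooth_on_differentiable[OF f]])
  then show "\<D>\<^sub>2 (\<lambda>x. l (f x)) x u v = l (\<D>\<^sub>2 f x u v)"
    using D[OF smooth_on_differentiable[OF smooth_on_\<D>[OF f] x]] by simp
qed

text \<open>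
  Uniqueness for linear first-order systems.  On a ball of radius \<open>r\<close> with \<open>C r \<le> 1/2\<close> the maximum
  of \<open>norm w\<close> is at most half of itself by the mean value inequality.
\<close>

lemma vanishing_propagates:
  fixes w :: "'e::euclidean_space \<Rightarrow> 'g::euclidean_space"
  assumes R: "0 < R" and w: "\<And>z. z \<in> cball x R \<Longrightarrow> (w has_derivative W z) (at z)" and wx: "w x = 0"
    and bound: "\<And>z u. z \<in> cball x R \<Longrightarrow> norm (W z u) \<le> C * norm (w z) * norm u" and C: "0 \<le> C"
  shows "\<exists>r>0. r \<le> R \<and> (\<forall>z\<in>cball x r. w z = 0)"
proof -
  define r where "r = min R (1 / (2 * (C + 1)))"
  have r: "0 < r" "r \<le> R" "C * r \<le> 1 / 2"
  proof -
    show "0 < r" "r \<le> R" using R C by (auto simp: r_def)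
    have "C * r \<le> C * (1 / (2 * (C + 1)))" using C by (intro mult_left_mono) (auto simp: r_def)
    also have "\<dots> \<le> 1 / 2" using C by (simp add: divide_simps)
    finally show "C * r \<le> 1 / 2" .
  qed
  have w': "(w has_derivative W z) (at z within cball x r)" if "z \<in> cball x r" for z
    by (rule has_derivative_at_withinI[OF w]) (use that r in auto)
  have cont: "continuous_on (cball x r) (\<lambda>z. norm (w z))"
    by (intro continuous_on_norm has_derivative_continuous_on[OF w'])
  have "cball x r \<noteq> {}" using r by auto
  then obtain z where z: "z \<in> cball x r" "\<And>y. y \<in> cball x r \<Longrightarrow> norm (w y) \<le> norm (w z)"
    using continuous_attains_sup[OF compact_cball _ cont] by blast
  have "norm (w z - w x) \<le> C * norm (w z) * norm (z - x)"
  proof (rule differentiable_bound[OF convex_cball w' _ z(1)])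
    show "onorm (W y) \<le> C * norm (w z)" if y: "y \<in> cball x r" for y
    proof (rule onorm_le)
      fix u
      have "norm (W y u) \<le> C * norm (w y) * norm u" by (rule bound) (use y r in auto)
      also have "\<dots> \<le> C * norm (w z) * norm u" by (intro mult_right_mono mult_left_mono z(2) y C) auto
      finally show "norm (W y u) \<le> C * norm (w z) * norm u" .
    qed
  qed (use r in auto)
  also have "\<dots> \<le> C * norm (w z) * r"
    using z(1) C by (intro mult_left_mono) (auto simp: dist_norm norm_minus_commute)
  also have "\<dots> = (C * r) * norm (w z)" by simp
  also have "\<dots> \<le> 1 / 2 * norm (w z)" by (intro mult_right_mono r) auto
  finally have "norm (w z) \<le> 0" by (simp add: wx)
  then have "\<forall>y\<in>cball x r. w y = 0" using z(2) by fastforce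
  then show ?thesis using r by blast
qed

text \<open>
  The equation says that the Hessian of \<open>h\<close> vanishes with respect to a connection with coefficients
  \<open>k\<close>.  Continuity of \<open>k\<close> at \<open>x\<close> bounds it near \<open>x\<close>, so the gradient \<open>w\<close> of \<open>h\<close> satisfies the differential
  inequality of \<open>vanishing_propagates\<close>.
\<close>

lemma hessian_vanishing_propagates:
  fixes h :: "'e::euclidean_space \<Rightarrow> real"
  assumes h: "open S" "smooth_on S h" and x: "x \<in> S" "\<And>u. \<D> h x u = 0"
    and k: "\<And>z u v. z \<in> S \<Longrightarrow> \<D>\<^sub>2 h z u v = \<D> h z (k z u v)"
    and lim: "\<And>u v. ((\<lambda>z. k z u v) \<longlongrightarrow> k x u v) (nhds x)"
  shows "\<exists>r>0. ball x r \<subseteq> S \<and> (\<forall>z\<in>ball x r. h z = h x)"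
proof -
  \<comment> \<open>A common bound, near \<open>x\<close>, for the coefficient vectors at all pairs of basis vectors.\<close>
  define K where "K = (\<Sum>u\<in>Basis. \<Sum>v\<in>Basis. norm (k x u v) + 1)"
  have le_K: "norm (k x u v) + 1 \<le> K" if "u \<in> Basis" "v \<in> Basis" for u v
  proof -
    have "norm (k x u v) + 1 \<le> (\<Sum>v\<in>Basis. norm (k x u v) + 1)"
      by (rule member_le_sum[OF that(2)]) auto
    also have "\<dots> \<le> K" unfolding K_def by (rule member_le_sum[OF that(1)]) (auto intro!: sum_nonneg)
    finally show ?thesis .
  qed
  have K0: "0 \<le> K" unfolding K_def by (intro sum_nonneg) auto
  have "\<forall>\<^sub>F z in nhds x. norm (k z u v) < norm (k x u v) + 1" for u v
    by (rule order_tendstoD(2)[OF tendsto_norm[OF lim]]) simp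
  then have "\<forall>\<^sub>F z in nhds x. \<forall>u\<in>Basis. \<forall>v\<in>Basis. norm (k z u v) < norm (k x u v) + 1"
    by (intro eventually_ball_finite finite_Basis ballI)
  moreover have "\<forall>\<^sub>F z in nhds x. z \<in> S" using h(1) x(1) by (rule eventually_nhds_in_open)
  ultimately have "\<forall>\<^sub>F z in nhds x. z \<in> S \<and> (\<forall>u\<in>Basis. \<forall>v\<in>Basis. norm (k z u v) \<le> K)"
    by eventually_elim (use le_K in fastforce)
  then obtain e where e: "0 < e" "\<And>z. dist z x < e \<Longrightarrow> z \<in> S \<and> (\<forall>u\<in>Basis. \<forall>v\<in>Basis. norm (k z u v) \<le> K)"
    unfolding eventually_nhds_metric by blast
  \<comment> \<open>\<open>w\<close> is the gradient of \<open>h\<close> and \<open>W\<close> its derivative.\<close>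
  define w where "w z = (\<Sum>v\<in>Basis. \<D> h z v *\<^sub>R v)" for z
  define W where "W z u = (\<Sum>v\<in>Basis. \<D>\<^sub>2 h z u v *\<^sub>R v)" for z u
  have wD: "\<D> h z u = w z \<bullet> u" if "z \<in> S" for z u
  proof -
    have "\<D> h z u = (\<Sum>b\<in>Basis. (u \<bullet> b) *\<^sub>R \<D> h z b)" by (rule linear_expand[OF smooth_on_linear_\<D>[OF h(2) that]])
    then show ?thesis by (simp add: w_def inner_sum_left inner_commute[of u] mult.commute)
  qed
  have "\<exists>r>0. r \<le> e / 2 \<and> (\<forall>z\<in>cball x r. w z = 0)"
  proof (rule vanishing_propagates)
    fix z assume "z \<in> cball x (e / 2)"
    then have z: "z \<in> S" "\<And>u v. u \<in> Basis \<Longrightarrow> v \<in> Basis \<Longrightarrow> norm (k z u v) \<le> K"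
      using e(2)[of z] e(1) by (auto simp: dist_commute)
    show "(w has_derivative W z) (at z)"
      unfolding w_def W_def
      by (intro has_derivative_sum has_derivative_scaleR_left smooth_on_has_derivative[OF smooth_on_\<D>[OF h(2)] z(1)])
    have b2: "bilinear (\<D>\<^sub>2 h z)" by (rule smooth_on_bilinear_\<D>\<^sub>2[OF h z(1)])
    show "norm (W z u) \<le> (real DIM('e) * (real DIM('e) * K)) * norm (w z) * norm u" for u
    proof -
      have bas: "\<bar>\<D>\<^sub>2 h z b v\<bar> \<le> norm (w z) * K" if "b \<in> Basis" "v \<in> Basis" for b v
      proof -
        have "\<bar>\<D>\<^sub>2 h z b v\<bar> \<le> norm (w z) * norm (k z b v)"
          unfolding k[OF z(1)] wD[OF z(1)] by (rule Cauchy_Schwarz_ineq2)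
        also have "\<dots> \<le> norm (w z) * K" by (intro mult_left_mono z(2) that) auto
        finally show ?thesis .
      qed
      have "\<bar>\<D>\<^sub>2 h z u v\<bar> \<le> real DIM('e) * K * norm (w z) * norm u" if v: "v \<in> Basis" for v
      proof -
        have "\<bar>\<D>\<^sub>2 h z u v\<bar> = \<bar>\<Sum>b\<in>Basis. (u \<bullet> b) *\<^sub>R \<D>\<^sub>2 h z b v\<bar>"
          by (subst linear_expand[of "\<lambda>u. \<D>\<^sub>2 h z u v"]) (use b2 in \<open>auto simp: bilinear_def\<close>)
        also have "\<dots> \<le> (\<Sum>b\<in>(Basis :: 'e set). norm u * (norm (w z) * K))"
          by (intro order_trans[OF sum_abs] sum_mono) (auto simp: abs_mult intro!: mult_mono Basis_le_norm bas v)
        finally show ?thesis by (simp add: algebra_simps)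
      qed
      then have "norm (W z u) \<le> (\<Sum>v\<in>(Basis :: 'e set). real DIM('e) * K * norm (w z) * norm u)"
        unfolding W_def by (intro order_trans[OF norm_sum] sum_mono) simp
      then show ?thesis by (simp add: algebra_simps)
    qed
  next
    show "w x = 0" by (simp add: w_def x(2))
  qed (use e K0 in auto)
  then obtain r where r: "0 < r" "r \<le> e / 2" "\<And>z. z \<in> cball x r \<Longrightarrow> w z = 0" by blast
  have inS: "z \<in> S" if "z \<in> ball x r" for z using e(2)[of z] e(1) r(1,2) that by (auto simp: dist_commute)
  have "(h has_derivative (\<lambda>u. 0)) (at y within ball x r)" if y: "y \<in> ball x r" for y
  proof -
    have "\<D> h y = (\<lambda>u. 0)" using wD[OF inS[OF y]] r(3)[of y] y by auto
    then show ?thesis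
      using has_derivative_at_withinI[OF smooth_on_has_derivative[OF h(2) inS[OF y]]] by simp
  qed
  then have "h z = h x" if "z \<in> ball x r" for z
    using has_derivative_zero_unique[OF convex_ball, of x r h z x] that r(1) by simp
  then show ?thesis using r inS by blast
qed

lemma mono_logarithmic_derivative:
  fixes f :: "real \<Rightarrow> real"
  assumes f: "smooth_on UNIV f" "\<And>t. f t > 0" and H: "\<And>t. deriv (\<lambda>t. deriv f t / f t) t \<ge> 0"
  shows "mono (\<lambda>t. deriv f t / f t)"
proof (rule monoI)
  let ?H = "\<lambda>t. deriv f t / f t"
  have eq: "deriv f = (\<lambda>t. \<D> f t 1)" using smooth_on_has_real_derivative(2)[OF f(1)] by auto
  have d: "(?H has_real_derivative deriv ?H t) (at t)" for t
  proof -
    have "(deriv f has_real_derivative deriv (deriv f) t) (at t)"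
      by (rule smooth_on_has_real_derivative(1)[where S = UNIV]) (simp_all add: eq smooth_on_\<D>[OF f(1)])
    moreover have "(f has_real_derivative deriv f t) (at t)"
      by (rule smooth_on_has_real_derivative(1)[OF f(1)]) simp
    moreover have "f t \<noteq> 0" using f(2)[of t] by simp
    ultimately have "\<exists>D. (?H has_real_derivative D) (at t)" using DERIV_divide by blast
    then show ?thesis using DERIV_imp_deriv by blast
  qed
  fix x y :: real assume "x \<le> y"
  then show "?H x \<le> ?H y"
    by (rule DERIV_nonneg_imp_nondecreasing) (use d H in blast)
qed

locale totally_geodesic_in_warped_product =
  fixes P :: "('c::{t2_space,second_countable_topology}, 'p::euclidean_space) chart set"
    and gP :: "('c, 'p) metric" and f :: "real \<Rightarrow> real"
    and \<Sigma> :: "('s::{t2_space,second_countable_topology}, 'j::euclidean_space) chart set"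
    and \<alpha> :: "'s \<Rightarrow> real \<times> 'c"
  assumes P: "riemannian_manifold P gP" and f: "smooth_on UNIV f" "\<And>t. f t > 0"
    and \<Sigma>: "smooth_atlas \<Sigma>"
    and geodesic: "totally_geodesic \<Sigma> (line_prod_atlas P) (warped_metric f P gP) \<alpha>"
begin

abbreviation "M \<equiv> line_prod_atlas P"
abbreviation "g \<equiv> warped_metric f P gP"

lemma atlas_P: "smooth_atlas P" and riemannian_M: "riemannian_manifold M g"
  and immersion_\<alpha>: "immersion \<Sigma> M \<alpha>" and smooth_\<alpha>: "smooth_map \<Sigma> M \<alpha>"
  using P warped_metric_riemannian[OF P f] geodesic
  by (auto simp: riemannian_manifold_def totally_geodesic_def immersion_def)

lemma atlas_M: "smooth_atlas M" by (rule smooth_atlas_line_prod[OF atlas_P])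

text \<open>
  The first component of the equation that expresses the acceleration as a tangent vector.  On the right, the last term is the correction that turns
  the second derivative of the height in coordinates into its Hessian.
\<close>

lemma hessian_height:
  assumes c: "c \<in> charts_at \<Sigma> s" and p: "p \<in> charts_at P (snd (\<alpha> s))"
    and k: "ambient_derivative M g \<alpha> c (line_chart p) s u v = \<D> (in_charts c (line_chart p) \<alpha>) (coord c s) k"
  shows "fst (\<D>\<^sub>2 (in_charts c (line_chart p) \<alpha>) (coord c s) u v) =
    f (fst (\<alpha> s)) * deriv f (fst (\<alpha> s)) * metric_in_chart P gP p (coord p (snd (\<alpha> s)))
      (snd (\<D> (in_charts c (line_chart p) \<alpha>) (coord c s) u)) (snd (\<D> (in_charts c (line_chart p) \<alpha>) (coord c s) v))
    + fst (\<D> (in_charts c (line_chart p) \<alpha>) (coord c s) k)"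
proof -
  note c' = charts_atD[OF c] and p' = charts_atD[OF p]
  have az: "in_charts c (line_chart p) \<alpha> (coord c s) = (fst (\<alpha> s), coord p (snd (\<alpha> s)))"
    using param_coord[OF \<Sigma> c'] by simp
  have "snd (fst (\<alpha> s), coord p (snd (\<alpha> s))) \<in> coord p ` dom_of p" using p'(2) by simp
  note \<Gamma> = christoffel_warped_fst[OF P f p'(1) this]
  show ?thesis
    using arg_cong[OF k, of fst] unfolding ambient_derivative_def Let_def az fst_add \<Gamma> by simp
qed

context
  fixes s c p
  assumes c: "c \<in> charts_at \<Sigma> s" and p: "p \<in> charts_at P (snd (\<alpha> s))"
begin

abbreviation "a \<equiv> in_charts c (line_chart p) \<alpha>"
abbreviation "U \<equiv> chart_dom c (line_chart p) \<alpha>"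

lemma line_chart_at: "line_chart p \<in> charts_at M (\<alpha> s)"
  using charts_atD[OF p] by (auto simp: charts_at_def line_prod_atlas_eq mem_Times_iff)

lemma open_U: "open U" and smooth_a: "smooth_on U a" and z_in_U: "coord c s \<in> U"
  using smooth_mapD[OF smooth_\<alpha> charts_atD(1)[OF c] charts_atD(1)[OF line_chart_at]]
    open_chart_dom[OF \<Sigma> charts_atD(1)[OF c] atlas_M charts_atD(1)[OF line_chart_at]]
    charts_atD(2)[OF c] charts_atD(2)[OF line_chart_at] by auto

lemma inj_a: "inj (\<D> a (coord c s))"
  by (rule immersion_inj[where \<psi> = \<alpha>, OF \<Sigma> c atlas_M line_chart_at immersion_\<alpha>])

text \<open>
  The factor \<open>\<epsilon>\<close> treats maxima (\<open>\<epsilon> = 1\<close>) and minima (\<open>\<epsilon> = -1\<close>) at once.  As \<open>dh = 0\<close>, a vector \<open>u \<noteq> 0\<close>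
  tangent to \<open>\<Sigma>\<close> has a nonzero component in \<open>P\<close>, so the sign of the Hessian is that of \<open>f'\<close>.
\<close>

lemma height_extremum:
  fixes \<epsilon> :: real
  assumes \<epsilon>: "\<epsilon> \<noteq> 0" and max: "\<And>x. \<epsilon> * fst (\<alpha> x) \<le> \<epsilon> * fst (\<alpha> s)"
  shows "fst (\<D> a (coord c s) u) = 0" "\<epsilon> * deriv f (fst (\<alpha> s)) \<le> 0"
proof -
  let ?z = "coord c s"
  have l: "linear (\<lambda>x :: real \<times> 'p. \<epsilon> * fst x)" by (rule linearI) (auto simp: algebra_simps)
  note h = smooth_on_linear_compose[OF open_U l smooth_a]
  have "\<epsilon> * fst (a y) \<le> \<epsilon> * fst (a ?z)" for y
    using max[of "param c y"] param_coord[OF \<Sigma> charts_atD[OF c]] by simp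
  note m = second_derivative_nonpos_at_max[OF open_U h(1) z_in_U this]
  have D0: "fst (\<D> a ?z u) = 0" for u using m(1)[of u] \<epsilon> unfolding h(2)[OF z_in_U] by simp
  then show "fst (\<D> a ?z u) = 0" .
  obtain u :: 'j where u: "u \<noteq> 0" using nonempty_Basis nonzero_Basis by blast
  obtain k where k: "ambient_derivative M g \<alpha> c (line_chart p) s u u = \<D> a ?z k"
    using geodesic c line_chart_at unfolding totally_geodesic_iff[where \<psi> = \<alpha>, OF \<Sigma> riemannian_M] by blast
  let ?G = "metric_in_chart P gP p (coord p (snd (\<alpha> s))) (snd (\<D> a ?z u)) (snd (\<D> a ?z u))"
  have "\<D> a ?z u \<noteq> 0"
    using inj_a u smooth_on_linear_\<D>[OF smooth_a z_in_U] linear_injective_0 by blast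
  then have "snd (\<D> a ?z u) \<noteq> 0" using D0[of u] by (simp add: prod_eq_iff)
  then have G: "0 < ?G"
    using smooth_metricD(2)[OF smooth_metric_in_chart[OF P charts_atD(1)[OF p]]] charts_atD(2)[OF p]
    unfolding pos_def_def by blast
  have "\<epsilon> * (f (fst (\<alpha> s)) * deriv f (fst (\<alpha> s)) * ?G) \<le> 0"
    using m(2)[of u] unfolding h(3)[OF z_in_U] hessian_height[OF c p k] D0 by simp
  then have "(\<epsilon> * deriv f (fst (\<alpha> s))) * (f (fst (\<alpha> s)) * ?G) \<le> 0" by (simp only: mult_ac)
  then show "\<epsilon> * deriv f (fst (\<alpha> s)) \<le> 0"
    using mult_pos_pos[OF f(2) G] by (metis mult_le_0_iff not_less)
qed

text \<open>
  With \<open>f' = 0\<close> the Hessian of the height vanishes.  The coefficients \<open>k\<close> of the acceleration are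
  continuous by \<open>tangential_coefficients_tendsto\<close>.
\<close>

lemma height_locally_constant:
  assumes crit: "\<And>u. fst (\<D> a (coord c s) u) = 0" and flat: "\<And>x. deriv f (fst (\<alpha> x)) = 0"
  shows "\<exists>V. open V \<and> s \<in> V \<and> (\<forall>x\<in>V. fst (\<alpha> x) = fst (\<alpha> s))"
proof -
  let ?z = "coord c s" and ?G = "metric_in_chart M g (line_chart p)"
  note c' = charts_atD[OF c] and m' = charts_atD[OF line_chart_at]
  have l: "linear (fst :: real \<times> 'p \<Rightarrow> real)" by (rule linearI) auto
  note h = smooth_on_linear_compose[OF open_U l smooth_a]
  let ?V = "\<lambda>z u v. \<D>\<^sub>2 a z u v + christoffel M g (line_chart p) (a z) (\<D> a z u) (\<D> a z v)"
  have pt: "c \<in> charts_at \<Sigma> (param c z)" "p \<in> charts_at P (snd (\<alpha> (param c z)))"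
    "line_chart p \<in> charts_at M (\<alpha> (param c z))" "coord c (param c z) = z"
    "ambient_derivative M g \<alpha> c (line_chart p) (param c z) u v = ?V z u v" if z: "z \<in> U" for z u v
  proof -
    have z': "z \<in> coord c ` dom_of c" "param c z \<in> \<alpha> -` dom_of (line_chart p)"
      using z coord_image_mem[OF \<Sigma> c'(1)] by blast+
    note cp = coord_param[OF \<Sigma> c'(1) z'(1)]
    show "c \<in> charts_at \<Sigma> (param c z)" "p \<in> charts_at P (snd (\<alpha> (param c z)))"
      "line_chart p \<in> charts_at M (\<alpha> (param c z))" "coord c (param c z) = z"
      using cp c'(1) z'(2) charts_atD(1)[OF p] m'(1) by (auto simp: charts_at_def mem_Times_iff)
    show "ambient_derivative M g \<alpha> c (line_chart p) (param c z) u v = ?V z u v"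
      unfolding ambient_derivative_def Let_def cp(1) ..
  qed
  define k where "k z u v = (SOME k. ?V z u v = \<D> a z k)" for z u v
  have k: "?V z u v = \<D> a z (k z u v)" if z: "z \<in> U" for z u v
  proof -
    have "?V z u v \<in> range (\<D> a z)"
      using geodesic pt[OF z] unfolding totally_geodesic_iff[where \<psi> = \<alpha>, OF \<Sigma> riemannian_M] by metis
    then show ?thesis unfolding k_def by (auto intro: someI)
  qed
  have lim: "((\<lambda>z. k z u v) \<longlongrightarrow> k ?z u v) (nhds ?z)" for u v
  proof (rule tangential_coefficients_tendsto[OF smooth_metric_in_chart[OF riemannian_M m'(1)] open_U smooth_a _ z_in_U inj_a])
    show aU: "a ` U \<subseteq> coord (line_chart p) ` dom_of (line_chart p)" using param_coord[OF \<Sigma> c'(1)] by auto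
    show id: "((\<lambda>z. z) \<longlongrightarrow> ?z) (nhds ?z)" by (rule filterlim_ident)
    have az: "a ?z \<in> coord (line_chart p) ` dom_of (line_chart p)" using aU z_in_U by blast
    show "((\<lambda>z. ?V z u v) \<longlongrightarrow> ?V ?z u v) (nhds ?z)"
      by (intro tendsto_add smooth_on_tendsto_\<D>\<^sub>2[OF smooth_a open_U id z_in_U] tendsto_christoffel[OF riemannian_M m'(1) az]
        smooth_on_tendsto[OF smooth_a open_U id z_in_U] smooth_on_tendsto_\<D>[OF smooth_a open_U id z_in_U] tendsto_const)
    show "\<forall>\<^sub>F z in nhds ?z. ?V z u v = \<D> a z (k z u v)"
      using eventually_nhds_in_open[OF open_U z_in_U] by eventually_elim (rule k)
    show "?G (a ?z) (\<D> a ?z (k ?z u v)) (\<D> a ?z w) = ?G (a ?z) (?V ?z u v) (\<D> a ?z w)" for w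
      unfolding k[OF z_in_U] ..
  qed
  have "\<exists>r>0. ball ?z r \<subseteq> U \<and> (\<forall>y\<in>ball ?z r. fst (a y) = fst (a ?z))"
  proof (rule hessian_vanishing_propagates[OF open_U h(1) z_in_U _ _ lim])
    show "\<D> (\<lambda>x. fst (a x)) ?z u = 0" for u unfolding h(2)[OF z_in_U] by (rule crit)
    show "\<D>\<^sub>2 (\<lambda>x. fst (a x)) z u v = \<D> (\<lambda>x. fst (a x)) z (k z u v)" if z: "z \<in> U" for z u v
    proof -
      have "ambient_derivative M g \<alpha> c (line_chart p) (param c z) u v = \<D> a (coord c (param c z)) (k z u v)"
        unfolding pt[OF z] by (rule k[OF z])
      from hessian_height[OF pt(1,2)[OF z] this] show ?thesis
        unfolding h(2,3)[OF z] pt(4)[OF z] flat by simp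
    qed
  qed
  then obtain r where r: "0 < r" "\<And>y. y \<in> ball ?z r \<Longrightarrow> fst (a y) = fst (a ?z)" by blast
  let ?V = "dom_of c \<inter> coord c -` ball ?z r"
  have "open ?V"
    by (rule continuous_open_preimage[OF homeomorphism_cont1[OF smooth_atlas_homeomorphism(3)[OF \<Sigma> c'(1)]]
        smooth_atlas_homeomorphism(1)[OF \<Sigma> c'(1)] open_ball])
  moreover have "s \<in> ?V" using c'(2) r(1) by simp
  moreover have "fst (\<alpha> x) = fst (\<alpha> s)" if x: "x \<in> ?V" for x
    using r(2)[of "coord c x"] x param_coord[OF \<Sigma> c'(1)] c'(2) by simp
  ultimately show ?thesis by blast
qed

end

theorem height_constant:
  assumes top: "connected (UNIV :: 's set)" "compact (UNIV :: 's set)"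
    and H: "mono (\<lambda>t. deriv f t / f t)"
  shows "\<exists>t. \<forall>x. fst (\<alpha> x) = t"
proof -
  let ?h = "\<lambda>x. fst (\<alpha> x)"
  have cont: "continuous_on UNIV ?h"
    using smooth_\<alpha> by (auto simp: smooth_map_def intro: continuous_on_fst)
  obtain s1 where s1: "\<And>x. ?h x \<le> ?h s1" using continuous_attains_sup[OF top(2) _ cont] by auto
  obtain s0 where s0: "\<And>x. ?h s0 \<le> ?h x" using continuous_attains_inf[OF top(2) _ cont] by auto
  have charts: "\<exists>c p. c \<in> charts_at \<Sigma> s \<and> p \<in> charts_at P (snd (\<alpha> s))" for s
    using charts_at_nonempty[OF \<Sigma>] charts_at_nonempty[OF atlas_P] by blast
  have "deriv f (?h s1) \<le> 0" using charts[of s1] height_extremum(2)[of _ s1 _ 1] s1 by auto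
  moreover have "0 \<le> deriv f (?h s0)" using charts[of s0] height_extremum(2)[of _ s0 _ "-1"] s0 by auto
  ultimately have "deriv f (?h x) / f (?h x) \<le> 0" "0 \<le> deriv f (?h x) / f (?h x)" for x
    using monoD[OF H s1[of x]] monoD[OF H s0[of x]] f(2)[of "?h s1"] f(2)[of "?h s0"]
    by (meson divide_nonneg_pos divide_nonpos_pos order_trans)+
  then have flat: "deriv f (?h x) = 0" for x
    using f(2)[of "?h x"] by (metis antisym divide_eq_0_iff less_irrefl)
  define Z where "Z = {x. ?h x = ?h s1}"
  have "open Z"
  proof (rule topological_space_class.openI)
    fix x assume x: "x \<in> Z"
    obtain c p where cp: "c \<in> charts_at \<Sigma> x" "p \<in> charts_at P (snd (\<alpha> x))" using charts by blast
    have "fst (\<D> (in_charts c (line_chart p) \<alpha>) (coord c x) u) = 0" for u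
      by (rule height_extremum(1)[OF cp, of 1]) (use x s1 in \<open>auto simp: Z_def\<close>)
    from height_locally_constant[OF cp this flat] show "\<exists>V. open V \<and> x \<in> V \<and> V \<subseteq> Z"
      using x unfolding Z_def by auto
  qed
  moreover have "open (- Z)"
    unfolding Z_def by (intro open_Compl closed_Collect_eq cont continuous_on_const)
  moreover have "s1 \<in> Z" by (simp add: Z_def)
  ultimately have "- Z = {}"
    using connectedD[OF top(1), of Z "- Z"] by auto
  then have "\<forall>x. ?h x = ?h s1" unfolding Z_def by blast
  then show ?thesis by blast
qed

end


section \<open>The slice\<close>

text \<open>
  Invariance of domain, read in charts.
\<close>

lemma injective_map_open_range:
  fixes A :: "('a::{t2_space,second_countable_topology}, 'e::euclidean_space) chart set"
    and B :: "('b::{t2_space,second_countable_topology}, 'f::euclidean_space) chart set"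
  assumes A: "smooth_atlas A" and B: "smooth_atlas B" and dim: "DIM('e) = DIM('f)"
    and \<beta>: "continuous_on UNIV \<beta>" "inj \<beta>"
  shows "open (range (\<beta> :: 'a \<Rightarrow> 'b))"
proof (rule topological_space_class.openI)
  fix x assume "x \<in> range \<beta>"
  then obtain s where s: "x = \<beta> s" by blast
  obtain c where "c \<in> charts_at A s" using charts_at_nonempty[OF A] by blast
  note c = charts_atD[OF this]
  obtain d where "d \<in> charts_at B (\<beta> s)" using charts_at_nonempty[OF B] by blast
  note d = charts_atD[OF this]
  note hc = smooth_atlas_homeomorphism[OF A c(1)] and hd = smooth_atlas_homeomorphism[OF B d(1)]
  let ?F = "in_charts c d \<beta>" and ?V = "chart_dom c d \<beta>"
  have V: "open ?V" by (rule open_chart_dom[OF A c(1) B d(1) \<beta>(1)])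
  have V_iff: "z \<in> coord c ` dom_of c" "\<beta> (param c z) \<in> dom_of d" if "z \<in> ?V" for z
    using that param_coord[OF A c(1)] by auto
  have "continuous_on ?V (param c)"
    by (rule continuous_on_subset[OF homeomorphism_cont2[OF hc(3)]]) auto
  then have "continuous_on ?V (\<lambda>z. \<beta> (param c z))"
    by (rule continuous_on_compose2[OF \<beta>(1)]) simp
  then have cont: "continuous_on ?V ?F"
    unfolding o_def by (rule continuous_on_compose2[OF homeomorphism_cont1[OF hd(3)]]) (use V_iff in auto)
  have inj: "inj_on ?F ?V"
  proof (rule inj_onI)
    fix y z assume yz: "y \<in> ?V" "z \<in> ?V" "?F y = ?F z"
    have "param d (coord d (\<beta> (param c y))) = param d (coord d (\<beta> (param c z)))"
      by (rule arg_cong[of _ _ "param d"]) (use yz(3) in \<open>simp only: o_apply\<close>)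
    then have "\<beta> (param c y) = \<beta> (param c z)"
      by (simp only: param_coord[OF B d(1) V_iff(2)[OF yz(1)]] param_coord[OF B d(1) V_iff(2)[OF yz(2)]])
    then have "param c y = param c z" using \<beta>(2) by (simp add: inj_eq)
    then show "y = z"
      using coord_param(1)[OF A c(1) V_iff(1)[OF yz(1)]] coord_param(1)[OF A c(1) V_iff(1)[OF yz(2)]] by metis
  qed
  have FV: "open (?F ` ?V)" using invariance_of_domain_gen[OF V cont inj] dim by simp
  let ?W = "dom_of d \<inter> coord d -` (?F ` ?V)"
  have "open ?W" by (rule continuous_open_preimage[OF homeomorphism_cont1[OF hd(3)] hd(1) FV])
  moreover have "x \<in> ?W"
  proof -
    have "coord c s \<in> ?V" using c(2) d(2) by auto
    moreover have "coord d x = ?F (coord c s)" using s param_coord[OF A c] by simp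
    ultimately show ?thesis using d(2) s by blast
  qed
  moreover have "?W \<subseteq> range \<beta>"
  proof
    fix y assume "y \<in> ?W"
    then obtain z where z: "y \<in> dom_of d" "z \<in> ?V" "coord d y = ?F z" by blast
    have "param d (coord d y) = param d (coord d (\<beta> (param c z)))"
      by (rule arg_cong[of _ _ "param d"]) (use z(3) in \<open>simp only: o_apply\<close>)
    then have "y = \<beta> (param c z)"
      by (simp only: param_coord[OF B d(1) z(1)] param_coord[OF B d(1) V_iff(2)[OF z(2)]])
    then show "y \<in> range \<beta>" by blast
  qed
  ultimately show "\<exists>T. open T \<and> x \<in> T \<and> T \<subseteq> range \<beta>" by blast
qed

theorem corollary2:
  fixes n :: nat
    and Mbar :: "('b::{t2_space,second_countable_topology}, 'f::euclidean_space) chart set"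
    and gbar :: "('b, 'f) metric"
    and N :: "('n::{t2_space,second_countable_topology}, 'l::euclidean_space) chart set"
    and \<psi> :: "'n \<Rightarrow> 'b"
    and P :: "('c::{t2_space,second_countable_topology}, 'p::euclidean_space) chart set"
    and gP :: "('c, 'p) metric"
    and f :: "real \<Rightarrow> real"
    and \<H> :: "real \<Rightarrow> real"
    and \<phi> :: "real \<times> 'c \<Rightarrow> 'b"
    and \<Sigma> :: "('s::{t2_space,second_countable_topology}, 'j::euclidean_space) chart set"
    and \<alpha> :: "'s \<Rightarrow> real \<times> 'c"
  assumes dims: "DIM('f) = n + 1" "DIM('l) = n" "DIM('p) = n - 1" "DIM('j) = n - 1"
    and Mbar: "riemannian_manifold Mbar gbar"
    and N: "smooth_atlas N" "totally_geodesic N Mbar gbar \<psi>"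
    and P: "riemannian_manifold P gP" "connected (UNIV :: 'c set)"
    and f: "smooth_on UNIV f" "\<And>t. f t > 0"
    and H: "\<And>t. \<H> t = deriv f t / f t" "\<And>t. deriv \<H> t \<ge> 0"
    and M: "isometric_immersion (line_prod_atlas P) (warped_metric f P gP) Mbar gbar \<phi>"
    and \<Sigma>: "smooth_atlas \<Sigma>" "connected (UNIV :: 's set)" "compact (UNIV :: 's set)"
    and normal: "normal_submanifolds Mbar gbar (line_prod_atlas P) \<phi> N \<psi> \<Sigma> \<alpha>"
  shows "(\<exists>t. range \<alpha> = slice t)
       \<and> totally_geodesic \<Sigma> (line_prod_atlas P) (warped_metric f P gP) \<alpha>
       \<and> compact (UNIV :: 'c set)"
proof -
  have \<alpha>: "immersion \<Sigma> (line_prod_atlas P) \<alpha>" "immersion \<Sigma> Mbar (\<phi> \<circ> \<alpha>)" "inj \<alpha>"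
    using normal by (auto simp: normal_submanifolds_def)
  have atlas_P: "smooth_atlas P" using P(1) by (simp add: riemannian_manifold_def)
  have geodesic: "totally_geodesic \<Sigma> (line_prod_atlas P) (warped_metric f P gP) \<alpha>"
  proof -
    interpret normal_intersection "line_prod_atlas P" "warped_metric f P gP" Mbar gbar \<phi> \<Sigma> \<alpha> N \<psi>
      by unfold_locales (use warped_metric_riemannian[OF P(1) f] Mbar M \<Sigma>(1) \<alpha> N normal in auto)
    show ?thesis by (rule intersection_totally_geodesic)
  qed
  have "\<H> = (\<lambda>t. deriv f t / f t)" using H(1) by blast
  then have mono: "mono (\<lambda>t. deriv f t / f t)" using mono_logarithmic_derivative[OF f] H(2) by simp
  have "totally_geodesic_in_warped_product P gP f \<Sigma> \<alpha>"
    by unfold_locales (use P(1) f \<Sigma>(1) geodesic in auto)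
  then obtain t where t: "\<And>x. fst (\<alpha> x) = t"
    using totally_geodesic_in_warped_product.height_constant[OF _ \<Sigma>(2,3) mono] by blast
  have cont: "continuous_on UNIV \<alpha>" using \<alpha>(1) by (simp add: immersion_def smooth_map_def)
  let ?\<beta> = "\<lambda>x. snd (\<alpha> x)"
  have \<beta>: "continuous_on UNIV ?\<beta>" using continuous_on_snd[OF cont] .
  have "inj ?\<beta>" using \<alpha>(3) t by (auto simp: inj_def prod_eq_iff)
  then have op: "open (range ?\<beta>)"
    using injective_map_open_range[OF \<Sigma>(1) atlas_P _ \<beta>] dims by simp
  have comp: "compact (range ?\<beta>)" by (rule compact_continuous_image[OF \<beta> \<Sigma>(3)])
  then have "open (- range ?\<beta>)" using compact_imp_closed by blast
  with op have "- range ?\<beta> = {}" using connectedD[OF P(2), of "range ?\<beta>" "- range ?\<beta>"] by auto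
  then have surj: "range ?\<beta> = UNIV" by blast
  have "range \<alpha> = slice t"
  proof
    show "range \<alpha> \<subseteq> slice t" by (simp add: image_subset_iff slice_def mem_Times_iff t)
    show "slice t \<subseteq> range \<alpha>"
    proof
      fix x :: "real \<times> 'c" assume x: "x \<in> slice t"
      obtain s where "snd x = snd (\<alpha> s)" using surj by (metis UNIV_I imageE)
      then have "x = \<alpha> s" using x t by (simp add: slice_def mem_Times_iff prod_eq_iff)
      then show "x \<in> range \<alpha>" by blast
    qed
  qed
  then show ?thesis using geodesic comp surj by auto
qed

end
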